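(* Let $\mathbb{K}\in\{\mathbb{R},\mathbb{C},\mathbb{H}\}$, $\delta=\dim_{\mathbb{R}}\mathbb{K}$, $m\ge 2$, $p\in 2\mathbb{N}$, and set $\alpha=\frac{\delta(m-1)-2}{2}$, $\beta=\frac{\delta-2}{2}$. Let $\xi$ be the largest root of the Jacobi polynomial $P^{(\alpha+1,\beta+1)}_{p/2}(t)$ and $\varepsilon=(1-\xi)/2$. Then the number $n$ of nodes of every projective cubature formula of index $p$ on $S^{\delta m-1}\subset\mathbb{K}^m$ satisfies \[ n\ \ge\ \frac{\Gamma(\alpha+2)\Gamma(\beta+1)}{\Gamma(\alpha+\beta+2)\,F(-\beta,\alpha+1;\alpha+2;\varepsilon)}\left(\frac{1}{\varepsilon}\right)^{\delta(m-1)/2}, \] where $F={}_2F_1$ is the Gauss hypergeometric function.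
   Context: $\mathbb{H}$ denotes the quaternions; $\delta=1,2,4$ for $\mathbb{R},\mathbb{C},\mathbb{H}$. Identify $\mathbb{K}^m\cong\mathbb{R}^{\delta m}$ with standard inner product $(x,y)=\sum_i\bar x_iy_i$; $S=S^{\delta m-1}$ is its unit sphere and $\sigma$ the normalized rotation-invariant surface measure on $S$. $\Phi_{\mathbb{K}}(m,p)$ is the space of complex-valued functions on $S$ which are restrictions of homogeneous polynomials $\psi$ of degree $p$ on $\mathbb{R}^{\delta m}$ (complex coefficients) satisfying $\psi(w\lambda)=\psi(w)$ for all $w\in\mathbb{K}^m$ and $\lambda\in\mathbb{K}$ with $|\lambda|=1$. A projective cubature formula of index $p$ on $S$ with $n$ nodes consists of points $x_1,\dots,x_n\in S$ that are projectively distinct ($x_i\neq x_j\lambda$ for $i\ne j$, $|\lambda|=1$) and weights $\rho_1,\dots,\rho_n>0$ such that $\int_S\phi\,d\sigma=\sum_{i=1}^n\rho_i\phi(x_i)$ for all $\phi\in\Phi_{\mathbb{K}}(m,p)$. Jacobi polynomials $P_k^{(a,b)}$ are orthogonal on $(-1,1)$ with weight $(1-t)^a(1+t)^b$. *)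

theory Defs
  imports "HOL-Analysis.Analysis"
begin

text \<open>Points of K^m = R^(delta m): real functions on the index set
  {0..<m} x {0..<delta}; coordinate (i,j) is the j-th real component of the
  i-th K-coordinate w_i = sum_j w(i,j) e_j with e_0 = 1, e_1 = i, e_2 = j, e_3 = k.\<close>

definition idx :: "nat \<Rightarrow> nat \<Rightarrow> (nat \<times> nat) set" where
  "idx \<delta> m = {0..<m} \<times> {0..<\<delta>}"

definition eucl :: "nat \<Rightarrow> nat \<Rightarrow> (nat \<times> nat \<Rightarrow> real) measure" where
  "eucl \<delta> m = PiM (idx \<delta> m) (\<lambda>_. lborel)"

definition sqnorm :: "nat \<Rightarrow> nat \<Rightarrow> (nat \<times> nat \<Rightarrow> real) \<Rightarrow> real" where
  "sqnorm \<delta> m x = (\<Sum>k\<in>idx \<delta> m. (x k)\<^sup>2)"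

definition sphere_K :: "nat \<Rightarrow> nat \<Rightarrow> (nat \<times> nat \<Rightarrow> real) set" where
  "sphere_K \<delta> m = {x \<in> space (eucl \<delta> m). sqnorm \<delta> m x = 1}"

text \<open>Normalized rotation-invariant surface measure on the unit sphere, realised as the
  cone measure: push-forward of the uniform probability measure on the punctured unit
  ball under radial projection x \<mapsto> x/|x|.\<close>

definition punct_ball :: "nat \<Rightarrow> nat \<Rightarrow> (nat \<times> nat \<Rightarrow> real) set" where
  "punct_ball \<delta> m = {x \<in> space (eucl \<delta> m). 0 < sqnorm \<delta> m x \<and> sqnorm \<delta> m x \<le> 1}"

definition sigma_K :: "nat \<Rightarrow> nat \<Rightarrow> (nat \<times> nat \<Rightarrow> real) measure" where
  "sigma_K \<delta> m =
     distr (uniform_measure (restrict_space (eucl \<delta> m) (punct_ball \<delta> m)) (punct_ball \<delta> m))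
           (restrict_space (eucl \<delta> m) (sphere_K \<delta> m))
           (\<lambda>x. restrict (\<lambda>k. x k / sqrt (sqnorm \<delta> m x)) (idx \<delta> m))"

definition qmul :: "(nat \<Rightarrow> real) \<Rightarrow> (nat \<Rightarrow> real) \<Rightarrow> nat \<Rightarrow> real" where
  "qmul a b j =
     (if j = 0 then a 0 * b 0 - a 1 * b 1 - a 2 * b 2 - a 3 * b 3
      else if j = 1 then a 0 * b 1 + a 1 * b 0 + a 2 * b 3 - a 3 * b 2
      else if j = 2 then a 0 * b 2 - a 1 * b 3 + a 2 * b 0 + a 3 * b 1
      else if j = 3 then a 0 * b 3 + a 1 * b 2 - a 2 * b 1 + a 3 * b 0
      else 0)"

text \<open>Unit scalars of K (K = R, C, H for delta = 1, 2, 4), embedded in H.\<close>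

definition unit_K :: "nat \<Rightarrow> (nat \<Rightarrow> real) \<Rightarrow> bool" where
  "unit_K \<delta> l \<longleftrightarrow> (\<forall>k\<ge>\<delta>. l k = 0) \<and> (\<Sum>k<4. (l k)\<^sup>2) = 1"

definition rmult :: "nat \<Rightarrow> nat \<Rightarrow> (nat \<times> nat \<Rightarrow> real) \<Rightarrow> (nat \<Rightarrow> real) \<Rightarrow> (nat \<times> nat \<Rightarrow> real)" where
  "rmult \<delta> m w l = restrict (\<lambda>(i, j). qmul (\<lambda>k. if k < \<delta> then w (i, k) else 0) l j) (idx \<delta> m)"

definition exps :: "nat \<Rightarrow> nat \<Rightarrow> nat \<Rightarrow> (nat \<times> nat \<Rightarrow> nat) set" where
  "exps \<delta> m p = {a \<in> PiE (idx \<delta> m) (\<lambda>_. {..p}). sum a (idx \<delta> m) = p}"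

definition homog_poly :: "nat \<Rightarrow> nat \<Rightarrow> nat \<Rightarrow> ((nat \<times> nat \<Rightarrow> real) \<Rightarrow> complex) \<Rightarrow> bool" where
  "homog_poly \<delta> m p \<psi> \<longleftrightarrow>
     (\<exists>c :: (nat \<times> nat \<Rightarrow> nat) \<Rightarrow> complex. \<forall>x.
        \<psi> x = (\<Sum>a\<in>exps \<delta> m p. c a * (\<Prod>k\<in>idx \<delta> m. complex_of_real (x k) ^ a k)))"

text \<open>Phi_K(m,p): (polynomial representatives of) the invariant homogeneous polynomials.\<close>

definition Phi_K :: "nat \<Rightarrow> nat \<Rightarrow> nat \<Rightarrow> ((nat \<times> nat \<Rightarrow> real) \<Rightarrow> complex) set" where
  "Phi_K \<delta> m p = {\<psi>. homog_poly \<delta> m p \<psi> \<and>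
      (\<forall>w\<in>space (eucl \<delta> m). \<forall>l. unit_K \<delta> l \<longrightarrow> \<psi> (rmult \<delta> m w l) = \<psi> w)}"

definition proj_cubature ::
  "nat \<Rightarrow> nat \<Rightarrow> nat \<Rightarrow> nat \<Rightarrow> (nat \<Rightarrow> nat \<times> nat \<Rightarrow> real) \<Rightarrow> (nat \<Rightarrow> real) \<Rightarrow> bool" where
  "proj_cubature \<delta> m p n x \<rho> \<longleftrightarrow>
     (\<forall>i<n. x i \<in> sphere_K \<delta> m) \<and>
     (\<forall>i<n. \<forall>j<n. i \<noteq> j \<longrightarrow> (\<forall>l. unit_K \<delta> l \<longrightarrow> x i \<noteq> rmult \<delta> m (x j) l)) \<and>
     (\<forall>i<n. \<rho> i > 0) \<and>
     (\<forall>\<psi>\<in>Phi_K \<delta> m p.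
        (\<integral>y. \<psi> y \<partial>sigma_K \<delta> m) = (\<Sum>i<n. complex_of_real (\<rho> i) * \<psi> (x i)))"

definition jacobiP :: "nat \<Rightarrow> real \<Rightarrow> real \<Rightarrow> real \<Rightarrow> real" where
  "jacobiP k a b t =
     (\<Sum>s=0..k. ((real k + a) gchoose (k - s)) * ((real k + b) gchoose s)
                 * ((t - 1) / 2) ^ s * ((t + 1) / 2) ^ (k - s))"

text \<open>Gauss hypergeometric function 2F1 (power series, for |z| < 1).\<close>

definition hyp2F1 :: "real \<Rightarrow> real \<Rightarrow> real \<Rightarrow> real \<Rightarrow> real" where
  "hyp2F1 a b c z =
     (\<Sum>k. pochhammer a k * pochhammer b k / (pochhammer c k * fact k) * z ^ k)"

end

theory Submission
  imports Defs "HOL-Probability.Distributions"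
begin

text \<open>
  Put \<open>t(x, z) = |(x, z)|\<^sup>2\<close>, let \<open>L\<close> be the Jacobi operator in the variable \<open>u = t\<close>, symmetric
  for the Beta weight \<open>u\<^sup>\<beta> (1 - u)\<^sup>\<alpha>\<close>, and let \<open>-\<lambda>\<close> be its eigenvalue of degree \<open>p/2 + 1\<close>, with
  eigenfunction \<open>Y\<close>. The point \<open>\<tau> = (1 + \<xi>)/2\<close> is the largest critical point of \<open>Y\<close>, so the function
  \<open>g\<close> that equals \<open>Y - Y(\<tau>)\<close> on the cap \<open>u > \<tau>\<close> and 0 elsewhere is \<open>C\<^sup>1\<close>, nonnegative, and
  satisfies \<open>(L + \<lambda>) g = C \<chi>\<close>, where \<open>\<chi>\<close> is the indicator of the cap and \<open>C = - \<lambda> Y(\<tau>) > 0\<close>.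

  Consider the quadratic form \<open>q(P) = \<Sum>\<^sub>i\<^sub>j \<rho>\<^sub>i \<rho>\<^sub>j \<integral> P(t(x\<^sub>i, z)) ((L + \<lambda>) P)(t(x\<^sub>j, z)) d\<sigma>(z)\<close> on
  polynomials. Eigenpolynomials of different degrees are orthogonal for it; the cubature formula
  annihilates the degrees from 1 to \<open>p/2\<close>, and \<open>L + \<lambda>\<close> is nonpositive on the higher ones. Hence
  \<open>q(P) \<le> \<lambda> A\<^sup>2\<close>, where \<open>A\<close> is the mean of \<open>P\<close>. Polynomials converge boundedly and pointwise to \<open>g\<close>
  together with their images under \<open>L\<close>, so this bound holds for \<open>g\<close>. There the terms with
  \<open>i \<noteq> j\<close> are nonnegative and the diagonal gives \<open>C A \<Sum> \<rho>\<^sub>i\<^sup>2\<close>, while \<open>\<lambda> A\<close> is \<open>C\<close> times the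
  normalised Beta measure of the cap. So that measure is at least \<open>\<Sum> \<rho>\<^sub>i\<^sup>2 \<ge> 1/n\<close>.

  The symmetry of \<open>L\<close> on the sphere is a statement about integrals of homogeneous polynomials. These
  are Gaussian expectations up to a radial factor, and for Gaussian expectations the symmetry is
  Green's identity. The mean over the sphere and the Beta mean are both the normalised functional on
  polynomials that vanishes on the image of \<open>L\<close>.
\<close>

section \<open>The Jacobi operator and its eigenpolynomials\<close>

definition jacobi_op :: "real \<Rightarrow> real \<Rightarrow> real poly \<Rightarrow> real poly" where
  "jacobi_op a b P = [:0, 1, -1:] * pderiv (pderiv P) + [:b + 1, - (a + b + 2):] * pderiv P"

definition jacobi_eigenvalue :: "real \<Rightarrow> real \<Rightarrow> nat \<Rightarrow> real" where
  "jacobi_eigenvalue a b k = real k * (real k + a + b + 1)"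

lemma poly_jacobi_op:
  "poly (jacobi_op a b P) u = u * (1 - u) * poly (pderiv (pderiv P)) u
     + (b + 1 - (a + b + 2) * u) * poly (pderiv P) u"
  by (simp add: jacobi_op_def algebra_simps)

lemma jacobi_op_add: "jacobi_op a b (P + Q) = jacobi_op a b P + jacobi_op a b Q"
  by (simp only: jacobi_op_def pderiv_add distrib_left add_ac)

lemma jacobi_op_smult: "jacobi_op a b (smult c P) = smult c (jacobi_op a b P)"
  by (simp add: jacobi_op_def pderiv_smult smult_add_right)

lemma jacobi_op_sum: "jacobi_op a b (\<Sum>i\<in>A. f i) = (\<Sum>i\<in>A. jacobi_op a b (f i))"
  by (induction A rule: infinite_finite_induct)
    (simp_all add: jacobi_op_add jacobi_op_def[of _ _ 0])

lemma jacobi_op_1 [simp]: "jacobi_op a b 1 = 0"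
  by (simp add: jacobi_op_def)

lemma pderiv_jacobi_op:
  "pderiv (jacobi_op a b P)
    = jacobi_op (a + 1) (b + 1) (pderiv P) - smult (a + b + 2) (pderiv P)"
proof (rule poly_eq_poly_eq_iff[THEN iffD1], rule ext)
  fix u
  show "poly (pderiv (jacobi_op a b P)) u
    = poly (jacobi_op (a + 1) (b + 1) (pderiv P) - smult (a + b + 2) (pderiv P)) u"
    unfolding jacobi_op_def[of a b] pderiv_add pderiv_mult
      poly_add poly_diff poly_mult poly_jacobi_op poly_smult
    by (simp add: pderiv_pCons algebra_simps)
qed

lemma jacobi_eigenvalue_0 [simp]: "jacobi_eigenvalue a b 0 = 0"
  by (simp add: jacobi_eigenvalue_def)

lemma jacobi_eigenvalue_shift:
  "jacobi_eigenvalue a b (Suc k) = jacobi_eigenvalue (a + 1) (b + 1) k + (a + b + 2)"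
  by (simp add: jacobi_eigenvalue_def algebra_simps)

lemma jacobi_eigenvalue_strict_mono:
  assumes "a > -1" "b > -1"
  shows "strict_mono (jacobi_eigenvalue a b)"
proof (rule strict_mono_Suc_iff[THEN iffD2], rule allI)
  fix k
  have "jacobi_eigenvalue a b (Suc k) - jacobi_eigenvalue a b k = 2 * real k + a + b + 2"
    by (simp add: jacobi_eigenvalue_def algebra_simps)
  then show "jacobi_eigenvalue a b k < jacobi_eigenvalue a b (Suc k)"
    using assms by simp
qed

lemma jacobi_eigenvalue_pos:
  assumes "a > -1" "b > -1" "k > 0"
  shows "0 < jacobi_eigenvalue a b k"
  using strict_monoD[OF jacobi_eigenvalue_strict_mono[OF assms(1,2)] assms(3)] by simp

lemma pderiv_linear_powers:
  "pderiv ([:-1, 1::real:] ^ i * [:0, 1:] ^ j)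
    = smult (real i) ([:-1, 1:] ^ (i - 1) * [:0, 1:] ^ j)
      + smult (real j) ([:-1, 1:] ^ i * [:0, 1:] ^ (j - 1))"
  by (simp add: pderiv_mult pderiv_power pderiv_pCons mult.commute)

text \<open>In the basis \<open>(u - 1)\<^sup>i u\<^sup>j\<close> of the homogeneous forms of degree \<open>i + j\<close> in \<open>u - 1\<close> and \<open>u\<close>
  the operator is tridiagonal up to an eigenvalue.\<close>

lemma poly_jacobi_op_linear_powers:
  "poly (jacobi_op a b ([:-1, 1:] ^ i * [:0, 1:] ^ j)) u
       + jacobi_eigenvalue a b (i + j) * ((u - 1) ^ i * u ^ j)
     = real i * (real i + a) * ((u - 1) ^ i * u ^ j - (u - 1) ^ (i - 1) * u ^ (j + 1))
     + real j * (real j + b) * ((u - 1) ^ i * u ^ j - (u - 1) ^ (i + 1) * u ^ (j - 1))"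
proof -
  define x where "x = u - 1"
  define p1 where "p1 = real i * x ^ (i - 1)"
  define p2 where "p2 = real i * real (i - 1) * x ^ (i - 1 - 1)"
  define q1 where "q1 = real j * u ^ (j - 1)"
  define q2 where "q2 = real j * real (j - 1) * u ^ (j - 1 - 1)"
  have euler_x: "p1 * x = real i * x ^ i" "p2 * x = (real i - 1) * p1"
    unfolding p1_def p2_def by (cases i; cases "i - 1"; simp add: algebra_simps)+
  have euler_u: "q1 * u = real j * u ^ j" "q2 * u = (real j - 1) * q1"
    unfolding q1_def q2_def by (cases j; cases "j - 1"; simp add: algebra_simps)+
  have deriv1: "poly (pderiv ([:-1, 1:] ^ i * [:0, 1:] ^ j)) u = p1 * u ^ j + x ^ i * q1"
    by (simp add: pderiv_linear_powers p1_def q1_def x_def)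
  have deriv2: "poly (pderiv (pderiv ([:-1, 1:] ^ i * [:0, 1:] ^ j))) u
      = p2 * u ^ j + 2 * p1 * q1 + x ^ i * q2"
    by (simp only: pderiv_linear_powers pderiv_add pderiv_smult p1_def q1_def p2_def q2_def x_def
          poly_add poly_smult poly_mult poly_power) (simp add: algebra_simps)
  have coeffs: "u * (1 - u) = - (x * u)" "b + 1 - (a + b + 2) * u = - ((a + 1) * u + (b + 1) * x)"
    by (simp_all add: x_def algebra_simps)
  have "poly (jacobi_op a b ([:-1, 1:] ^ i * [:0, 1:] ^ j)) u
      = - (x * u) * (p2 * u ^ j + 2 * p1 * q1 + x ^ i * q2)
        - ((a + 1) * u + (b + 1) * x) * (p1 * u ^ j + x ^ i * q1)"
    unfolding poly_jacobi_op deriv1 deriv2 coeffs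
    by (simp only: mult_minus_left diff_conv_add_uminus)
  also have "\<dots> = - ((p2 * x) * u * u ^ j + 2 * (p1 * x) * (q1 * u) + x * x ^ i * (q2 * u))
      - ((a + 1) * (u * p1 * u ^ j + x ^ i * (q1 * u))
        + (b + 1) * ((p1 * x) * u ^ j + x * x ^ i * q1))"
    by (simp add: algebra_simps)
  also have "\<dots> = - (real i * (real i + a)) * (x ^ (i - 1) * u ^ (j + 1))
      - real j * (real j + b) * (x ^ (i + 1) * u ^ (j - 1))
      - (2 * real i * real j + (a + 1) * real j + (b + 1) * real i) * (x ^ i * u ^ j)"
    unfolding euler_x euler_u by (simp add: p1_def q1_def algebra_simps)
  finally show ?thesis
    unfolding x_def[symmetric] jacobi_eigenvalue_def by (simp add: algebra_simps)
qed

lemma jacobi_op_monom: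
  "jacobi_op a b (monom 1 j)
    = monom (- jacobi_eigenvalue a b j) j + monom (real j * (real j + b)) (j - 1)"
proof (rule poly_eq_poly_eq_iff[THEN iffD1], rule ext)
  fix u :: real
  have "poly (jacobi_op a b (monom 1 j)) u + jacobi_eigenvalue a b j * u ^ j
      = (real j + b) * (real j * (u ^ j - (u - 1) * u ^ (j - 1)))"
    using poly_jacobi_op_linear_powers[of a b 0 j u] by (simp add: monom_altdef mult_ac)
  also have "real j * (u ^ j - (u - 1) * u ^ (j - 1)) = real j * u ^ (j - 1)"
    by (cases j) (simp_all add: algebra_simps)
  finally show "poly (jacobi_op a b (monom 1 j)) u
     = poly (monom (- jacobi_eigenvalue a b j) j + monom (real j * (real j + b)) (j - 1)) u"
    by (simp add: poly_monom algebra_simps)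
qed

definition jacobi_coeff :: "nat \<Rightarrow> real \<Rightarrow> real \<Rightarrow> nat \<Rightarrow> real" where
  "jacobi_coeff k a b s = ((real k + a) gchoose (k - s)) * ((real k + b) gchoose s)"

definition jacobi_poly :: "nat \<Rightarrow> real \<Rightarrow> real \<Rightarrow> real poly" where
  "jacobi_poly k a b = (\<Sum>s\<le>k. smult (jacobi_coeff k a b s) ([:-1, 1:] ^ s * [:0, 1:] ^ (k - s)))"

lemma poly_jacobi_poly_sum:
  "poly (jacobi_poly k a b) u = (\<Sum>s\<le>k. jacobi_coeff k a b s * ((u - 1) ^ s * u ^ (k - s)))"
  by (simp add: jacobi_poly_def poly_sum)

lemma jacobiP_eq_poly: "jacobiP k a b t = poly (jacobi_poly k a b) ((1 + t) / 2)"
proof -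
  have "(1 + t) / 2 - 1 = (t - 1) / 2" by (simp add: field_simps)
  then show ?thesis
    unfolding poly_jacobi_poly_sum jacobiP_def jacobi_coeff_def atLeast0AtMost
    by (simp add: mult.assoc add.commute[of 1])
qed

lemma jacobi_poly_0 [simp]: "jacobi_poly 0 a b = 1"
  by (simp add: jacobi_poly_def jacobi_coeff_def)

lemma gbinomial_Suc_mult:
  fixes x :: real
  shows "real (Suc r) * (x gchoose Suc r) = (x - real r) * (x gchoose r)"
  using gbinomial_mult_1[of x r] by (simp add: algebra_simps)

lemma jacobi_coeff_Suc:
  assumes "s < k"
  shows "real (Suc s) * (real (Suc s) + a) * jacobi_coeff k a b (Suc s)
    = real (k - s) * (real (k - s) + b) * jacobi_coeff k a b s"
proof -
  obtain r where r: "k - s = Suc r" "k - Suc s = r" and k: "real k = real s + real (Suc r)"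
    using assms by (intro that[of "k - Suc s"]) (auto simp: of_nat_diff)
  have "real (Suc s) * (real (Suc s) + a) * jacobi_coeff k a b (Suc s)
      = ((real k + a - real r) * ((real k + a) gchoose r))
        * (real (Suc s) * ((real k + b) gchoose Suc s))"
    by (simp add: jacobi_coeff_def r k mult_ac)
  also have "\<dots> = (real (Suc r) * ((real k + a) gchoose Suc r))
        * ((real k + b - real s) * ((real k + b) gchoose s))"
    unfolding gbinomial_Suc_mult ..
  also have "\<dots> = real (k - s) * (real (k - s) + b) * jacobi_coeff k a b s"
    by (simp add: jacobi_coeff_def r k mult_ac)
  finally show ?thesis .
qed

lemma poly_jacobi_op_linear_powers_le:
  fixes a b u :: real
  assumes "s \<le> k"
  defines "e \<equiv> \<lambda>r. (u - 1) ^ r * u ^ (k - r)"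
  shows "poly (jacobi_op a b ([:-1, 1:] ^ s * [:0, 1:] ^ (k - s))) u + jacobi_eigenvalue a b k * e s
    = real s * (real s + a) * (e s - e (s - 1))
      + real (k - s) * (real (k - s) + b) * (e s - e (Suc s))"
proof -
  have "(u - 1) ^ (s - 1) * u ^ (k - s + 1) = e (s - 1)" if "s > 0"
    using that assms(1) by (simp add: e_def Suc_diff_le[symmetric])
  then have "real s * (real s + a) * (e s - (u - 1) ^ (s - 1) * u ^ (k - s + 1))
      = real s * (real s + a) * (e s - e (s - 1))"
    by (cases "s = 0") auto
  moreover have "(u - 1) ^ (s + 1) * u ^ (k - s - 1) = e (Suc s)"
    by (simp add: e_def)
  ultimately show ?thesis
    using poly_jacobi_op_linear_powers[of a b s "k - s" u] assms(1)
    by (simp only: e_def le_add_diff_inverse)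
qed

text \<open>By the recurrence of the coefficients, the contributions of neighbouring powers cancel.\<close>

lemma jacobi_op_jacobi_poly:
  "jacobi_op a b (jacobi_poly k a b) = smult (- jacobi_eigenvalue a b k) (jacobi_poly k a b)"
proof (rule poly_eq_poly_eq_iff[THEN iffD1], rule ext)
  fix u :: real
  define e where "e s = (u - 1) ^ s * u ^ (k - s)" for s
  define down where "down s = real s * (real s + a) * jacobi_coeff k a b s" for s
  define up where "up s = real (k - s) * (real (k - s) + b) * jacobi_coeff k a b s" for s
  have summand: "jacobi_coeff k a b s * (poly (jacobi_op a b ([:-1, 1:] ^ s * [:0, 1:] ^ (k - s))) u
      + jacobi_eigenvalue a b k * e s) = down s * (e s - e (s - 1)) + up s * (e s - e (Suc s))"
    if "s \<le> k" for s
    unfolding e_def down_def up_def poly_jacobi_op_linear_powers_le[OF that]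
    by (subst distrib_left) (simp only: mult_ac)
  have "poly (jacobi_op a b (jacobi_poly k a b)) u
        + jacobi_eigenvalue a b k * poly (jacobi_poly k a b) u
      = (\<Sum>s\<le>k. jacobi_coeff k a b s * (poly (jacobi_op a b ([:-1, 1:] ^ s * [:0, 1:] ^ (k - s))) u
         + jacobi_eigenvalue a b k * e s))"
    by (simp add: jacobi_poly_def jacobi_op_sum jacobi_op_smult poly_sum e_def sum_distrib_left
        sum.distrib distrib_left mult.left_commute)
  also have "\<dots> = (\<Sum>s\<le>k. down s * (e s - e (s - 1))) + (\<Sum>s\<le>k. up s * (e s - e (Suc s)))"
    by (simp add: summand sum.distrib)
  also have "(\<Sum>s\<le>k. down s * (e s - e (s - 1))) = (\<Sum>s<k. down (Suc s) * (e (Suc s) - e s))"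
    by (simp add: sum.atMost_shift down_def)
  also have "\<dots> = (\<Sum>s<k. up s * (e (Suc s) - e s))"
    by (intro sum.cong refl) (simp only: down_def up_def jacobi_coeff_Suc lessThan_iff)
  also have "(\<Sum>s\<le>k. up s * (e s - e (Suc s))) = (\<Sum>s<k. up s * (e s - e (Suc s)))"
    by (simp add: up_def flip: lessThan_Suc_atMost)
  also have "(\<Sum>s<k. up s * (e (Suc s) - e s)) + \<dots> = 0"
    by (simp add: right_diff_distrib flip: sum.distrib)
  finally show "poly (jacobi_op a b (jacobi_poly k a b)) u
    = poly (smult (- jacobi_eigenvalue a b k) (jacobi_poly k a b)) u"
    by simp
qed

lemma shifted_jacobi_op_expansion:
  fixes l :: real
  assumes "P = (\<Sum>k\<in>A. smult (c k) (jacobi_poly k a b))"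
  shows "jacobi_op a b P + smult l P
    = (\<Sum>k\<in>A. smult (c k * (l - jacobi_eigenvalue a b k)) (jacobi_poly k a b))"
proof -
  have smult_eq: "smult l Q = [:l:] * Q" for Q by simp
  show ?thesis
    unfolding assms jacobi_op_sum smult_eq sum_distrib_left sum.distrib[symmetric]
    by (intro sum.cong refl)
      (simp add: jacobi_op_smult jacobi_op_jacobi_poly right_diff_distrib smult_diff_left
        mult.commute)
qed

lemma gbinomial_pos: "0 < (x gchoose r)" if "real r < x + 1" for x :: real
  using that by (auto simp: gbinomial_prod_rev intro!: divide_pos_pos prod_pos)

lemma jacobi_coeff_pos:
  assumes "a > -1" "b > -1" "s \<le> k"
  shows "0 < jacobi_coeff k a b s"
  unfolding jacobi_coeff_def using assms by (intro mult_pos_pos gbinomial_pos) auto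

lemma jacobi_poly_pos:
  assumes "a > -1" "b > -1" "u \<ge> 1"
  shows "0 < poly (jacobi_poly k a b) u"
  unfolding poly_jacobi_poly_sum
proof (rule sum_pos2[of _ 0])
  show "0 < jacobi_coeff k a b 0 * ((u - 1) ^ 0 * u ^ (k - 0))"
    using jacobi_coeff_pos[OF assms(1,2)] assms(3) by simp
  show "0 \<le> jacobi_coeff k a b s * ((u - 1) ^ s * u ^ (k - s))" if "s \<in> {..k}" for s
    using that assms
    by (intro mult_nonneg_nonneg zero_le_power less_imp_le[OF jacobi_coeff_pos]) auto
qed auto

lemma degree_jacobi_poly:
  assumes "a > -1" "b > -1"
  shows "degree (jacobi_poly k a b) = k"
proof (rule antisym)
  have deg: "degree ([:-1, 1::real:] ^ s * [:0, 1:] ^ (k - s)) = k" if "s \<le> k" for s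
    using that by (simp add: degree_mult_eq degree_power_eq)
  then show "degree (jacobi_poly k a b) \<le> k"
    unfolding jacobi_poly_def by (intro degree_sum_le) (auto intro: order.trans[OF degree_smult_le])
  have "coeff ([:-1, 1::real:] ^ s * [:0, 1:] ^ (k - s)) k = 1" if "s \<le> k" for s
    using deg[OF that] lead_coeff_mult[of "[:-1, 1::real:] ^ s" "[:0, 1:] ^ (k - s)"]
    by (simp add: lead_coeff_power)
  then have "coeff (jacobi_poly k a b) k = (\<Sum>s\<le>k. jacobi_coeff k a b s)"
    by (simp add: jacobi_poly_def coeff_sum)
  also have "\<dots> > 0"
    using assms by (intro sum_pos jacobi_coeff_pos) auto
  finally show "k \<le> degree (jacobi_poly k a b)"
    by (intro le_degree) auto
qed

lemma poly_expansion:
  fixes J :: "nat \<Rightarrow> 'a::field poly"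
  assumes J: "\<And>k. degree (J k) = k" "J 0 \<noteq> 0" and P: "degree P \<le> N"
  shows "\<exists>c. P = (\<Sum>k\<le>N. smult (c k) (J k))"
  using P
proof (induction N arbitrary: P)
  case 0
  obtain x y where xy: "J 0 = [:x:]" "P = [:y:]"
    using J(1)[of 0] 0 by (metis degree_eq_zeroE le_zero_eq)
  then have "x \<noteq> 0" using J(2) by auto
  then show ?case by (intro exI[of _ "\<lambda>_. y / x"]) (simp add: xy)
next
  case (Suc N)
  define q where "q = coeff P (Suc N) / coeff (J (Suc N)) (Suc N)"
  have "coeff (J (Suc N)) (Suc N) \<noteq> 0"
    using J(1)[of "Suc N"] by (metis degree_0 leading_coeff_0_iff nat.distinct(1))
  then have "coeff (P - smult q (J (Suc N))) (Suc N) = 0"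
    by (simp add: q_def)
  moreover have "degree (P - smult q (J (Suc N))) \<le> Suc N"
    using Suc.prems J(1)[of "Suc N"]
    by (intro degree_diff_le) (auto intro: order.trans[OF degree_smult_le])
  ultimately have "degree (P - smult q (J (Suc N))) \<le> N"
    by (metis degree_0 le_SucE le0 leading_coeff_0_iff)
  from Suc.IH[OF this] obtain c
    where c: "P - smult q (J (Suc N)) = (\<Sum>k\<le>N. smult (c k) (J k))" by blast
  have "P = (\<Sum>k\<le>Suc N. smult ((c(Suc N := q)) k) (J k))"
    using c by (simp add: algebra_simps)
  then show ?case by blast
qed

lemma jacobi_expansion:
  assumes "a > -1" "b > -1"
  obtains c where "P = (\<Sum>k\<le>degree P. smult (c k) (jacobi_poly k a b))"
  using poly_expansion[of "\<lambda>k. jacobi_poly k a b" P "degree P"] degree_jacobi_poly[OF assms] by auto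

section \<open>The Jacobi weight\<close>

definition jacobi_weight :: "real \<Rightarrow> real \<Rightarrow> real \<Rightarrow> real" where
  "jacobi_weight a b u = u powr b * (1 - u) powr a"

definition jacobi_mean :: "real \<Rightarrow> real \<Rightarrow> (real \<Rightarrow> real) \<Rightarrow> real" where
  "jacobi_mean a b f = integral {0..1} (\<lambda>u. f u * jacobi_weight a b u) / Beta (b + 1) (a + 1)"

lemma jacobi_weight_nonneg: "0 \<le> jacobi_weight a b u"
  by (simp add: jacobi_weight_def)

lemma Beta_pos: "0 < Beta x y" if "x > 0" "y > 0" for x y :: real
  using that by (simp add: Beta_def Gamma_real_pos)

lemma jacobi_weight_poly_integrable:
  assumes "a > -1" "b > -1"
  shows "(\<lambda>u. poly P u * jacobi_weight a b u) integrable_on {0..1}"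
proof -
  have "(\<lambda>u. u ^ j * jacobi_weight a b u) integrable_on {0..1}" for j
  proof (rule integrable_eq)
    show "(\<lambda>u. u powr (b + real j) * (1 - u) powr a) integrable_on {0..1}"
      using has_integral_Beta_real[of "b + real j + 1" "a + 1"] assms
      by (auto simp: integrable_on_def)
    show "u powr (b + real j) * (1 - u) powr a = u ^ j * jacobi_weight a b u" if "u \<in> {0..1}" for u
      using that by (cases "u = 0") (auto simp: jacobi_weight_def powr_add powr_realpow)
  qed
  then have "(\<lambda>u. \<Sum>j\<le>degree P. coeff P j * (u ^ j * jacobi_weight a b u)) integrable_on {0..1}"
    by (intro integrable_sum integrable_on_mult_right) auto
  then show ?thesis
    by (simp add: poly_altdef sum_distrib_right mult.assoc)
qed

lemma jacobi_mean_add: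
  assumes "a > -1" "b > -1"
  shows "jacobi_mean a b (poly (P + Q)) = jacobi_mean a b (poly P) + jacobi_mean a b (poly Q)"
  using integral_add[OF jacobi_weight_poly_integrable[OF assms, of P]
      jacobi_weight_poly_integrable[OF assms, of Q]]
  by (simp add: jacobi_mean_def distrib_right add_divide_distrib)

lemma jacobi_mean_smult: "jacobi_mean a b (poly (smult c P)) = c * jacobi_mean a b (poly P)"
  by (simp add: jacobi_mean_def mult.assoc)

lemma jacobi_mean_sum:
  assumes "a > -1" "b > -1"
  shows "jacobi_mean a b (poly (\<Sum>i\<in>A. f i)) = (\<Sum>i\<in>A. jacobi_mean a b (poly (f i)))"
  by (induction A rule: infinite_finite_induct)
    (simp_all add: jacobi_mean_add[OF assms] jacobi_mean_def[of _ _ "\<lambda>_. 0"] del: poly_add)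

lemma jacobi_mean_1:
  assumes "a > -1" "b > -1"
  shows "jacobi_mean a b (poly 1) = 1"
  using integral_unique[OF has_integral_Beta_real[of "b + 1" "a + 1"]] assms
    Beta_pos[of "b + 1" "a + 1"]
  by (simp add: jacobi_mean_def jacobi_weight_def)

lemma jacobi_weight_pderiv_has_derivative:
  assumes "0 < u" "u < 1"
  shows "((\<lambda>u. jacobi_weight (a + 1) (b + 1) u * poly (pderiv P) u)
     has_real_derivative jacobi_weight a b u * poly (jacobi_op a b P) u) (at u)"
proof -
  have "u powr (b + 1) = u * u powr b" "(1 - u) powr (a + 1) = (1 - u) * (1 - u) powr a"
    using assms by (simp_all add: powr_add)
  then have "((b + 1) * u powr b * ((1 - u) powr (a + 1))
        - u powr (b + 1) * ((a + 1) * (1 - u) powr a)) * poly (pderiv P) u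
      + u powr (b + 1) * (1 - u) powr (a + 1) * poly (pderiv (pderiv P)) u
     = u powr b * (1 - u) powr a * poly (jacobi_op a b P) u"
    by (simp only: poly_jacobi_op) (simp add: ring_distribs mult_ac)
  then show ?thesis
    unfolding jacobi_weight_def using assms
    by (auto intro!: derivative_eq_intros simp: algebra_simps)
qed

lemma continuous_on_jacobi_weight_pderiv:
  assumes "a > -1" "b > -1"
  shows "continuous_on {0..1} (\<lambda>u. jacobi_weight (a + 1) (b + 1) u * poly (pderiv P) u)"
  unfolding jacobi_weight_def using assms by (intro continuous_intros continuous_on_powr') auto

lemma jacobi_mean_jacobi_op:
  assumes "a > -1" "b > -1"
  shows "jacobi_mean a b (poly (jacobi_op a b P)) = 0"
proof -
  define H where "H u = jacobi_weight (a + 1) (b + 1) u * poly (pderiv P) u" for u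
  have "((\<lambda>u. jacobi_weight a b u * poly (jacobi_op a b P) u) has_integral H 1 - H 0) {0..1}"
    unfolding H_def
    using continuous_on_jacobi_weight_pderiv[OF assms] jacobi_weight_pderiv_has_derivative
    by (intro fundamental_theorem_of_calculus_interior)
      (auto simp flip: has_real_derivative_iff_has_vector_derivative)
  moreover have "H 1 = 0" "H 0 = 0"
    by (simp_all add: H_def jacobi_weight_def)
  ultimately show ?thesis
    by (simp add: jacobi_mean_def mult.commute integral_unique)
qed

lemma jacobi_mean_jacobi_poly:
  assumes "a > -1" "b > -1" "k > 0"
  shows "jacobi_mean a b (poly (jacobi_poly k a b)) = 0"
  using jacobi_mean_jacobi_op[OF assms(1,2), of "jacobi_poly k a b"] jacobi_eigenvalue_pos[OF assms]
  unfolding jacobi_op_jacobi_poly jacobi_mean_smult by simp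

lemma jacobi_mean_expansion:
  assumes ab: "a > -1" "b > -1" and P: "P = (\<Sum>k\<le>N. smult (c k) (jacobi_poly k a b))"
  shows "jacobi_mean a b (poly P) = c 0"
proof -
  have "jacobi_mean a b (poly P) = (\<Sum>k\<le>N. if k = 0 then c 0 else 0)"
    unfolding P jacobi_mean_sum[OF ab]
    by (intro sum.cong refl)
      (auto simp: jacobi_mean_smult jacobi_mean_1[OF ab] jacobi_mean_jacobi_poly[OF ab]
        simp del: poly_smult poly_1)
  then show ?thesis by simp
qed

lemma poly_additive_eq_0:
  fixes f :: "'a::comm_monoid_add poly \<Rightarrow> 'b::comm_monoid_add"
  assumes add: "\<And>P Q. f (P + Q) = f P + f Q" and monom: "\<And>c i. f (monom c i) = 0"
  shows "f P = 0"
proof -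
  have "f 0 = 0" using monom[of 0 0] by simp
  then have "f (\<Sum>i\<in>A. monom (coeff P i) i) = 0" for A
    by (induction A rule: infinite_finite_induct) (simp_all add: add monom)
  from this[of "{..degree P}"] show ?thesis by (simp add: poly_as_sum_of_monoms)
qed

lemma poly_bilinear_eq_0:
  fixes f :: "real poly \<Rightarrow> real poly \<Rightarrow> real"
  assumes add: "\<And>P Q R. f (P + Q) R = f P R + f Q R" "\<And>P Q R. f R (P + Q) = f R P + f R Q"
    and smult: "\<And>c P R. f (smult c P) R = c * f P R" "\<And>c P R. f P (smult c R) = c * f P R"
    and monom: "\<And>i j. f (monom 1 i) (monom 1 j) = 0"
  shows "f P R = 0"
proof (rule poly_additive_eq_0[of "\<lambda>P. f P R"])
  show "f (monom c i) R = 0" for c i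
  proof (rule poly_additive_eq_0[of "f (monom c i)"])
    show "f (monom c i) (monom e j) = 0" for e j
      using smult(1)[of c "monom 1 i"] smult(2)[of "monom 1 i" e "monom 1 j"]
      by (simp add: smult_monom monom)
  qed (rule add)
qed (rule add)

text \<open>Applied to the images of the monomials, the hypotheses determine the moments recursively.\<close>

lemma jacobi_mean_unique:
  fixes f :: "real poly \<Rightarrow> real"
  assumes ab: "a > -1" "b > -1"
    and add: "\<And>P Q. f (P + Q) = f P + f Q" and smult: "\<And>c P. f (smult c P) = c * f P"
    and jacobi_op: "\<And>P. f (jacobi_op a b P) = 0" and one: "f 1 = 1"
  shows "f P = jacobi_mean a b (poly P)"
proof -
  define D where "D P = f P - jacobi_mean a b (poly P)" for P
  have D_add: "D (P + Q) = D P + D Q" and D_smult: "D (smult c P) = c * D P" for c P Q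
    unfolding D_def add smult jacobi_mean_add[OF ab] jacobi_mean_smult
    by (simp_all add: algebra_simps)
  have D_monom: "D (monom c i) = c * D (monom 1 i)" for c i
    using D_smult[of c "monom 1 i"] by (simp add: smult_monom)
  have "D (monom 1 i) = 0" for i
  proof (induction i)
    case 0
    then show ?case by (simp add: D_def one jacobi_mean_1[OF ab] monom_eq_1)
  next
    case (Suc i)
    have "D (jacobi_op a b (monom 1 (Suc i))) = 0"
      by (simp add: D_def jacobi_op jacobi_mean_jacobi_op[OF ab])
    then have "jacobi_eigenvalue a b (Suc i) * D (monom 1 (Suc i)) = 0"
      using Suc.IH D_monom[of "- jacobi_eigenvalue a b (Suc i)" "Suc i"]
        D_monom[of "real (Suc i) * (real (Suc i) + b)" i]
      by (simp add: jacobi_op_monom D_add)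
    then show ?case
      using jacobi_eigenvalue_pos[OF ab, of "Suc i"] by simp
  qed
  then have "D (monom c i) = 0" for c i
    using D_monom[of c i] by simp
  with D_add have "D P = 0"
    by (rule poly_additive_eq_0[of D])
  then show ?thesis by (simp add: D_def)
qed

lemma (in prob_space) expectation_eq_jacobi_mean:
  assumes ab: "a > -1" "b > -1" and int: "\<And>P. integrable M (\<lambda>z. poly P (f z))"
    and jacobi_op: "\<And>P. (\<integral>z. poly (jacobi_op a b P) (f z) \<partial>M) = 0"
  shows "(\<integral>z. poly P (f z) \<partial>M) = jacobi_mean a b (poly P)"
  by (rule jacobi_mean_unique[OF ab]) (simp_all add: int jacobi_op prob_space)

section \<open>The largest zero\<close>

lemma jacobi_op_Rolle:
  assumes ab: "a > -1" "b > -1" and c: "0 \<le> c" "c < 1" "c = 0 \<or> poly (pderiv P) c = 0"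
  obtains u where "c < u" "u < 1" "poly (jacobi_op a b P) u = 0"
proof -
  define H where "H u = jacobi_weight (a + 1) (b + 1) u * poly (pderiv P) u" for u
  have "\<exists>u. c < u \<and> u < 1 \<and> (\<lambda>h. jacobi_weight a b u * poly (jacobi_op a b P) u * h) = (\<lambda>h. 0)"
  proof (rule Rolle_deriv[of c 1 H])
    show "H c = H 1" using c by (auto simp: H_def jacobi_weight_def)
    show "continuous_on {c..1} H"
      unfolding H_def using c
      by (intro continuous_on_subset[OF continuous_on_jacobi_weight_pderiv[OF ab]]) auto
    show "(H has_derivative (\<lambda>h. jacobi_weight a b u * poly (jacobi_op a b P) u * h)) (at u)"
      if "c < u" "u < 1" for u
      unfolding H_def has_field_derivative_def[symmetric]
      using that c by (intro jacobi_weight_pderiv_has_derivative) auto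
  qed (rule c)
  then obtain u where "c < u" "u < 1" "jacobi_weight a b u * poly (jacobi_op a b P) u = 0"
    by (metis mult.right_neutral)
  then show thesis using c by (intro that[of u]) (auto simp: jacobi_weight_def)
qed

definition largest_jacobi_zero :: "nat \<Rightarrow> real \<Rightarrow> real \<Rightarrow> real" where
  "largest_jacobi_zero d a b = (1 + Max {t. jacobiP d a b t = 0}) / 2"

lemma largest_jacobi_zero:
  assumes ab: "a > -1" "b > -1" and d: "d > 0"
  defines "\<tau> \<equiv> largest_jacobi_zero d a b"
  shows "0 < \<tau>" "\<tau> < 1" "poly (jacobi_poly d a b) \<tau> = 0"
    and "\<And>u. \<tau> < u \<Longrightarrow> 0 < poly (jacobi_poly d a b) u"
proof -
  define y where "y = jacobi_poly d a b"
  define Z where "Z = {t. jacobiP d a b t = 0}"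
  have Z: "t \<in> Z \<longleftrightarrow> poly y ((1 + t) / 2) = 0" for t
    by (simp add: Z_def y_def jacobiP_eq_poly)
  have pos: "0 < poly y u" if "u \<ge> 1" for u
    unfolding y_def using ab that by (rule jacobi_poly_pos)
  then have "y \<noteq> 0" by fastforce
  then have "finite ((\<lambda>t. (1 + t) / 2) -` {u. poly y u = 0})"
    by (intro finite_vimageI poly_roots_finite injI) auto
  then have fin: "finite Z"
    by (rule finite_subset[rotated]) (auto simp: Z)
  obtain v where v: "0 < v" "v < 1" "poly (jacobi_op a b y) v = 0"
    by (rule jacobi_op_Rolle[OF ab, of 0 y]) auto
  then have v0: "2 * v - 1 \<in> Z"
    using jacobi_eigenvalue_pos[OF ab d] by (simp add: Z y_def jacobi_op_jacobi_poly)
  then have "Max Z \<in> Z" using fin by (intro Max_in) auto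
  then show y\<tau>: "poly (jacobi_poly d a b) \<tau> = 0"
    by (simp add: Z \<tau>_def largest_jacobi_zero_def y_def flip: Z_def)
  have zero_le: "u \<le> \<tau>" if "poly y u = 0" for u
    using Max_ge[OF fin, of "2 * u - 1"] that
    by (simp add: Z \<tau>_def largest_jacobi_zero_def flip: Z_def)
  show "0 < \<tau>" using zero_le[of v] v0 v by (simp add: Z)
  show "\<tau> < 1" using pos[of \<tau>] y\<tau> by (cases "\<tau> < 1") (auto simp: y_def)
  show "0 < poly (jacobi_poly d a b) u" if "\<tau> < u" for u
  proof (rule ccontr)
    assume "\<not> 0 < poly (jacobi_poly d a b) u"
    then have "\<exists>w\<ge>u. w \<le> max u 1 \<and> poly y w = 0"
      using pos[of "max u 1"] by (intro IVT') (auto intro!: continuous_intros simp: y_def)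
    then show False using zero_le that by force
  qed
qed

lemma poly_antiderivative:
  fixes R :: "'a::field_char_0 poly"
  obtains P where "pderiv P = R" "poly P 0 = 0"
proof
  define P where "P = (\<Sum>i\<le>degree R. monom (coeff R i / of_nat (Suc i)) (Suc i))"
  have "pderiv (\<Sum>i\<in>A. f i) = (\<Sum>i\<in>A. pderiv (f i))" for f :: "nat \<Rightarrow> 'a poly" and A
    by (induction A rule: infinite_finite_induct) (simp_all add: pderiv_add)
  then have "pderiv P = (\<Sum>i\<le>degree R. monom (coeff R i) i)"
    by (simp add: P_def pderiv_monom del: of_nat_Suc)
  then show "pderiv P = R" by (simp add: poly_as_sum_of_monoms)
  show "poly P 0 = 0" by (simp add: P_def poly_sum poly_monom)
qed

lemma jacobi_op_eigen_antiderivative: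
  assumes y: "jacobi_op (a + 1) (b + 1) y = smult (- k) y" and l: "l = k + (a + b + 2)" "l \<noteq> 0"
  obtains Y where "pderiv Y = y" "jacobi_op a b Y = smult (- l) Y"
proof -
  obtain Y0 where Y0: "pderiv Y0 = y" by (rule poly_antiderivative)
  have deriv: "pderiv (jacobi_op a b Y0) = smult (- l) y"
    unfolding pderiv_jacobi_op Y0 y l(1) by (simp add: smult_diff_left smult_add_left)
  define Y where "Y = smult (- (1 / l)) (jacobi_op a b Y0)"
  have Y: "pderiv Y = y"
    unfolding Y_def pderiv_smult deriv smult_smult using l(2) by simp
  then have "jacobi_op a b Y = jacobi_op a b Y0"
    by (simp add: jacobi_op_def Y0)
  then have "jacobi_op a b Y = smult (- l) Y"
    using l(2) by (simp add: Y_def)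
  then show thesis using Y by (rule that[rotated])
qed

lemma poly_strict_increasing_after:
  fixes Y :: "real poly"
  assumes "\<And>u. \<tau> < u \<Longrightarrow> 0 < poly (pderiv Y) u" "\<tau> < u"
  shows "poly Y \<tau> < poly Y u"
proof (rule DERIV_pos_imp_increasing_open[OF assms(2)])
  fix v assume "\<tau> < v"
  then show "\<exists>D. (poly Y has_real_derivative D) (at v) \<and> D > 0"
    using assms(1)[of v] poly_DERIV[of Y v] by blast
qed (auto intro!: continuous_intros)

lemma eigenpoly_neg_at_last_critical_point:
  assumes ab: "a > -1" "b > -1" and \<tau>: "0 \<le> \<tau>" "\<tau> < 1" "poly (pderiv Y) \<tau> = 0"
    and pos: "\<And>u. \<tau> < u \<Longrightarrow> 0 < poly (pderiv Y) u"
    and eigen: "jacobi_op a b Y = smult (- l) Y" and l: "l \<noteq> 0"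
  shows "poly Y \<tau> < 0"
proof -
  obtain c where c: "\<tau> < c" "c < 1" "poly (jacobi_op a b Y) c = 0"
    using jacobi_op_Rolle[OF ab \<tau>(1,2)] \<tau>(3) by metis
  have "poly Y \<tau> < poly Y c"
    using pos c(1) by (rule poly_strict_increasing_after)
  also have "poly Y c = 0" using c(3) l by (simp add: eigen)
  finally show ?thesis .
qed

lemma jacobi_last_critical_point:
  assumes ab: "a > -1" "b > -1" and d: "d > 0"
  defines "\<tau> \<equiv> largest_jacobi_zero d (a + 1) (b + 1)"
  obtains Y where "jacobi_op a b Y = smult (- jacobi_eigenvalue a b (Suc d)) Y"
    "poly (pderiv Y) \<tau> = 0" "\<And>u. \<tau> < u \<Longrightarrow> poly Y \<tau> < poly Y u" "poly Y \<tau> < 0"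
proof -
  define l where "l = jacobi_eigenvalue a b (Suc d)"
  have l: "l \<noteq> 0" unfolding l_def using jacobi_eigenvalue_pos[OF ab, of "Suc d"] by simp
  have \<tau>: "0 < \<tau>" "\<tau> < 1" "poly (jacobi_poly d (a + 1) (b + 1)) \<tau> = 0"
    and pos: "\<And>u. \<tau> < u \<Longrightarrow> 0 < poly (jacobi_poly d (a + 1) (b + 1)) u"
    using largest_jacobi_zero[of "a + 1" "b + 1" d] ab d unfolding \<tau>_def by auto
  obtain Y where Y: "pderiv Y = jacobi_poly d (a + 1) (b + 1)" "jacobi_op a b Y = smult (- l) Y"
    using jacobi_op_eigen_antiderivative[OF jacobi_op_jacobi_poly jacobi_eigenvalue_shift, of a b d]
      l unfolding l_def by auto
  show thesis
  proof (rule that[of Y])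
    show "poly Y \<tau> < 0"
      using \<tau> Y l ab pos by (intro eigenpoly_neg_at_last_critical_point[of a b \<tau> Y l]) auto
    show "poly Y \<tau> < poly Y u" if "\<tau> < u" for u
      using pos that unfolding Y(1)[symmetric] by (rule poly_strict_increasing_after)
  qed (use Y \<tau>(3) in \<open>simp_all add: l_def\<close>)
qed

section \<open>Bounded pointwise limits of polynomials\<close>

definition bounded_poly_limit :: "(nat \<Rightarrow> real poly) \<Rightarrow> (real \<Rightarrow> real) \<Rightarrow> bool" where
  "bounded_poly_limit P f \<longleftrightarrow> (\<exists>M. \<forall>k. \<forall>u\<in>{0..1}. \<bar>poly (P k) u\<bar> \<le> M)
     \<and> (\<forall>u\<in>{0..1}. (\<lambda>k. poly (P k) u) \<longlonglongrightarrow> f u)"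

lemma bounded_poly_limitI:
  assumes "\<And>k u. u \<in> {0..1} \<Longrightarrow> \<bar>poly (P k) u\<bar> \<le> M"
    and "\<And>u. u \<in> {0..1} \<Longrightarrow> (\<lambda>k. poly (P k) u) \<longlonglongrightarrow> f u"
  shows "bounded_poly_limit P f"
  using assms unfolding bounded_poly_limit_def by blast

lemma bounded_poly_limitE:
  assumes "bounded_poly_limit P f"
  obtains M where "\<And>k u. u \<in> {0..1} \<Longrightarrow> \<bar>poly (P k) u\<bar> \<le> M"
    and "\<And>u. u \<in> {0..1} \<Longrightarrow> (\<lambda>k. poly (P k) u) \<longlonglongrightarrow> f u"
  using assms unfolding bounded_poly_limit_def by metis

lemma bounded_poly_limit_cong:
  "(\<And>u. u \<in> {0..1} \<Longrightarrow> f u = g u) \<Longrightarrow> bounded_poly_limit P f \<Longrightarrow> bounded_poly_limit P g"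
  by (simp add: bounded_poly_limit_def)

lemma poly_bounded_unit_interval:
  fixes Q :: "real poly"
  obtains M where "\<And>u. u \<in> {0..1} \<Longrightarrow> \<bar>poly Q u\<bar> \<le> M"
proof -
  have "compact (poly Q ` {0..1})"
    by (intro compact_continuous_image continuous_intros) auto
  then have "\<exists>M. \<forall>u\<in>{0..1}. \<bar>poly Q u\<bar> \<le> M"
    by (auto dest!: compact_imp_bounded simp: bounded_iff)
  then show thesis using that by blast
qed

lemma bounded_poly_limit_add:
  assumes "bounded_poly_limit P f" "bounded_poly_limit Q g"
  shows "bounded_poly_limit (\<lambda>k. P k + Q k) (\<lambda>u. f u + g u)"
proof -
  obtain M where P: "\<And>k u. u \<in> {0..1} \<Longrightarrow> \<bar>poly (P k) u\<bar> \<le> M"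
    "\<And>u. u \<in> {0..1} \<Longrightarrow> (\<lambda>k. poly (P k) u) \<longlonglongrightarrow> f u"
    using assms(1) by (rule bounded_poly_limitE) (rule that)
  obtain N where Q: "\<And>k u. u \<in> {0..1} \<Longrightarrow> \<bar>poly (Q k) u\<bar> \<le> N"
    "\<And>u. u \<in> {0..1} \<Longrightarrow> (\<lambda>k. poly (Q k) u) \<longlonglongrightarrow> g u"
    using assms(2) by (rule bounded_poly_limitE) (rule that)
  show ?thesis
  proof (rule bounded_poly_limitI)
    show "\<bar>poly (P k + Q k) u\<bar> \<le> M + N" if "u \<in> {0..1}" for k u
      using P(1)[OF that, of k] Q(1)[OF that, of k] by simp
  qed (simp add: P(2) Q(2) tendsto_add)
qed

lemma bounded_poly_limit_mult:
  assumes "bounded_poly_limit P f"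
  shows "bounded_poly_limit (\<lambda>k. q * P k) (\<lambda>u. poly q u * f u)"
proof -
  obtain M where P: "\<And>k u. u \<in> {0..1} \<Longrightarrow> \<bar>poly (P k) u\<bar> \<le> M"
    "\<And>u. u \<in> {0..1} \<Longrightarrow> (\<lambda>k. poly (P k) u) \<longlonglongrightarrow> f u"
    using assms by (rule bounded_poly_limitE) (rule that)
  obtain N where N: "\<And>u. u \<in> {0..1} \<Longrightarrow> \<bar>poly q u\<bar> \<le> N"
    using poly_bounded_unit_interval[of q] by metis
  show ?thesis
  proof (rule bounded_poly_limitI)
    show "\<bar>poly (q * P k) u\<bar> \<le> N * M" if "u \<in> {0..1}" for k u
      using P(1)[OF that, of k] N[OF that] by (simp add: abs_mult mult_mono')
  qed (simp add: P(2) tendsto_mult)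
qed

lemma Weierstrass_real_poly:
  fixes f :: "real \<Rightarrow> real"
  assumes "continuous_on {a..b} f" "e > 0"
  obtains R :: "real poly" where "\<And>u. u \<in> {a..b} \<Longrightarrow> \<bar>poly R u - f u\<bar> < e"
proof -
  obtain g where g: "real_polynomial_function g" "\<And>u. u \<in> {a..b} \<Longrightarrow> \<bar>f u - g u\<bar> < e"
    using Stone_Weierstrass_real_polynomial_function[of "{a..b}" f e] assms by auto
  obtain c n where c: "g = (\<lambda>u. \<Sum>i\<le>n. c i * u ^ i)"
    using g(1) by (auto simp: real_polynomial_function_iff_sum)
  show thesis
  proof (rule that[of "\<Sum>i\<le>n. monom (c i) i"])
    fix u assume "u \<in> {a..b}"
    then show "\<bar>poly (\<Sum>i\<le>n. monom (c i) i) u - f u\<bar> < e"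
      using g(2)[of u] by (simp add: poly_sum poly_monom c abs_minus_commute)
  qed
qed

lemma bounded_poly_limit_of_continuous:
  assumes cont: "\<And>k. continuous_on {0..1} (f k)"
    and bound: "\<And>k u. u \<in> {0..1} \<Longrightarrow> \<bar>f k u\<bar> \<le> M"
    and lim: "\<And>u. u \<in> {0..1} \<Longrightarrow> (\<lambda>k. f k u) \<longlonglongrightarrow> g u"
  obtains R where "bounded_poly_limit R g"
proof -
  have "\<exists>R. \<forall>u\<in>{0..1}. \<bar>poly R u - f k u\<bar> < inverse (real (Suc k))" for k
    using Weierstrass_real_poly[OF cont, of "inverse (real (Suc k))" k]
    by (metis inverse_positive_iff_positive of_nat_0_less_iff zero_less_Suc)
  then obtain R where R: "\<And>k u. u \<in> {0..1} \<Longrightarrow> \<bar>poly (R k) u - f k u\<bar> < inverse (real (Suc k))"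
    by metis
  have "\<bar>poly (R k) u\<bar> \<le> M + 1" if "u \<in> {0..1}" for k u
  proof -
    have "inverse (real (Suc k)) \<le> 1" by (simp add: inverse_le_1_iff)
    then show ?thesis using R[OF that, of k] bound[OF that, of k] by linarith
  qed
  moreover have "(\<lambda>k. poly (R k) u) \<longlonglongrightarrow> g u" if "u \<in> {0..1}" for u
  proof -
    have "(\<lambda>k. poly (R k) u - f k u) \<longlonglongrightarrow> 0"
      by (rule Lim_null_comparison[OF _ LIMSEQ_inverse_real_of_nat])
        (use R[OF that] in \<open>auto intro!: always_eventually less_imp_le\<close>)
    from tendsto_add[OF this lim[OF that]] show ?thesis by simp
  qed
  ultimately show thesis
    by (intro that[of R] bounded_poly_limitI)
qed

lemma has_integral_pderiv:
  fixes p :: "real poly"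
  assumes "c \<le> u"
  shows "(poly (pderiv p) has_integral poly p u - poly p c) {c..u}"
  using assms poly_DERIV[of p]
  by (intro fundamental_theorem_of_calculus)
    (auto intro: has_field_derivative_at_within
      simp flip: has_real_derivative_iff_has_vector_derivative)

lemma bounded_poly_limit_antiderivative:
  assumes R: "bounded_poly_limit (\<lambda>k. pderiv (P k)) f" and P: "\<And>k. poly (P k) 0 = 0"
    and F: "\<And>u. u \<in> {0..1} \<Longrightarrow> (f has_integral F u) {0..u}"
  shows "bounded_poly_limit P F"
proof -
  obtain M where M: "\<And>k u. u \<in> {0..1} \<Longrightarrow> \<bar>poly (pderiv (P k)) u\<bar> \<le> M"
    and lim: "\<And>u. u \<in> {0..1} \<Longrightarrow> (\<lambda>k. poly (pderiv (P k)) u) \<longlonglongrightarrow> f u"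
    using R by (rule bounded_poly_limitE) (rule that)
  have M0: "M \<ge> 0" using M[of 0 0] by simp
  have int: "(poly (pderiv (P k)) has_integral poly (P k) u) {0..u}" if "u \<in> {0..1}" for k u
    using has_integral_pderiv[of 0 u "P k"] that by (simp add: P)
  have "\<bar>poly (P k) u\<bar> \<le> M" if u: "u \<in> {0..1}" for k u
  proof -
    have "\<bar>poly (P k) u\<bar> \<le> M * u"
      using has_integral_bound_real[OF M0 finite.emptyI int[OF u, of k]] M u by auto
    also have "\<dots> \<le> M * 1" using M0 u by (intro mult_left_mono) auto
    finally show ?thesis by simp
  qed
  moreover have "(\<lambda>k. poly (P k) u) \<longlonglongrightarrow> F u" if u: "u \<in> {0..1}" for u
  proof -
    have "(\<lambda>k. integral {0..u} (poly (pderiv (P k)))) \<longlonglongrightarrow> integral {0..u} f"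
    proof (rule dominated_convergence(2))
      show "poly (pderiv (P k)) integrable_on {0..u}" for k using int[OF u] by blast
      show "(\<lambda>_. M) integrable_on {0..u}" by (rule integrable_const_ivl)
    qed (use M lim u in auto)
    then show ?thesis by (simp add: integral_unique[OF int[OF u]] integral_unique[OF F[OF u]])
  qed
  ultimately show ?thesis by (rule bounded_poly_limitI)
qed

lemma bounded_poly_limit_truncation:
  obtains R where "bounded_poly_limit R (\<lambda>u. indicat_real {\<tau><..} u * poly p u)"
proof -
  define \<kappa> where "\<kappa> k u = max 0 (min 1 (real k * (u - \<tau>)))" for k u
  obtain M where M: "\<And>u. u \<in> {0..1} \<Longrightarrow> \<bar>poly p u\<bar> \<le> M"
    using poly_bounded_unit_interval[of p] by metis
  show thesis
  proof (rule bounded_poly_limit_of_continuous)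
    show "continuous_on {0..1} (\<lambda>u. \<kappa> k u * poly p u)" for k
      unfolding \<kappa>_def by (intro continuous_intros)
    show "\<bar>\<kappa> k u * poly p u\<bar> \<le> 1 * M" if "u \<in> {0..1}" for k u
      unfolding abs_mult using M[OF that] by (intro mult_mono) (auto simp: \<kappa>_def)
    show "(\<lambda>k. \<kappa> k u * poly p u) \<longlonglongrightarrow> indicat_real {\<tau><..} u * poly p u" for u
    proof (intro tendsto_mult tendsto_const tendsto_eventually)
      show "\<forall>\<^sub>F k in sequentially. \<kappa> k u = indicat_real {\<tau><..} u"
      proof (cases "\<tau> < u")
        case True
        have "\<forall>\<^sub>F k in sequentially. 1 / (u - \<tau>) \<le> real k"
          using filterlim_real_sequentially by (simp add: filterlim_at_top)
        then show ?thesis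
          by eventually_elim (use True in \<open>auto simp: \<kappa>_def field_simps\<close>)
      next
        case False
        then have "\<kappa> k u = 0" for k
          by (simp add: \<kappa>_def max_absorb1 min_le_iff_disj mult_le_0_iff)
        then show ?thesis using False by simp
      qed
    qed
  qed (rule that)
qed

lemma has_integral_truncated_pderiv:
  assumes "0 \<le> \<tau>" "0 \<le> u"
  shows "((\<lambda>v. indicat_real {\<tau><..} v * poly (pderiv p) v) has_integral
    indicat_real {\<tau><..} u * (poly p u - poly p \<tau>)) {0..u}"
proof (cases "\<tau> < u")
  case True
  then have "(poly (pderiv p) has_integral poly p u - poly p \<tau>) {\<tau>..u}"
    by (intro has_integral_pderiv) simp
  then have "((\<lambda>v. if v \<in> {\<tau>..u} then poly (pderiv p) v else 0)
      has_integral poly p u - poly p \<tau>) {0..u}"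
    using assms by (subst has_integral_restrict) auto
  then show ?thesis
    unfolding indicator_simps(1)[OF greaterThan_iff[THEN iffD2, OF True]] mult_1
    by (rule has_integral_spike_finite[of "{\<tau>}", rotated 2]) auto
next
  case False
  then show ?thesis by (intro has_integral_is_0[THEN has_integral_eq_rhs]) auto
qed

text \<open>Since \<open>\<tau>\<close> is a critical point of \<open>Y\<close>, the truncation of \<open>Y - Y(\<tau>)\<close> is continuously
  differentiable, and its second derivative is the truncation of \<open>Y''\<close>.\<close>

lemma truncated_poly_C2_approximation:
  assumes \<tau>: "0 \<le> \<tau>" and critical: "poly (pderiv Y) \<tau> = 0"
  obtains P where
    "bounded_poly_limit P (\<lambda>u. indicat_real {\<tau><..} u * (poly Y u - poly Y \<tau>))"
    "bounded_poly_limit (\<lambda>k. pderiv (P k)) (\<lambda>u. indicat_real {\<tau><..} u * poly (pderiv Y) u)"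
    "bounded_poly_limit (\<lambda>k. pderiv (pderiv (P k)))
      (\<lambda>u. indicat_real {\<tau><..} u * poly (pderiv (pderiv Y)) u)"
proof -
  obtain R where R: "bounded_poly_limit R (\<lambda>u. indicat_real {\<tau><..} u * poly (pderiv (pderiv Y)) u)"
    by (rule bounded_poly_limit_truncation)
  have "\<exists>P. pderiv (pderiv P) = R k \<and> poly (pderiv P) 0 = 0 \<and> poly P 0 = 0" for k
    using poly_antiderivative by metis
  then obtain P where P: "\<And>k. pderiv (pderiv (P k)) = R k" "\<And>k. poly (pderiv (P k)) 0 = 0"
    "\<And>k. poly (P k) 0 = 0"
    by metis
  have P2: "bounded_poly_limit (\<lambda>k. pderiv (pderiv (P k)))
      (\<lambda>u. indicat_real {\<tau><..} u * poly (pderiv (pderiv Y)) u)"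
    using R by (simp add: P)
  have P1: "bounded_poly_limit (\<lambda>k. pderiv (P k)) (\<lambda>u. indicat_real {\<tau><..} u * poly (pderiv Y) u)"
    using has_integral_truncated_pderiv[OF \<tau>, of _ "pderiv Y"]
    by (intro bounded_poly_limit_antiderivative[OF P2 P(2)]) (auto simp: critical)
  have P0: "bounded_poly_limit P (\<lambda>u. indicat_real {\<tau><..} u * (poly Y u - poly Y \<tau>))"
    using has_integral_truncated_pderiv[OF \<tau>, of _ Y]
    by (intro bounded_poly_limit_antiderivative[OF P1 P(3)]) auto
  show thesis using P0 P1 P2 by (rule that)
qed

lemma truncated_eigenpoly_approximation:
  assumes \<tau>: "0 \<le> \<tau>" and critical: "poly (pderiv Y) \<tau> = 0"
    and eigen: "jacobi_op a b Y = smult (- l) Y"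
  obtains P where "bounded_poly_limit P (\<lambda>u. indicat_real {\<tau><..} u * (poly Y u - poly Y \<tau>))"
    and "bounded_poly_limit (\<lambda>k. jacobi_op a b (P k) + smult l (P k))
      (\<lambda>u. - (l * poly Y \<tau>) * indicat_real {\<tau><..} u)"
proof -
  obtain P where P: "bounded_poly_limit P (\<lambda>u. indicat_real {\<tau><..} u * (poly Y u - poly Y \<tau>))"
    "bounded_poly_limit (\<lambda>k. pderiv (P k)) (\<lambda>u. indicat_real {\<tau><..} u * poly (pderiv Y) u)"
    "bounded_poly_limit (\<lambda>k. pderiv (pderiv (P k)))
      (\<lambda>u. indicat_real {\<tau><..} u * poly (pderiv (pderiv Y)) u)"
    using \<tau> critical by (rule truncated_poly_C2_approximation)
  have smult_as_mult: "smult l Q = [:l:] * Q" for Q by simp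
  have "bounded_poly_limit (\<lambda>k. jacobi_op a b (P k) + smult l (P k))
      (\<lambda>u. - (l * poly Y \<tau>) * indicat_real {\<tau><..} u)"
  proof (rule bounded_poly_limit_cong)
    show "bounded_poly_limit (\<lambda>k. jacobi_op a b (P k) + smult l (P k))
      (\<lambda>u. poly [:0, 1, -1:] u * (indicat_real {\<tau><..} u * poly (pderiv (pderiv Y)) u)
        + poly [:b + 1, - (a + b + 2):] u * (indicat_real {\<tau><..} u * poly (pderiv Y) u)
        + poly [:l:] u * (indicat_real {\<tau><..} u * (poly Y u - poly Y \<tau>)))"
      unfolding jacobi_op_def smult_as_mult
      by (intro bounded_poly_limit_add bounded_poly_limit_mult P)
    fix u
    have "poly (jacobi_op a b Y) u = - l * poly Y u" by (simp add: eigen)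
    then show "poly [:0, 1, -1:] u * (indicat_real {\<tau><..} u * poly (pderiv (pderiv Y)) u)
        + poly [:b + 1, - (a + b + 2):] u * (indicat_real {\<tau><..} u * poly (pderiv Y) u)
        + poly [:l:] u * (indicat_real {\<tau><..} u * (poly Y u - poly Y \<tau>))
      = - (l * poly Y \<tau>) * indicat_real {\<tau><..} u"
      by (cases "\<tau> < u") (simp_all add: poly_jacobi_op algebra_simps)
  qed
  with P(1) show thesis by (rule that)
qed

lemma jacobi_mean_bounded_limit:
  assumes ab: "a > -1" "b > -1" and P: "bounded_poly_limit P f"
  shows "(\<lambda>k. jacobi_mean a b (poly (P k))) \<longlonglongrightarrow> jacobi_mean a b f"
proof -
  obtain M where M: "\<And>k u. u \<in> {0..1} \<Longrightarrow> \<bar>poly (P k) u\<bar> \<le> M"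
    and lim: "\<And>u. u \<in> {0..1} \<Longrightarrow> (\<lambda>k. poly (P k) u) \<longlonglongrightarrow> f u"
    using P by (rule bounded_poly_limitE) (rule that)
  have "(\<lambda>k. integral {0..1} (\<lambda>u. poly (P k) u * jacobi_weight a b u))
      \<longlonglongrightarrow> integral {0..1} (\<lambda>u. f u * jacobi_weight a b u)"
  proof (rule dominated_convergence(2))
    show "(\<lambda>u. poly [:M:] u * jacobi_weight a b u) integrable_on {0..1}"
      by (rule jacobi_weight_poly_integrable[OF ab])
    show "norm (poly (P k) u * jacobi_weight a b u) \<le> poly [:M:] u * jacobi_weight a b u"
      if "u \<in> {0..1}" for k u
      using M[OF that, of k] jacobi_weight_nonneg[of a b u] by (simp add: abs_mult mult_right_mono)
    show "(\<lambda>k. poly (P k) u * jacobi_weight a b u) \<longlonglongrightarrow> f u * jacobi_weight a b u"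
      if "u \<in> {0..1}" for u
      by (intro tendsto_mult_right lim that)
  qed (rule jacobi_weight_poly_integrable[OF ab])
  then show ?thesis
    unfolding jacobi_mean_def using Beta_pos[of "b + 1" "a + 1"] ab
    by (intro tendsto_divide tendsto_const) auto
qed

section \<open>The weight of a cap\<close>

definition incomplete_beta_coeff :: "real \<Rightarrow> real \<Rightarrow> nat \<Rightarrow> real" where
  "incomplete_beta_coeff a b k = (a + 1) / (a + 1 + real k) * ((-1) ^ k * (b gchoose k))"

lemma hyp2F1_incomplete_beta:
  assumes "a > -1"
  shows "hyp2F1 (- b) (a + 1) (a + 2) = (\<lambda>z. \<Sum>k. incomplete_beta_coeff a b k * z ^ k)"
proof -
  have "pochhammer (- b) k * pochhammer (a + 1) k / (pochhammer (a + 2) k * fact k)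
      = incomplete_beta_coeff a b k" for k
  proof -
    have "(a + 1) * pochhammer (a + 2) k = pochhammer (a + 1) k * (a + 1 + real k)"
      using pochhammer_rec[of "a + 1" k] pochhammer_Suc[of "a + 1" k] by (simp add: add_ac)
    moreover have "pochhammer (a + 2) k > 0" "a + 1 + real k > 0"
      using assms by (auto intro!: pochhammer_pos)
    ultimately have "pochhammer (a + 1) k / pochhammer (a + 2) k = (a + 1) / (a + 1 + real k)"
      by (simp add: field_simps)
    moreover have "pochhammer (- b) k / fact k = (-1) ^ k * (b gchoose k)"
      by (simp add: gbinomial_pochhammer)
    ultimately show ?thesis
      unfolding incomplete_beta_coeff_def by (metis times_divide_times_eq mult.commute)
  qed
  then show ?thesis unfolding hyp2F1_def by simp
qed

lemma one_minus_powr_sums: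
  fixes b x :: real
  assumes "\<bar>x\<bar> < 1"
  shows "(\<lambda>k. (-1) ^ k * (b gchoose k) * x ^ k) sums (1 - x) powr b"
  using gen_binomial_real[of "- x" b] assms by (simp add: power_minus[of x] mult_ac)

lemma summable_incomplete_beta:
  assumes a: "a > -1" and x: "\<bar>x\<bar> < 1"
  shows "summable (\<lambda>k. incomplete_beta_coeff a b k * x ^ k)"
proof -
  obtain y where y: "\<bar>x\<bar> < y" "y < 1" using dense[OF x] by blast
  have "summable (\<lambda>k. norm ((-1) ^ k * (b gchoose k) * x ^ k))"
    using powser_insidea[of "\<lambda>k. (-1) ^ k * (b gchoose k)" y x] one_minus_powr_sums[of y b] y
    by (auto simp: sums_iff)
  then show ?thesis
  proof (rule summable_comparison_test[rotated], intro exI allI impI)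
    fix k
    have "\<bar>(a + 1) / (a + 1 + real k)\<bar> * \<bar>(-1) ^ k * (b gchoose k) * x ^ k\<bar>
        \<le> 1 * \<bar>(-1) ^ k * (b gchoose k) * x ^ k\<bar>"
      using a by (intro mult_right_mono) (auto simp: field_simps)
    then show "norm (incomplete_beta_coeff a b k * x ^ k) \<le> norm ((-1) ^ k * (b gchoose k) * x ^ k)"
      by (simp add: incomplete_beta_coeff_def abs_mult mult.assoc)
  qed
qed

text \<open>The factor \<open>a + 1 + z d/dz\<close> cancels the denominators of the coefficients and leaves the
  binomial series.\<close>

lemma hyp2F1_incomplete_beta_deriv:
  fixes a b z :: real
  assumes a: "a > -1" and z: "\<bar>z\<bar> < 1"
  defines "H \<equiv> hyp2F1 (- b) (a + 1) (a + 2)"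
  obtains D where "(H has_real_derivative D) (at z)"
    "(a + 1) * H z + z * D = (a + 1) * (1 - z) powr b"
proof -
  define h where "h = incomplete_beta_coeff a b"
  define D where "D = (\<Sum>k. diffs h k * z ^ k)"
  have H: "H = (\<lambda>z. \<Sum>k. h k * z ^ k)"
    unfolding H_def h_def by (rule hyp2F1_incomplete_beta[OF a])
  have h_summable: "summable (\<lambda>k. h k * x ^ k)" if "\<bar>x\<bar> < 1" for x
    unfolding h_def using a that by (rule summable_incomplete_beta)
  have deriv: "(H has_real_derivative D) (at z)"
    unfolding H D_def using termdiffs_strong'[of 1 h z] h_summable z by simp
  have "summable (\<lambda>k. diffs h k * z ^ k)"
    using termdiff_converges[of z 1 h] h_summable z by simp
  then have "(\<lambda>k. real (Suc k) * h (Suc k) * z ^ Suc k) sums (z * D)"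
    using sums_mult[OF summable_sums, of _ z] by (simp add: D_def diffs_def mult_ac)
  then have "(\<lambda>k. real k * h k * z ^ k) sums (z * D)"
    by (subst (asm) sums_Suc_iff) simp
  then have "(\<lambda>k. (a + 1) * (h k * z ^ k) + real k * h k * z ^ k) sums ((a + 1) * H z + z * D)"
    unfolding H using h_summable z by (intro sums_add sums_mult summable_sums) auto
  moreover have "(a + 1) * (h k * z ^ k) + real k * h k * z ^ k
      = (a + 1) * ((-1) ^ k * (b gchoose k) * z ^ k)" for k
  proof -
    have "(a + 1) * (h k * z ^ k) + real k * h k * z ^ k = ((a + 1 + real k) * h k) * z ^ k"
      by (simp add: algebra_simps)
    also have "(a + 1 + real k) * h k = (a + 1) * ((-1) ^ k * (b gchoose k))"
      using a by (simp add: h_def incomplete_beta_coeff_def)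
    finally show ?thesis by simp
  qed
  ultimately have "(a + 1) * H z + z * D = (a + 1) * (1 - z) powr b"
    using sums_mult[OF one_minus_powr_sums[OF z], of "a + 1" b] by (simp add: sums_unique2)
  with deriv show thesis by (rule that)
qed

definition incomplete_beta :: "real \<Rightarrow> real \<Rightarrow> real \<Rightarrow> real" where
  "incomplete_beta a b z = z powr (a + 1) / (a + 1) * hyp2F1 (- b) (a + 1) (a + 2) z"

lemma incomplete_beta_has_derivative:
  assumes a: "a > -1" and z: "0 < z" "z < 1"
  shows "(incomplete_beta a b has_real_derivative z powr a * (1 - z) powr b) (at z)"
proof -
  define H where "H = hyp2F1 (- b) (a + 1) (a + 2)"
  obtain D where D: "(H has_real_derivative D) (at z)"
    "(a + 1) * H z + z * D = (a + 1) * (1 - z) powr b"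
    using hyp2F1_incomplete_beta_deriv[OF a, of z b] z unfolding H_def by auto
  have "((\<lambda>z. z powr (a + 1)) has_real_derivative (a + 1) * z powr (a + 1 - 1)) (at z)"
    using z by (intro has_real_derivative_powr) auto
  from DERIV_cdivide[OF this, of "a + 1"]
  have "((\<lambda>z. z powr (a + 1) / (a + 1)) has_real_derivative z powr a) (at z)" using a by simp
  from DERIV_mult[OF this D(1)]
  have "(incomplete_beta a b has_real_derivative
      z powr a * H z + z powr (a + 1) / (a + 1) * D) (at z)"
    by (simp add: incomplete_beta_def[abs_def] H_def mult.commute add.commute)
  moreover have "z powr a * H z + z powr (a + 1) / (a + 1) * D
      = z powr a / (a + 1) * ((a + 1) * H z + z * D)"
    using a z by (simp add: powr_add field_simps)
  ultimately show ?thesis using a by (simp only: D(2)) simp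
qed

lemma continuous_on_incomplete_beta:
  assumes a: "a > -1" and z: "z < 1"
  shows "continuous_on {0..z} (incomplete_beta a b)"
proof -
  have "isCont (hyp2F1 (- b) (a + 1) (a + 2)) x" if "x \<in> {0..z}" for x
    using hyp2F1_incomplete_beta_deriv[OF a, of x b] DERIV_isCont that z by (metis abs_of_nonneg
        atLeastAtMost_iff order_le_less_trans)
  then have "continuous_on {0..z} (hyp2F1 (- b) (a + 1) (a + 2))"
    by (simp add: continuous_at_imp_continuous_on)
  moreover have "continuous_on {0..z} (\<lambda>z. z powr (a + 1))"
    using a by (intro continuous_on_powr' continuous_intros) auto
  ultimately show ?thesis
    unfolding incomplete_beta_def[abs_def] using a
    by (intro continuous_on_mult continuous_on_divide continuous_on_const) auto
qed

context
  fixes a b \<tau> :: real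
  assumes a: "a > -1" and \<tau>: "0 < \<tau>" "\<tau> < 1"
begin

lemma cap_primitive_has_derivative:
  assumes u: "\<tau> < u" "u < 1"
  shows "((\<lambda>u. - incomplete_beta a b (1 - u)) has_real_derivative jacobi_weight a b u) (at u)"
proof -
  have "(incomplete_beta a b has_real_derivative (1 - u) powr a * u powr b) (at (1 - u))"
    using incomplete_beta_has_derivative[OF a, of "1 - u" b] u \<tau> by simp
  then have "((\<lambda>u. incomplete_beta a b (1 - u)) has_real_derivative
      ((1 - u) powr a * u powr b) * (- 1)) (at u)"
    by (rule DERIV_chain2[where g = "\<lambda>u. 1 - u"]) (auto intro!: derivative_eq_intros)
  from DERIV_minus[OF this] show ?thesis
    by (simp add: jacobi_weight_def mult.commute)
qed

lemma continuous_on_cap_primitive: "continuous_on {\<tau>..1} (\<lambda>u. - incomplete_beta a b (1 - u))"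
proof -
  have "continuous_on {0..1 - \<tau>} (incomplete_beta a b)"
    using \<tau> by (intro continuous_on_incomplete_beta a) simp
  then have "continuous_on {\<tau>..1} (\<lambda>u. incomplete_beta a b (1 - u))"
    by (rule continuous_on_compose2[where f = "\<lambda>u. 1 - u"]) (auto intro!: continuous_intros)
  then show ?thesis by (rule continuous_on_minus)
qed

lemma jacobi_weight_has_integral_cap:
  "(jacobi_weight a b has_integral incomplete_beta a b (1 - \<tau>)) {\<tau>..1}"
proof -
  have "(jacobi_weight a b has_integral
      (- incomplete_beta a b (1 - 1)) - (- incomplete_beta a b (1 - \<tau>))) {\<tau>..1}"
    using \<tau> continuous_on_cap_primitive cap_primitive_has_derivative
    by (intro fundamental_theorem_of_calculus_interior)
      (auto simp flip: has_real_derivative_iff_has_vector_derivative)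
  then show ?thesis using a by (simp add: incomplete_beta_def)
qed

lemma incomplete_beta_pos: "0 < incomplete_beta a b (1 - \<tau>)"
proof -
  have "- incomplete_beta a b (1 - \<tau>) < - incomplete_beta a b (1 - 1)"
  proof (rule DERIV_pos_imp_increasing_open[OF \<tau>(2) _ continuous_on_cap_primitive])
    fix u assume u: "\<tau> < u" "u < 1"
    then have "0 < jacobi_weight a b u" using \<tau> by (simp add: jacobi_weight_def)
    then show "\<exists>D. ((\<lambda>u. - incomplete_beta a b (1 - u)) has_real_derivative D) (at u) \<and> 0 < D"
      using cap_primitive_has_derivative[OF u] by blast
  qed
  then show ?thesis using a by (simp add: incomplete_beta_def)
qed

lemma jacobi_mean_cap:
  "jacobi_mean a b (indicat_real {\<tau><..}) = incomplete_beta a b (1 - \<tau>) / Beta (b + 1) (a + 1)"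
proof -
  have "((\<lambda>u. if u \<in> {\<tau>..1} then jacobi_weight a b u else 0)
      has_integral incomplete_beta a b (1 - \<tau>)) {0..1}"
    using \<tau> jacobi_weight_has_integral_cap by (subst has_integral_restrict) auto
  then have "((\<lambda>u. indicat_real {\<tau><..} u * jacobi_weight a b u)
      has_integral incomplete_beta a b (1 - \<tau>)) {0..1}"
    by (rule has_integral_spike_finite[of "{\<tau>}", rotated 2]) (auto simp: indicator_def)
  then show ?thesis by (simp add: jacobi_mean_def integral_unique)
qed

end

section \<open>Jacobi designs\<close>

text \<open>The functions \<open>t\<^sub>i\<close> play the role of \<open>|(x\<^sub>i, z)|\<^sup>2\<close> for the nodes \<open>x\<^sub>i\<close> of a cubature formula
  with weights \<open>\<rho>\<^sub>i\<close>.\<close>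

locale jacobi_design = prob_space M for M :: "'z measure" +
  fixes a b :: real and d n :: nat and \<rho> :: "nat \<Rightarrow> real" and t :: "nat \<Rightarrow> 'z \<Rightarrow> real"
  assumes ab: "a > -1" "b > -1"
    and weights_nonneg: "i < n \<Longrightarrow> 0 \<le> \<rho> i"
    and sum_weights: "(\<Sum>i<n. \<rho> i) = 1"
    and measurable_t: "i < n \<Longrightarrow> t i \<in> borel_measurable M"
    and t_range: "i < n \<Longrightarrow> z \<in> space M \<Longrightarrow> t i z \<in> {0..1}"
    and jacobi_op_symmetric: "i < n \<Longrightarrow> j < n \<Longrightarrow>
      (\<integral>z. poly P (t i z) * poly (jacobi_op a b R) (t j z) \<partial>M)
        = (\<integral>z. poly (jacobi_op a b P) (t i z) * poly R (t j z) \<partial>M)"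
    and low_degree: "degree R \<le> d \<Longrightarrow> z \<in> space M \<Longrightarrow>
      (\<Sum>i<n. \<rho> i * poly R (t i z)) = jacobi_mean a b (poly R)"
begin

definition averaged :: "(real \<Rightarrow> real) \<Rightarrow> 'z \<Rightarrow> real" where
  "averaged f z = (\<Sum>i<n. \<rho> i * f (t i z))"

definition averaged_form :: "(real \<Rightarrow> real) \<Rightarrow> (real \<Rightarrow> real) \<Rightarrow> real" where
  "averaged_form f g = (\<integral>z. averaged f z * averaged g z \<partial>M)"

abbreviation eigenpoly :: "nat \<Rightarrow> real poly" where
  "eigenpoly k \<equiv> jacobi_poly k a b"

abbreviation eigenvalue :: "nat \<Rightarrow> real" where
  "eigenvalue k \<equiv> jacobi_eigenvalue a b k"

lemma measurable_poly_t: "i < n \<Longrightarrow> (\<lambda>z. poly P (t i z)) \<in> borel_measurable M"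
  by (rule measurable_compose[OF measurable_t])
    (auto intro!: borel_measurable_continuous_onI continuous_intros)

lemma integrable_poly_t_mult:
  assumes "i < n" "j < n"
  shows "integrable M (\<lambda>z. poly P (t i z) * poly R (t j z))"
proof -
  obtain C where C: "\<And>u. u \<in> {0..1} \<Longrightarrow> \<bar>poly P u\<bar> \<le> C"
    using poly_bounded_unit_interval[of P] by metis
  obtain D where D: "\<And>u. u \<in> {0..1} \<Longrightarrow> \<bar>poly R u\<bar> \<le> D"
    using poly_bounded_unit_interval[of R] by metis
  show ?thesis
  proof (rule integrable_const_bound[where B = "C * D"])
    show "AE z in M. norm (poly P (t i z) * poly R (t j z)) \<le> C * D"
      using C[OF t_range[OF assms(1)]] D[OF t_range[OF assms(2)]]
      by (intro AE_I2) (simp add: abs_mult mult_mono')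
  qed (intro borel_measurable_times measurable_poly_t assms)
qed

lemma integrable_poly_t: "i < n \<Longrightarrow> integrable M (\<lambda>z. poly P (t i z))"
  using integrable_poly_t_mult[of i i P 1] by simp

lemma expectation_poly_t:
  assumes "i < n"
  shows "(\<integral>z. poly P (t i z) \<partial>M) = jacobi_mean a b (poly P)"
proof (rule expectation_eq_jacobi_mean[OF ab integrable_poly_t[OF assms]])
  show "(\<integral>z. poly (jacobi_op a b P) (t i z) \<partial>M) = 0" for P
    using jacobi_op_symmetric[OF assms assms, of 1 P] by simp
qed

lemma averaged_form_expand:
  "averaged_form (poly P) (poly R)
    = (\<Sum>i<n. \<Sum>j<n. \<rho> i * \<rho> j * (\<integral>z. poly P (t i z) * poly R (t j z) \<partial>M))"
proof -
  have "averaged_form (poly P) (poly R)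
     = (\<integral>z. (\<Sum>i<n. \<Sum>j<n. \<rho> i * \<rho> j * (poly P (t i z) * poly R (t j z))) \<partial>M)"
    unfolding averaged_form_def averaged_def sum_product by (simp add: mult_ac)
  also have "\<dots> = (\<Sum>i<n. \<integral>z. (\<Sum>j<n. \<rho> i * \<rho> j * (poly P (t i z) * poly R (t j z))) \<partial>M)"
    by (intro Bochner_Integration.integral_sum Bochner_Integration.integrable_sum
        integrable_mult_right integrable_poly_t_mult) auto
  also have "\<dots> = (\<Sum>i<n. \<Sum>j<n. \<integral>z. \<rho> i * \<rho> j * (poly P (t i z) * poly R (t j z)) \<partial>M)"
    by (intro sum.cong refl Bochner_Integration.integral_sum integrable_mult_right
        integrable_poly_t_mult) auto
  finally show ?thesis by simp
qed

lemma averaged_form_jacobi_op: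
  "averaged_form (poly (jacobi_op a b P)) (poly R)
    = averaged_form (poly P) (poly (jacobi_op a b R))"
  unfolding averaged_form_expand by (intro sum.cong refl) (simp add: jacobi_op_symmetric)

lemma averaged_smult: "averaged (poly (smult c P)) z = c * averaged (poly P) z"
  by (simp add: averaged_def sum_distrib_left mult_ac)

lemma averaged_sum: "averaged (poly (\<Sum>k\<in>A. f k)) z = (\<Sum>k\<in>A. averaged (poly (f k)) z)"
  unfolding averaged_def poly_sum sum_distrib_left by (rule sum.swap)

lemma averaged_form_smult:
  "averaged_form (poly (smult c P)) (poly R) = c * averaged_form (poly P) (poly R)"
  "averaged_form (poly P) (poly (smult c R)) = c * averaged_form (poly P) (poly R)"
  unfolding averaged_form_def averaged_smult by (simp_all add: mult.assoc mult.left_commute)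

lemma integrable_averaged_poly_mult:
  "integrable M (\<lambda>z. averaged (poly P) z * averaged (poly R) z)"
proof -
  have "integrable M (\<lambda>z. \<Sum>i<n. \<Sum>j<n. \<rho> i * \<rho> j * (poly P (t i z) * poly R (t j z)))"
    by (intro Bochner_Integration.integrable_sum integrable_mult_right integrable_poly_t_mult) auto
  then show ?thesis
    unfolding averaged_def sum_product by (simp add: mult_ac)
qed

lemma averaged_form_sum_smult:
  "averaged_form (poly (\<Sum>k\<in>A. smult (c k) (f k))) (poly (\<Sum>j\<in>B. smult (e j) (g j)))
    = (\<Sum>k\<in>A. \<Sum>j\<in>B. c k * e j * averaged_form (poly (f k)) (poly (g j)))"
proof -
  have "averaged_form (poly (\<Sum>k\<in>A. smult (c k) (f k))) (poly (\<Sum>j\<in>B. smult (e j) (g j)))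
    = (\<integral>z. (\<Sum>k\<in>A. \<Sum>j\<in>B. c k * e j * (averaged (poly (f k)) z * averaged (poly (g j)) z)) \<partial>M)"
    unfolding averaged_form_def averaged_sum averaged_smult sum_product by (simp add: mult_ac)
  then show ?thesis
    by (simp add: averaged_form_def Bochner_Integration.integral_sum integrable_averaged_poly_mult)
qed

lemma averaged_form_jacobi_orthogonal:
  assumes "k \<noteq> l"
  shows "averaged_form (poly (eigenpoly k)) (poly (eigenpoly l)) = 0"
proof -
  have "eigenvalue k * averaged_form (poly (eigenpoly k)) (poly (eigenpoly l))
      = eigenvalue l * averaged_form (poly (eigenpoly k)) (poly (eigenpoly l))"
    using averaged_form_jacobi_op[of "eigenpoly k" "eigenpoly l"]
    unfolding jacobi_op_jacobi_poly averaged_form_smult by simp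
  moreover have "eigenvalue k \<noteq> eigenvalue l"
    using assms strict_mono_eq[OF jacobi_eigenvalue_strict_mono[OF ab]] by simp
  ultimately show ?thesis by simp
qed

lemma averaged_form_diagonal_nonneg: "0 \<le> averaged_form f f"
  unfolding averaged_form_def by (intro integral_nonneg_AE AE_I2) simp

lemma averaged_form_jacobi_diagonal:
  "(eigenvalue (Suc d) - eigenvalue k) * averaged_form (poly (eigenpoly k)) (poly (eigenpoly k))
    \<le> (if k = 0 then eigenvalue (Suc d) else 0)"
proof -
  consider "k = 0" | "0 < k" "k \<le> d" | "Suc d \<le> k" by linarith
  then show ?thesis
  proof cases
    case 1
    have "averaged_form (poly 1) (poly 1) = 1"
      by (simp add: averaged_form_def averaged_def sum_weights prob_space)
    then show ?thesis using 1 by simp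
  next
    case 2
    have "averaged (poly (eigenpoly k)) z = 0" if "z \<in> space M" for z
      using low_degree[OF _ that, of "eigenpoly k"] degree_jacobi_poly[OF ab] 2(2)
        jacobi_mean_jacobi_poly[OF ab 2(1)]
      by (simp add: averaged_def)
    then have "averaged_form (poly (eigenpoly k)) (poly (eigenpoly k)) = (\<integral>z. 0 \<partial>M)"
      unfolding averaged_form_def by (intro Bochner_Integration.integral_cong) auto
    then show ?thesis using 2 by simp
  next
    case 3
    have "eigenvalue (Suc d) \<le> eigenvalue k"
      using 3 strict_mono_less_eq[OF jacobi_eigenvalue_strict_mono[OF ab]] by simp
    then show ?thesis
      using 3 averaged_form_diagonal_nonneg by (simp add: mult_nonpos_nonneg)
  qed
qed

text \<open>Expand in Jacobi polynomials: the terms of degree 1 to \<open>d\<close> vanish because the design is exact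
  on them, and those of degree above \<open>d\<close> are nonpositive.\<close>

lemma averaged_form_shifted_jacobi_op_le:
  defines "l \<equiv> eigenvalue (Suc d)"
  shows "averaged_form (poly P) (poly (jacobi_op a b P + smult l P))
    \<le> l * (jacobi_mean a b (poly P))\<^sup>2"
proof -
  obtain c N where P: "P = (\<Sum>k\<le>N. smult (c k) (eigenpoly k))"
    using jacobi_expansion[OF ab] by metis
  define norm2 where "norm2 k = averaged_form (poly (eigenpoly k)) (poly (eigenpoly k))" for k
  have "averaged_form (poly P) (poly (jacobi_op a b P + smult l P))
      = (\<Sum>k\<le>N. \<Sum>j\<le>N. c k * (c j * (l - eigenvalue j))
          * averaged_form (poly (eigenpoly k)) (poly (eigenpoly j)))"
    unfolding shifted_jacobi_op_expansion[OF P] unfolding P by (rule averaged_form_sum_smult)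
  also have "\<dots> = (\<Sum>k\<le>N. \<Sum>j\<le>N.
      if k = j then (c k)\<^sup>2 * ((l - eigenvalue k) * norm2 k) else 0)"
    by (intro sum.cong refl) (auto simp: averaged_form_jacobi_orthogonal norm2_def power2_eq_square)
  also have "\<dots> = (\<Sum>k\<le>N. (c k)\<^sup>2 * ((l - eigenvalue k) * norm2 k))"
    by simp
  also have "\<dots> \<le> (\<Sum>k\<le>N. (c k)\<^sup>2 * (if k = 0 then l else 0))"
    unfolding l_def norm2_def by (intro sum_mono mult_left_mono averaged_form_jacobi_diagonal) auto
  also have "\<dots> = l * (jacobi_mean a b (poly P))\<^sup>2"
    by (simp add: jacobi_mean_expansion[OF ab P] if_distrib cong: if_cong)
  finally show ?thesis .
qed

lemma averaged_bounded_limit: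
  assumes "bounded_poly_limit P f" "z \<in> space M"
  shows "(\<lambda>k. averaged (poly (P k)) z) \<longlonglongrightarrow> averaged f z"
  using assms t_range unfolding averaged_def bounded_poly_limit_def
  by (intro tendsto_sum tendsto_mult_left) auto

lemma abs_averaged_le:
  assumes f: "\<And>u. u \<in> {0..1} \<Longrightarrow> \<bar>f u\<bar> \<le> C" and z: "z \<in> space M"
  shows "\<bar>averaged f z\<bar> \<le> C"
proof -
  have "\<bar>averaged f z\<bar> \<le> (\<Sum>i<n. \<bar>\<rho> i * f (t i z)\<bar>)"
    unfolding averaged_def by (rule sum_abs)
  also have "\<dots> \<le> (\<Sum>i<n. \<rho> i * C)"
    using f t_range[OF _ z] weights_nonneg by (intro sum_mono) (simp add: abs_mult mult_left_mono)
  also have "\<dots> = C" by (simp add: sum_weights flip: sum_distrib_right)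
  finally show ?thesis .
qed

lemma averaged_form_bounded_limit:
  assumes "bounded_poly_limit P f" "bounded_poly_limit Q g"
  shows "integrable M (\<lambda>z. averaged f z * averaged g z)"
    and "(\<lambda>k. averaged_form (poly (P k)) (poly (Q k))) \<longlonglongrightarrow> averaged_form f g"
proof -
  obtain C where C: "\<And>k u. u \<in> {0..1} \<Longrightarrow> \<bar>poly (P k) u\<bar> \<le> C"
    using assms(1) by (rule bounded_poly_limitE) (rule that)
  obtain D where D: "\<And>k u. u \<in> {0..1} \<Longrightarrow> \<bar>poly (Q k) u\<bar> \<le> D"
    using assms(2) by (rule bounded_poly_limitE) (rule that)
  have meas: "(\<lambda>z. averaged (poly R) z) \<in> borel_measurable M" for R
    unfolding averaged_def
    by (intro borel_measurable_sum borel_measurable_times measurable_poly_t) auto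
  have lim: "(\<lambda>k. averaged (poly (P k)) z * averaged (poly (Q k)) z) \<longlonglongrightarrow> averaged f z * averaged g z"
    if "z \<in> space M" for z
    by (intro tendsto_mult averaged_bounded_limit assms that)
  have bound: "AE z in M. norm (averaged (poly (P k)) z * averaged (poly (Q k)) z) \<le> C * D" for k
    using abs_averaged_le[OF C] abs_averaged_le[OF D]
    by (intro AE_I2) (simp add: abs_mult mult_mono')
  have lim_meas: "(\<lambda>z. averaged f z * averaged g z) \<in> borel_measurable M"
    by (rule borel_measurable_LIMSEQ_real[OF lim borel_measurable_times[OF meas meas]])
  note dom = lim_meas borel_measurable_times[OF meas meas] integrable_const AE_I2[OF lim] bound
  show "integrable M (\<lambda>z. averaged f z * averaged g z)"
    by (rule integrable_dominated_convergence[OF dom])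
  show "(\<lambda>k. averaged_form (poly (P k)) (poly (Q k))) \<longlonglongrightarrow> averaged_form f g"
    unfolding averaged_form_def by (rule integral_dominated_convergence[OF dom])
qed

lemma expectation_bounded_limit:
  assumes P: "bounded_poly_limit P f" and i: "i < n"
  shows "integrable M (\<lambda>z. f (t i z))" and "(\<integral>z. f (t i z) \<partial>M) = jacobi_mean a b f"
proof -
  obtain C where C: "\<And>k u. u \<in> {0..1} \<Longrightarrow> \<bar>poly (P k) u\<bar> \<le> C"
    and lim: "\<And>u. u \<in> {0..1} \<Longrightarrow> (\<lambda>k. poly (P k) u) \<longlonglongrightarrow> f u"
    using P by (rule bounded_poly_limitE) (rule that)
  have lim_t: "(\<lambda>k. poly (P k) (t i z)) \<longlonglongrightarrow> f (t i z)" if "z \<in> space M" for z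
    by (intro lim t_range i that)
  have bound: "AE z in M. norm (poly (P k) (t i z)) \<le> C" for k
    using C t_range[OF i] by (intro AE_I2) simp
  have lim_meas: "(\<lambda>z. f (t i z)) \<in> borel_measurable M"
    by (rule borel_measurable_LIMSEQ_real[OF lim_t measurable_poly_t[OF i]])
  note dom = lim_meas measurable_poly_t[OF i] integrable_const AE_I2[OF lim_t] bound
  show "integrable M (\<lambda>z. f (t i z))"
    by (rule integrable_dominated_convergence[OF dom])
  have "(\<lambda>k. \<integral>z. poly (P k) (t i z) \<partial>M) \<longlonglongrightarrow> (\<integral>z. f (t i z) \<partial>M)"
    by (rule integral_dominated_convergence[OF dom])
  then show "(\<integral>z. f (t i z) \<partial>M) = jacobi_mean a b f"
    unfolding expectation_poly_t[OF i]
    using jacobi_mean_bounded_limit[OF ab P] by (rule LIMSEQ_unique)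
qed

text \<open>Only the diagonal terms of the double sum are kept.\<close>

lemma averaged_form_ge_diagonal:
  assumes P: "bounded_poly_limit P f" and Q: "bounded_poly_limit Q g"
    and nonneg: "\<And>u. u \<in> {0..1} \<Longrightarrow> 0 \<le> f u" "\<And>u. u \<in> {0..1} \<Longrightarrow> 0 \<le> g u"
    and fg: "\<And>u. u \<in> {0..1} \<Longrightarrow> f u * g u = C * f u"
  shows "C * jacobi_mean a b f * (\<Sum>i<n. (\<rho> i)\<^sup>2) \<le> averaged_form f g"
proof -
  have "C * jacobi_mean a b f * (\<Sum>i<n. (\<rho> i)\<^sup>2) = (\<integral>z. (\<Sum>i<n. (\<rho> i)\<^sup>2 * (C * f (t i z))) \<partial>M)"
    using expectation_bounded_limit[OF P]
    by (simp add: Bochner_Integration.integral_sum sum_distrib_left mult_ac)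
  also have "\<dots> \<le> averaged_form f g"
    unfolding averaged_form_def
  proof (rule integral_mono)
    show "integrable M (\<lambda>z. \<Sum>i<n. (\<rho> i)\<^sup>2 * (C * f (t i z)))"
      by (intro Bochner_Integration.integrable_sum integrable_mult_right
          expectation_bounded_limit(1)[OF P]) simp
    fix z assume z: "z \<in> space M"
    have "(\<Sum>i<n. (\<rho> i)\<^sup>2 * (C * f (t i z))) = (\<Sum>i<n. (\<rho> i * f (t i z)) * (\<rho> i * g (t i z)))"
      by (intro sum.cong refl) (simp add: power2_eq_square mult_ac flip: fg[OF t_range[OF _ z]])
    also have "\<dots> \<le> (\<Sum>i<n. (\<rho> i * f (t i z)) * averaged g z)"
      unfolding averaged_def using nonneg t_range[OF _ z] weights_nonneg
      by (intro sum_mono mult_left_mono member_le_sum) auto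
    also have "\<dots> = averaged f z * averaged g z"
      by (simp add: averaged_def[of f] sum_distrib_right)
    finally show "(\<Sum>i<n. (\<rho> i)\<^sup>2 * (C * f (t i z))) \<le> averaged f z * averaged g z" .
  qed (rule averaged_form_bounded_limit(1)[OF P Q])
  finally show ?thesis .
qed

lemma jacobi_mean_shifted_limit:
  assumes P: "bounded_poly_limit P g"
    and Q: "bounded_poly_limit (\<lambda>k. jacobi_op a b (P k) + smult l (P k)) f"
  shows "l * jacobi_mean a b g = jacobi_mean a b f"
proof (rule LIMSEQ_unique)
  show "(\<lambda>k. l * jacobi_mean a b (poly (P k))) \<longlonglongrightarrow> l * jacobi_mean a b g"
    by (intro tendsto_mult_left jacobi_mean_bounded_limit ab P)
  have "jacobi_mean a b (poly (jacobi_op a b R + smult l R)) = l * jacobi_mean a b (poly R)" for R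
    unfolding jacobi_mean_add[OF ab] jacobi_mean_jacobi_op[OF ab] jacobi_mean_smult by simp
  then show "(\<lambda>k. l * jacobi_mean a b (poly (P k))) \<longlonglongrightarrow> jacobi_mean a b f"
    using jacobi_mean_bounded_limit[OF ab Q] by simp
qed

lemma averaged_form_shifted_limit_le:
  defines "l \<equiv> eigenvalue (Suc d)"
  assumes P: "bounded_poly_limit P g"
    and Q: "bounded_poly_limit (\<lambda>k. jacobi_op a b (P k) + smult l (P k)) f"
  shows "averaged_form g f \<le> l * (jacobi_mean a b g)\<^sup>2"
proof (rule LIMSEQ_le)
  show "(\<lambda>k. averaged_form (poly (P k)) (poly (jacobi_op a b (P k) + smult l (P k))))
      \<longlonglongrightarrow> averaged_form g f"
    by (rule averaged_form_bounded_limit(2)[OF P Q])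
  show "(\<lambda>k. l * (jacobi_mean a b (poly (P k)))\<^sup>2) \<longlonglongrightarrow> l * (jacobi_mean a b g)\<^sup>2"
    by (intro tendsto_intros jacobi_mean_bounded_limit ab P)
qed (use averaged_form_shifted_jacobi_op_le l_def in blast)

lemma sum_weights_squared_le_cap:
  assumes d: "d > 0"
  defines "\<tau> \<equiv> largest_jacobi_zero d (a + 1) (b + 1)"
  shows "(\<Sum>i<n. (\<rho> i)\<^sup>2) \<le> jacobi_mean a b (indicat_real {\<tau><..})"
proof -
  define cap where "cap = indicat_real {\<tau><..}"
  define l where "l = eigenvalue (Suc d)"
  have l: "l > 0" unfolding l_def using ab by (intro jacobi_eigenvalue_pos) auto
  have \<tau>: "0 < \<tau>" "\<tau> < 1"
    using largest_jacobi_zero(1,2)[of "a + 1" "b + 1" d] ab d unfolding \<tau>_def by auto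
  obtain Y where Y: "jacobi_op a b Y = smult (- l) Y" "poly (pderiv Y) \<tau> = 0"
    "\<And>u. \<tau> < u \<Longrightarrow> poly Y \<tau> < poly Y u" "poly Y \<tau> < 0"
    using jacobi_last_critical_point[OF ab d] unfolding \<tau>_def l_def by blast
  define C where "C = - (l * poly Y \<tau>)"
  have C: "C > 0" using l Y(4) by (simp add: C_def mult_pos_neg)
  define g where "g = (\<lambda>u. cap u * (poly Y u - poly Y \<tau>))"
  define A where "A = jacobi_mean a b g"
  obtain P where P: "bounded_poly_limit P g"
    and Q: "bounded_poly_limit (\<lambda>k. jacobi_op a b (P k) + smult l (P k)) (\<lambda>u. C * cap u)"
    using truncated_eigenpoly_approximation[OF less_imp_le[OF \<tau>(1)] Y(2,1)]
    unfolding g_def cap_def C_def by blast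
  have lA: "l * A = C * jacobi_mean a b cap"
    using jacobi_mean_shifted_limit[OF P Q] by (simp add: A_def jacobi_mean_def mult.assoc)
  have "0 < jacobi_mean a b cap"
    unfolding cap_def jacobi_mean_cap[OF ab(1) \<tau>]
    using ab incomplete_beta_pos[OF ab(1) \<tau>] by (simp add: Beta_pos)
  then have "0 < l * A" using C by (simp add: lA)
  then have A: "A > 0" using l by (rule zero_less_mult_pos)
  have "C * A * (\<Sum>i<n. (\<rho> i)\<^sup>2) \<le> averaged_form g (\<lambda>u. C * cap u)"
    unfolding A_def using C Y(3)
    by (intro averaged_form_ge_diagonal[OF P Q])
      (auto simp: g_def cap_def indicator_def less_imp_le)
  also have "\<dots> \<le> l * A\<^sup>2"
    using averaged_form_shifted_limit_le[OF P] Q unfolding A_def l_def by blast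
  also have "\<dots> = C * A * jacobi_mean a b cap"
    by (simp add: power2_eq_square lA)
  finally show ?thesis
    using A C by (simp add: cap_def)
qed

lemma one_le_card_mult_cap:
  assumes "d > 0"
  defines "\<tau> \<equiv> largest_jacobi_zero d (a + 1) (b + 1)"
  shows "1 \<le> real n * jacobi_mean a b (indicat_real {\<tau><..})"
proof -
  have "1 = (\<Sum>i<n. \<rho> i * 1)\<^sup>2" using sum_weights by simp
  also have "\<dots> \<le> (\<Sum>i<n. (\<rho> i)\<^sup>2) * (\<Sum>i<n. 1\<^sup>2)" by (rule Cauchy_Schwarz_ineq_sum)
  also have "\<dots> = real n * (\<Sum>i<n. (\<rho> i)\<^sup>2)" by simp
  finally show ?thesis
    using sum_weights_squared_le_cap[OF assms(1)] unfolding \<tau>_def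
    by (meson mult_left_mono of_nat_0_le_iff order.trans)
qed

end

section \<open>Polynomial functions of finitely many coordinates\<close>

inductive polyfun :: "'i set \<Rightarrow> (('i \<Rightarrow> real) \<Rightarrow> real) \<Rightarrow> bool" for I where
  polyfun_const: "polyfun I (\<lambda>z. c)"
| polyfun_proj: "k \<in> I \<Longrightarrow> polyfun I (\<lambda>z. z k)"
| polyfun_add: "polyfun I f \<Longrightarrow> polyfun I g \<Longrightarrow> polyfun I (\<lambda>z. f z + g z)"
| polyfun_mult: "polyfun I f \<Longrightarrow> polyfun I g \<Longrightarrow> polyfun I (\<lambda>z. f z * g z)"

lemma polyfun_diff: "polyfun I f \<Longrightarrow> polyfun I g \<Longrightarrow> polyfun I (\<lambda>z. f z - g z)"
  using polyfun_add[of I f "\<lambda>z. - 1 * g z"] polyfun_mult[OF polyfun_const, of I g "- 1"] by simp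

lemma polyfun_sum:
  "(\<And>i. i \<in> A \<Longrightarrow> polyfun I (f i)) \<Longrightarrow> polyfun I (\<lambda>z. \<Sum>i\<in>A. f i z)"
  by (induction A rule: infinite_finite_induct) (auto intro: polyfun.intros)

lemma polyfun_power: "polyfun I f \<Longrightarrow> polyfun I (\<lambda>z. f z ^ n)"
  by (induction n) (auto intro: polyfun.intros)

lemmas polyfun_intros = polyfun.intros polyfun_diff polyfun_sum polyfun_power

lemma polyfun_poly: "polyfun I f \<Longrightarrow> polyfun I (\<lambda>z. poly P (f z))"
  unfolding poly_altdef by (intro polyfun_intros)

abbreviation euclid :: "'i set \<Rightarrow> ('i \<Rightarrow> real) measure" where
  "euclid I \<equiv> PiM I (\<lambda>_. lborel)"

lemma polyfun_measurable: "polyfun I f \<Longrightarrow> f \<in> borel_measurable (euclid I)"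
proof (induction rule: polyfun.induct)
  case (polyfun_proj k)
  then show ?case
    using measurable_component_singleton[of k I "\<lambda>_. lborel :: real measure"] by simp
qed auto

definition envelope :: "'i set \<Rightarrow> nat \<Rightarrow> ('i \<Rightarrow> real) \<Rightarrow> real" where
  "envelope I n z = (\<Prod>k\<in>I. (1 + (z k)\<^sup>2) ^ n)"

lemma envelope_mono: "n \<le> l \<Longrightarrow> envelope I n z \<le> envelope I l z"
  unfolding envelope_def by (intro prod_mono conjI power_increasing zero_le_power) auto

lemma envelope_add: "envelope I (n + l) z = envelope I n z * envelope I l z"
  by (simp add: envelope_def power_add prod.distrib)

lemma abs_coord_le_envelope:
  assumes "finite I" "k \<in> I"
  shows "\<bar>z k\<bar> \<le> envelope I 1 z"
proof -
  have "\<bar>z k\<bar> \<le> 1 + (z k)\<^sup>2"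
    using zero_le_power2[of "\<bar>z k\<bar> - 1"] by (simp add: power2_eq_square algebra_simps)
  also have "\<dots> = (1 + (z k)\<^sup>2) * 1" by simp
  also have "\<dots> \<le> (1 + (z k)\<^sup>2) * (\<Prod>j\<in>I - {k}. 1 + (z j)\<^sup>2)"
    by (intro mult_left_mono prod_ge_1) auto
  also have "\<dots> = envelope I 1 z"
    using assms by (simp add: envelope_def prod.remove)
  finally show ?thesis .
qed

lemma polyfun_le_envelope:
  assumes "polyfun I f" "finite I"
  shows "\<exists>C n. 0 \<le> C \<and> (\<forall>z. \<bar>f z\<bar> \<le> C * envelope I n z)"
  using assms(1)
proof (induction rule: polyfun.induct)
  case (polyfun_const c)
  show ?case by (intro exI[of _ "\<bar>c\<bar>"] exI[of _ 0]) (simp add: envelope_def)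
next
  case (polyfun_proj k)
  then show ?case
    using abs_coord_le_envelope[OF assms(2)] by (intro exI[of _ 1]) auto
next
  case (polyfun_add f g)
  then obtain C n D l where f: "0 \<le> C" "\<And>z. \<bar>f z\<bar> \<le> C * envelope I n z"
    and g: "0 \<le> D" "\<And>z. \<bar>g z\<bar> \<le> D * envelope I l z" by blast
  have "\<bar>f z + g z\<bar> \<le> (C + D) * envelope I (max n l) z" for z
  proof -
    have "C * envelope I n z \<le> C * envelope I (max n l) z"
      "D * envelope I l z \<le> D * envelope I (max n l) z"
      using f(1) g(1) by (auto intro!: mult_left_mono envelope_mono)
    then show ?thesis
      using f(2)[of z] g(2)[of z] by (simp add: distrib_right)
  qed
  then show ?case using f(1) g(1) by (intro exI[of _ "C + D"]) auto
next
  case (polyfun_mult f g)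
  then obtain C n D l where f: "0 \<le> C" "\<And>z. \<bar>f z\<bar> \<le> C * envelope I n z"
    and g: "0 \<le> D" "\<And>z. \<bar>g z\<bar> \<le> D * envelope I l z" by blast
  have "\<bar>f z * g z\<bar> \<le> (C * D) * envelope I (n + l) z" for z
  proof -
    have "\<bar>f z * g z\<bar> \<le> (C * envelope I n z) * (D * envelope I l z)"
      unfolding abs_mult using f(2)[of z] g(2)[of z] by (intro mult_mono') auto
    then show ?thesis by (simp add: envelope_add mult_ac)
  qed
  then show ?case using f(1) g(1) by (intro exI[of _ "C * D"]) auto
qed

lemma polyfun_bounded_on_cube:
  assumes "polyfun I f" "finite I"
  obtains K where "\<And>z. (\<And>k. k \<in> I \<Longrightarrow> \<bar>z k\<bar> \<le> 1) \<Longrightarrow> \<bar>f z\<bar> \<le> K"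
proof -
  obtain C n where C: "0 \<le> C" "\<And>z. \<bar>f z\<bar> \<le> C * envelope I n z"
    using polyfun_le_envelope[OF assms] by blast
  show thesis
  proof (rule that[of "C * (\<Prod>k\<in>I. 2 ^ n)"])
    fix z :: "'a \<Rightarrow> real" assume z: "\<And>k. k \<in> I \<Longrightarrow> \<bar>z k\<bar> \<le> 1"
    have "envelope I n z \<le> (\<Prod>k\<in>I. 2 ^ n)"
      unfolding envelope_def using z
      by (intro prod_mono conjI power_mono) (auto simp: abs_square_le_1)
    then show "\<bar>f z\<bar> \<le> C * (\<Prod>k\<in>I. 2 ^ n)"
      using C(2)[of z] mult_left_mono[OF _ C(1)] order.trans by blast
  qed
qed

lemma polyfun_section:
  assumes "polyfun I f"
  shows "\<exists>p. \<forall>s. f (z(k := s)) = poly p s"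
  using assms
proof (induction rule: polyfun.induct)
  case (polyfun_const c)
  show ?case by (intro exI[of _ "[:c:]"]) simp
next
  case (polyfun_proj j)
  show ?case by (intro exI[of _ "if j = k then [:0, 1:] else [:z j:]"]) simp
next
  case (polyfun_add f g)
  then show ?case by (metis poly_add)
next
  case (polyfun_mult f g)
  then show ?case by (metis poly_mult)
qed

definition has_partial :: "'i \<Rightarrow> (('i \<Rightarrow> real) \<Rightarrow> real) \<Rightarrow> (('i \<Rightarrow> real) \<Rightarrow> real) \<Rightarrow> bool" where
  "has_partial k f f' \<longleftrightarrow> (\<forall>z s. ((\<lambda>s. f (z(k := s))) has_real_derivative f' (z(k := s))) (at s))"

lemma has_partial_const: "has_partial k (\<lambda>z. c) (\<lambda>z. 0)"
  by (simp add: has_partial_def)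

lemma has_partial_proj: "has_partial k (\<lambda>z. z j) (\<lambda>z. if j = k then 1 else 0)"
  by (auto simp: has_partial_def intro!: derivative_eq_intros)

lemma has_partial_mult:
  "has_partial k f f' \<Longrightarrow> has_partial k g g' \<Longrightarrow>
    has_partial k (\<lambda>z. f z * g z) (\<lambda>z. f' z * g z + f z * g' z)"
  by (auto simp: has_partial_def intro!: derivative_eq_intros)

lemma has_partial_sum:
  "(\<And>i. i \<in> A \<Longrightarrow> has_partial k (f i) (f' i)) \<Longrightarrow> has_partial k (\<lambda>z. \<Sum>i\<in>A. f i z) (\<lambda>z. \<Sum>i\<in>A. f' i z)"
  by (auto simp: has_partial_def intro!: derivative_intros)

lemma has_partial_power:
  "has_partial k f f' \<Longrightarrow> has_partial k (\<lambda>z. f z ^ n) (\<lambda>z. real n * f z ^ (n - 1) * f' z)"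
  by (auto simp: has_partial_def intro!: derivative_eq_intros)

lemma has_partial_cong: "has_partial k f f' \<Longrightarrow> (\<And>z. f' z = g' z) \<Longrightarrow> has_partial k f g'"
  by (metis ext)

section \<open>Gaussian integration by parts\<close>

lemma integrable_poly_std_normal:
  "integrable lborel (\<lambda>s. poly p s * std_normal_density s)"
proof -
  have "integrable lborel (\<lambda>s. \<Sum>i\<le>degree p. coeff p i * (std_normal_density s * s ^ i))"
    by (intro Bochner_Integration.integrable_sum integrable_mult_right integrable_std_normal_moment)
  then show ?thesis
    unfolding poly_altdef sum_distrib_right by (simp add: mult_ac)
qed

lemma std_normal_Stein_monomial:
  "(\<integral>s. s ^ (n + 1) * std_normal_density s \<partial>lborel)
    = real n * (\<integral>s. s ^ (n - 1) * std_normal_density s \<partial>lborel)"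
proof (cases "even n")
  case True
  then obtain k where k: "n = 2 * k" by auto
  have odd: "(\<integral>s. s ^ (2 * j + 1) * std_normal_density s \<partial>lborel) = 0" for j
    using integral_std_normal_moment_odd[of j] by (simp only: mult.commute)
  show ?thesis
    using odd[of k] odd[of "k - 1"] by (cases k) (simp_all add: k)
next
  case False
  then obtain k where k: "n = 2 * k + 1" by (auto elim: oddE)
  have even: "(\<integral>s. s ^ (2 * j) * std_normal_density s \<partial>lborel) = fact (2 * j) / (2 ^ j * fact j)"
    for j
    using integral_std_normal_moment_even[of j] by (simp add: mult.commute)
  have "fact (2 * (k + 1)) / (2 ^ (k + 1) * fact (k + 1))
      = real n * (fact (2 * k) / (2 ^ k * fact k))"
    by (simp add: k divide_simps)
  moreover have "n + 1 = 2 * (k + 1)" "n - 1 = 2 * k" using k by auto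
  ultimately show ?thesis by (simp only: even)
qed

lemma std_normal_Stein:
  "(\<integral>s. (poly (pderiv p) s - s * poly p s) * std_normal_density s \<partial>lborel) = 0"
proof -
  define T where "T p = (\<integral>s. poly (pderiv p - pCons 0 p) s * std_normal_density s \<partial>lborel)" for p
  have "T p = 0"
  proof (rule poly_additive_eq_0[of T])
    show "T (p + q) = T p + T q" for p q
    proof -
      have "pderiv (p + q) - pCons 0 (p + q) = (pderiv p - pCons 0 p) + (pderiv q - pCons 0 q)"
        by (simp add: pderiv_add)
      then show ?thesis
        unfolding T_def by (simp only: poly_add distrib_right integrable_poly_std_normal
            Bochner_Integration.integral_add)
    qed
    show "T (monom c i) = 0" for c i
    proof -
      have int: "integrable lborel (\<lambda>s. s ^ j * std_normal_density s)" for j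
        using integrable_poly_std_normal[of "monom 1 j"] by (simp add: poly_monom)
      have "T (monom c i)
        = (\<integral>s. c * (real i * (s ^ (i - 1) * std_normal_density s)
            - s ^ (i + 1) * std_normal_density s) \<partial>lborel)"
        by (simp add: T_def pderiv_monom poly_monom algebra_simps)
      then show ?thesis
        using std_normal_Stein_monomial[of i]
        by (simp add: int Bochner_Integration.integral_diff del: power_Suc)
    qed
  qed
  then show ?thesis by (simp add: T_def)
qed

definition gauss_density :: "'i set \<Rightarrow> ('i \<Rightarrow> real) \<Rightarrow> real" where
  "gauss_density I z = (\<Prod>k\<in>I. std_normal_density (z k))"

definition gauss_expect :: "'i set \<Rightarrow> (('i \<Rightarrow> real) \<Rightarrow> real) \<Rightarrow> real" where
  "gauss_expect I f = (\<integral>z. f z * gauss_density I z \<partial>euclid I)"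

lemma gauss_density_measurable [measurable]: "gauss_density I \<in> borel_measurable (euclid I)"
  unfolding gauss_density_def by measurable

lemma gauss_density_pos: "0 < gauss_density I z"
  unfolding gauss_density_def by (intro prod_pos ballI normal_density_pos) simp

lemma gauss_density_fun_upd:
  assumes "finite J" "k \<notin> J"
  shows "gauss_density (insert k J) (x(k := s)) = gauss_density J x * std_normal_density s"
proof -
  have "(\<Prod>j\<in>J. std_normal_density ((x(k := s)) j)) = (\<Prod>j\<in>J. std_normal_density (x j))"
    using assms by (intro prod.cong) auto
  then show ?thesis using assms by (simp add: gauss_density_def)
qed

lemma integrable_polyfun_gauss:
  assumes "polyfun I f" "finite I"
  shows "integrable (euclid I) (\<lambda>z. f z * gauss_density I z)"
proof -
  interpret product_sigma_finite "\<lambda>_. lborel :: real measure"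
    by standard
  obtain C n where C: "\<And>z. \<bar>f z\<bar> \<le> C * envelope I n z"
    using polyfun_le_envelope[OF assms] by blast
  have "integrable lborel (\<lambda>s::real. (1 + s\<^sup>2) ^ n * std_normal_density s)"
    using integrable_poly_std_normal[of "[:1, 0, 1:] ^ n"] by (simp add: power2_eq_square)
  then have "integrable (euclid I) (\<lambda>z. \<Prod>k\<in>I. (1 + (z k)\<^sup>2) ^ n * std_normal_density (z k))"
    using product_integrable_prod[OF assms(2), of "\<lambda>_ s. (1 + s\<^sup>2) ^ n * std_normal_density s"]
    by simp
  then have "integrable (euclid I) (\<lambda>z. C * (envelope I n z * gauss_density I z))"
    unfolding envelope_def gauss_density_def prod.distrib[symmetric] by (rule integrable_mult_right)
  then show ?thesis
  proof (rule Bochner_Integration.integrable_bound)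
    show "(\<lambda>z. f z * gauss_density I z) \<in> borel_measurable (euclid I)"
      using polyfun_measurable[OF assms(1)] by measurable
    have "norm (f z * gauss_density I z) \<le> norm (C * (envelope I n z * gauss_density I z))" for z
    proof -
      have "norm (f z * gauss_density I z) = \<bar>f z\<bar> * gauss_density I z"
        using gauss_density_pos[of I z] by (simp add: abs_mult)
      also have "\<dots> \<le> C * envelope I n z * gauss_density I z"
        by (intro mult_right_mono C less_imp_le[OF gauss_density_pos])
      finally show ?thesis by (simp add: mult.assoc)
    qed
    then show "AE z in euclid I. norm (f z * gauss_density I z)
        \<le> norm (C * (envelope I n z * gauss_density I z))" by simp
  qed
qed

lemma gauss_expect_add:
  assumes "polyfun I f" "polyfun I g" "finite I"
  shows "gauss_expect I (\<lambda>z. f z + g z) = gauss_expect I f + gauss_expect I g"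
  unfolding gauss_expect_def
  using integrable_polyfun_gauss[OF assms(1,3)] integrable_polyfun_gauss[OF assms(2,3)]
  by (simp add: distrib_right)

lemma gauss_expect_cmult: "gauss_expect I (\<lambda>z. c * f z) = c * gauss_expect I f"
  unfolding gauss_expect_def by (simp add: mult.assoc)

lemma gauss_expect_diff:
  assumes "polyfun I f" "polyfun I g" "finite I"
  shows "gauss_expect I (\<lambda>z. f z - g z) = gauss_expect I f - gauss_expect I g"
  unfolding gauss_expect_def
  using integrable_polyfun_gauss[OF assms(1,3)] integrable_polyfun_gauss[OF assms(2,3)]
  by (simp add: left_diff_distrib)

lemma gauss_expect_sum:
  assumes "\<And>i. i \<in> A \<Longrightarrow> polyfun I (f i)" "finite I"
  shows "gauss_expect I (\<lambda>z. \<Sum>i\<in>A. f i z) = (\<Sum>i\<in>A. gauss_expect I (f i))"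
  unfolding gauss_expect_def sum_distrib_right
  using assms by (intro Bochner_Integration.integral_sum integrable_polyfun_gauss)

lemma gauss_expect_1:
  assumes "finite I"
  shows "gauss_expect I (\<lambda>z. 1) = 1"
proof -
  interpret product_sigma_finite "\<lambda>_. lborel :: real measure"
    by standard
  have "(\<integral>z. (\<Prod>k\<in>I. std_normal_density (z k)) \<partial>euclid I)
      = (\<Prod>k\<in>I. integral\<^sup>L lborel std_normal_density)"
    by (rule product_integral_prod[OF assms]) simp
  then show ?thesis by (simp add: gauss_expect_def gauss_density_def)
qed

lemma gauss_Stein:
  assumes f: "polyfun I f" "polyfun I f'" and I: "finite I" "k \<in> I"
    and partial: "has_partial k f f'"
  shows "gauss_expect I (\<lambda>z. z k * f z) = gauss_expect I f'"
proof -
  interpret product_sigma_finite "\<lambda>_. lborel :: real measure"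
    by standard
  define F where "F z = (f' z - z k * f z) * gauss_density I z" for z
  define J where "J = I - {k}"
  have J: "finite J" "k \<notin> J" "I = insert k J" using I by (auto simp: J_def)
  have intF: "integrable (euclid (insert k J)) F"
    unfolding F_def J(3)[symmetric] using f I by (intro integrable_polyfun_gauss polyfun_intros)
  have line_integral: "(\<integral>s. F (x(k := s)) \<partial>lborel) = 0" for x
  proof -
    obtain p where p: "\<And>s. f (x(k := s)) = poly p s"
      using polyfun_section[OF f(1)] by blast
    have p': "f' (x(k := s)) = poly (pderiv p) s" for s
      using DERIV_unique[OF partial[unfolded has_partial_def, rule_format, of x s, unfolded p]
          poly_DERIV[of p s]] .
    have "F (x(k := s))
        = gauss_density J x * ((poly (pderiv p) s - s * poly p s) * std_normal_density s)" for s
      unfolding F_def p p' J(3) gauss_density_fun_upd[OF J(1,2)] by simp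
    then show ?thesis by (simp add: std_normal_Stein)
  qed
  have "gauss_expect I f' - gauss_expect I (\<lambda>z. z k * f z) = integral\<^sup>L (euclid (insert k J)) F"
    unfolding F_def J(3)[symmetric] gauss_expect_def[symmetric]
    using f I by (intro gauss_expect_diff[symmetric] polyfun_intros)
  also have "\<dots> = (\<integral>x. (\<integral>s. F (x(k := s)) \<partial>lborel) \<partial>euclid J)"
    by (rule product_integral_insert[OF J(1,2) intF])
  finally show ?thesis by (simp add: line_integral)
qed

lemma gauss_Green:
  assumes I: "finite I"
    and polyfuns: "polyfun I p" "\<And>k. polyfun I (p' k)" "\<And>k. polyfun I (q' k)"
      "\<And>k. polyfun I (q'' k)"
    and partials: "\<And>k. k \<in> I \<Longrightarrow> has_partial k p (p' k)" "\<And>k. k \<in> I \<Longrightarrow> has_partial k (q' k) (q'' k)"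
  shows "gauss_expect I (\<lambda>z. \<Sum>k\<in>I. p' k z * q' k z)
    = gauss_expect I (\<lambda>z. p z * (\<Sum>k\<in>I. z k * q' k z - q'' k z))"
proof -
  have "gauss_expect I (\<lambda>z. z k * (p z * q' k z))
      = gauss_expect I (\<lambda>z. p' k z * q' k z + p z * q'' k z)"
    if k: "k \<in> I" for k
    using polyfuns partials[OF k] I k by (intro gauss_Stein has_partial_mult polyfun_intros)
  then have by_parts: "gauss_expect I (\<lambda>z. p' k z * q' k z)
      = gauss_expect I (\<lambda>z. z k * (p z * q' k z) - p z * q'' k z)" if "k \<in> I" for k
    using that polyfuns I by (simp add: gauss_expect_add gauss_expect_diff polyfun_intros)
  have "gauss_expect I (\<lambda>z. \<Sum>k\<in>I. p' k z * q' k z) = (\<Sum>k\<in>I. gauss_expect I (\<lambda>z. p' k z * q' k z))"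
    by (intro gauss_expect_sum polyfun_intros polyfuns I)
  also have "\<dots> = (\<Sum>k\<in>I. gauss_expect I (\<lambda>z. z k * (p z * q' k z) - p z * q'' k z))"
    by (intro sum.cong refl by_parts)
  also have "\<dots> = gauss_expect I (\<lambda>z. \<Sum>k\<in>I. z k * (p z * q' k z) - p z * q'' k z)"
    by (intro gauss_expect_sum[symmetric] polyfun_intros polyfuns I)
  also have "\<dots> = gauss_expect I (\<lambda>z. p z * (\<Sum>k\<in>I. z k * q' k z - q'' k z))"
    by (simp add: sum_distrib_left right_diff_distrib mult.left_commute)
  finally show ?thesis .
qed

section \<open>Squared lengths of projections\<close>

definition inner_on :: "'i set \<Rightarrow> ('i \<Rightarrow> real) \<Rightarrow> ('i \<Rightarrow> real) \<Rightarrow> real" where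
  "inner_on I x z = (\<Sum>k\<in>I. x k * z k)"

definition sqn :: "'i set \<Rightarrow> ('i \<Rightarrow> real) \<Rightarrow> real" where
  "sqn I z = (\<Sum>k\<in>I. (z k)\<^sup>2)"

definition orthonormal_family :: "'i set \<Rightarrow> 'j set \<Rightarrow> ('j \<Rightarrow> 'i \<Rightarrow> real) \<Rightarrow> bool" where
  "orthonormal_family I J a \<longleftrightarrow> (\<forall>i\<in>J. \<forall>j\<in>J. inner_on I (a i) (a j) = (if i = j then 1 else 0))"

text \<open>For an orthonormal family this is the squared length of the projection of \<open>z\<close> to its span.\<close>

definition sqproj :: "'i set \<Rightarrow> 'j set \<Rightarrow> ('j \<Rightarrow> 'i \<Rightarrow> real) \<Rightarrow> ('i \<Rightarrow> real) \<Rightarrow> real" where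
  "sqproj I J a z = (\<Sum>j\<in>J. (inner_on I (a j) z)\<^sup>2)"

definition sqproj_grad :: "'i set \<Rightarrow> 'j set \<Rightarrow> ('j \<Rightarrow> 'i \<Rightarrow> real) \<Rightarrow> 'i \<Rightarrow> ('i \<Rightarrow> real) \<Rightarrow> real" where
  "sqproj_grad I J a k z = (\<Sum>j\<in>J. 2 * a j k * inner_on I (a j) z)"

definition unit_vec :: "'i \<Rightarrow> 'i \<Rightarrow> real" where
  "unit_vec j k = (if k = j then 1 else 0)"

lemma inner_on_unit_vec: "finite I \<Longrightarrow> j \<in> I \<Longrightarrow> inner_on I (unit_vec j) z = z j"
  by (simp add: inner_on_def unit_vec_def if_distrib[of "\<lambda>x. x * _"] cong: if_cong)

lemma orthonormal_family_unit_vec: "finite I \<Longrightarrow> orthonormal_family I I unit_vec"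
  unfolding orthonormal_family_def by (auto simp: inner_on_unit_vec) (auto simp: unit_vec_def)

lemma sqn_eq_sqproj: "finite I \<Longrightarrow> sqn I = sqproj I I unit_vec"
  by (auto simp: fun_eq_iff sqn_def sqproj_def inner_on_unit_vec intro: sum.cong)

lemma sqproj_nonneg: "0 \<le> sqproj I J a z"
  by (simp add: sqproj_def sum_nonneg)

lemma inner_on_scale: "inner_on I a (\<lambda>k\<in>I. c * z k) = c * inner_on I a z"
  by (simp add: inner_on_def sum_distrib_left mult_ac cong: sum.cong)

lemma sqproj_scale: "sqproj I J a (\<lambda>k\<in>I. c * z k) = c\<^sup>2 * sqproj I J a z"
  by (simp add: sqproj_def inner_on_scale power_mult_distrib sum_distrib_left)

lemma polyfun_inner_on: "polyfun I (inner_on I a)"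
  unfolding inner_on_def by (intro polyfun_intros)

lemma polyfun_sqproj: "polyfun I (sqproj I J a)"
  unfolding sqproj_def by (intro polyfun_intros polyfun_inner_on)

lemma polyfun_sqproj_grad: "polyfun I (sqproj_grad I J a k)"
  unfolding sqproj_grad_def by (intro polyfun_intros polyfun_inner_on)

lemma has_partial_inner_on:
  assumes "finite I" "k \<in> I"
  shows "has_partial k (inner_on I a) (\<lambda>z. a k)"
  unfolding inner_on_def
proof (rule has_partial_cong)
  show "has_partial k (\<lambda>z. \<Sum>j\<in>I. a j * z j) (\<lambda>z. \<Sum>j\<in>I. 0 * z j + a j * (if j = k then 1 else 0))"
    by (intro has_partial_sum has_partial_mult has_partial_const has_partial_proj)
  show "(\<Sum>j\<in>I. 0 * z j + a j * (if j = k then 1 else 0)) = a k" for z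
    using assms by (simp add: if_distrib cong: if_cong)
qed

lemma has_partial_sqproj:
  assumes "finite I" "k \<in> I"
  shows "has_partial k (sqproj I J a) (sqproj_grad I J a k)"
  unfolding sqproj_def sqproj_grad_def
proof (rule has_partial_cong)
  show "has_partial k (\<lambda>z. \<Sum>j\<in>J. (inner_on I (a j) z)\<^sup>2)
     (\<lambda>z. \<Sum>j\<in>J. real 2 * inner_on I (a j) z ^ (2 - 1) * a j k)"
    by (intro has_partial_sum has_partial_power has_partial_inner_on assms)
qed (simp add: mult_ac)

lemma has_partial_sqproj_grad:
  assumes "finite I" "k \<in> I"
  shows "has_partial k (sqproj_grad I J a k) (\<lambda>z. 2 * (\<Sum>j\<in>J. (a j k)\<^sup>2))"
  unfolding sqproj_grad_def
proof (rule has_partial_cong)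
  show "has_partial k (\<lambda>z. \<Sum>j\<in>J. 2 * a j k * inner_on I (a j) z)
     (\<lambda>z. \<Sum>j\<in>J. 0 * inner_on I (a j) z + 2 * a j k * a j k)"
    by (intro has_partial_sum has_partial_mult has_partial_const has_partial_inner_on assms)
qed (simp add: power2_eq_square mult.assoc sum_distrib_left)

lemma sum_coord_mult_sqproj_grad: "(\<Sum>k\<in>I. z k * sqproj_grad I J a k z) = 2 * sqproj I J a z"
proof -
  have "(\<Sum>k\<in>I. z k * sqproj_grad I J a k z) = (\<Sum>j\<in>J. \<Sum>k\<in>I. z k * (2 * a j k * inner_on I (a j) z))"
    unfolding sqproj_grad_def sum_distrib_left by (rule sum.swap)
  also have "\<dots> = (\<Sum>j\<in>J. 2 * inner_on I (a j) z * (\<Sum>k\<in>I. a j k * z k))"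
    unfolding sum_distrib_left by (intro sum.cong refl) simp
  also have "\<dots> = 2 * sqproj I J a z"
    by (simp add: sqproj_def inner_on_def[of I "a _", symmetric] power2_eq_square
        sum_distrib_left mult.assoc)
  finally show ?thesis .
qed

lemma sum_sqproj_grad_squared:
  assumes J: "finite J" and a: "orthonormal_family I J a"
  shows "(\<Sum>k\<in>I. (sqproj_grad I J a k z)\<^sup>2) = 4 * sqproj I J a z"
proof -
  have "(\<Sum>k\<in>I. (sqproj_grad I J a k z)\<^sup>2)
      = (\<Sum>k\<in>I. \<Sum>i\<in>J. \<Sum>j\<in>J. 2 * a i k * inner_on I (a i) z * (2 * a j k * inner_on I (a j) z))"
    unfolding sqproj_grad_def power2_eq_square sum_product ..
  also have "\<dots> = (\<Sum>i\<in>J. \<Sum>j\<in>J. \<Sum>k\<in>I.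
      2 * a i k * inner_on I (a i) z * (2 * a j k * inner_on I (a j) z))"
    by (subst sum.swap, intro sum.cong refl, rule sum.swap)
  also have "\<dots> = (\<Sum>i\<in>J. \<Sum>j\<in>J. 4 * inner_on I (a i) z * inner_on I (a j) z * inner_on I (a i) (a j))"
    by (intro sum.cong refl) (simp add: inner_on_def[of I "a _" "a _"] sum_distrib_left mult_ac)
  also have "\<dots> = (\<Sum>i\<in>J. \<Sum>j\<in>J. if i = j then 4 * inner_on I (a i) z * inner_on I (a j) z else 0)"
    using a by (intro sum.cong refl) (auto simp: orthonormal_family_def)
  also have "\<dots> = 4 * sqproj I J a z"
    using J by (simp add: sqproj_def sum_distrib_left power2_eq_square mult.assoc)
  finally show ?thesis .
qed

lemma sqproj_le_sqn:
  assumes "finite J" "orthonormal_family I J a"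
  shows "sqproj I J a z \<le> sqn I z"
proof -
  have "0 \<le> (\<Sum>k\<in>I. (z k - sqproj_grad I J a k z / 2)\<^sup>2)" by (simp add: sum_nonneg)
  also have "\<dots> = sqn I z - (\<Sum>k\<in>I. z k * sqproj_grad I J a k z)
      + (\<Sum>k\<in>I. (sqproj_grad I J a k z)\<^sup>2) / 4"
    by (simp add: sqn_def power2_diff power_divide sum.distrib sum_subtractf sum_divide_distrib)
  also have "\<dots> = sqn I z - sqproj I J a z"
    by (simp add: sum_coord_mult_sqproj_grad sum_sqproj_grad_squared[OF assms])
  finally show ?thesis by simp
qed

lemma sum_coord_squares_orthonormal:
  assumes "orthonormal_family I J a"
  shows "(\<Sum>k\<in>I. \<Sum>j\<in>J. (a j k)\<^sup>2) = real (card J)"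
proof -
  have "(\<Sum>k\<in>I. \<Sum>j\<in>J. (a j k)\<^sup>2) = (\<Sum>j\<in>J. inner_on I (a j) (a j))"
    by (subst sum.swap) (simp add: inner_on_def power2_eq_square)
  then show ?thesis using assms by (simp add: orthonormal_family_def)
qed

definition sqproj_power_grad ::
  "'i set \<Rightarrow> 'j set \<Rightarrow> ('j \<Rightarrow> 'i \<Rightarrow> real) \<Rightarrow> nat \<Rightarrow> 'i \<Rightarrow> ('i \<Rightarrow> real) \<Rightarrow> real" where
  "sqproj_power_grad I J a n k z = real n * sqproj I J a z ^ (n - 1) * sqproj_grad I J a k z"

definition sqproj_power_hess ::
  "'i set \<Rightarrow> 'j set \<Rightarrow> ('j \<Rightarrow> 'i \<Rightarrow> real) \<Rightarrow> nat \<Rightarrow> 'i \<Rightarrow> ('i \<Rightarrow> real) \<Rightarrow> real" where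
  "sqproj_power_hess I J a n k z
    = real n * real (n - 1) * sqproj I J a z ^ (n - 1 - 1) * (sqproj_grad I J a k z)\<^sup>2
      + 2 * real n * sqproj I J a z ^ (n - 1) * (\<Sum>j\<in>J. (a j k)\<^sup>2)"

lemma has_partial_sqproj_power:
  assumes "finite I" "k \<in> I"
  shows "has_partial k (\<lambda>z. sqproj I J a z ^ n) (sqproj_power_grad I J a n k)"
  unfolding sqproj_power_grad_def by (intro has_partial_power has_partial_sqproj assms)

lemma has_partial_sqproj_power_grad:
  assumes "finite I" "k \<in> I"
  shows "has_partial k (sqproj_power_grad I J a n k) (sqproj_power_hess I J a n k)"
proof (rule has_partial_cong)
  show "has_partial k (sqproj_power_grad I J a n k)
    (\<lambda>z. (0 * sqproj I J a z ^ (n - 1)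
        + real n * (real (n - 1) * sqproj I J a z ^ (n - 1 - 1) * sqproj_grad I J a k z))
          * sqproj_grad I J a k z
      + real n * sqproj I J a z ^ (n - 1) * (2 * (\<Sum>j\<in>J. (a j k)\<^sup>2)))"
    unfolding sqproj_power_grad_def
    by (intro has_partial_mult has_partial_power has_partial_const has_partial_sqproj
        has_partial_sqproj_grad assms)
qed (simp add: sqproj_power_hess_def power2_eq_square mult_ac)

lemma ornstein_uhlenbeck_sqproj_power:
  assumes "finite J" "orthonormal_family I J a"
  shows "(\<Sum>k\<in>I. z k * sqproj_power_grad I J a n k z - sqproj_power_hess I J a n k z)
    = 2 * real n * sqproj I J a z ^ n
      - 2 * real n * (2 * real n + real (card J) - 2) * sqproj I J a z ^ (n - 1)"
proof -
  define s where "s = sqproj I J a z"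
  have "(\<Sum>k\<in>I. z k * sqproj_power_grad I J a n k z) = real n * s ^ (n - 1) * (2 * s)"
    by (simp add: sqproj_power_grad_def s_def sum_distrib_left mult_ac
        flip: sum_coord_mult_sqproj_grad)
  moreover have "(\<Sum>k\<in>I. sqproj_power_hess I J a n k z)
      = real n * real (n - 1) * s ^ (n - 1 - 1) * (4 * s)
        + 2 * real n * s ^ (n - 1) * real (card J)"
    unfolding sqproj_power_hess_def s_def sum.distrib sum_sqproj_grad_squared[OF assms, symmetric]
      sum_coord_squares_orthonormal[OF assms(2), symmetric] by (simp only: sum_distrib_left)
  ultimately show ?thesis
    unfolding s_def[symmetric] sum_subtractf
    by (cases n; cases "n - 1") (simp_all add: algebra_simps)
qed

lemma gauss_expect_sqproj_gradients:
  assumes I: "finite I" and J: "finite J" and b: "orthonormal_family I J b"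
  shows "gauss_expect I (\<lambda>z. \<Sum>k\<in>I. sqproj_power_grad I J' a i k z * sqproj_power_grad I J b j k z)
    = 2 * real j * gauss_expect I (\<lambda>z. sqproj I J' a z ^ i * sqproj I J b z ^ j)
      - 2 * real j * (2 * real j + real (card J) - 2)
        * gauss_expect I (\<lambda>z. sqproj I J' a z ^ i * sqproj I J b z ^ (j - 1))"
proof -
  have poly: "polyfun I (\<lambda>z. sqproj I J' a z ^ i * sqproj I J b z ^ j)" for j
    by (intro polyfun_intros polyfun_sqproj)
  have "gauss_expect I (\<lambda>z. \<Sum>k\<in>I. sqproj_power_grad I J' a i k z * sqproj_power_grad I J b j k z)
    = gauss_expect I (\<lambda>z. sqproj I J' a z ^ i *
        (\<Sum>k\<in>I. z k * sqproj_power_grad I J b j k z - sqproj_power_hess I J b j k z))"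
    by (intro gauss_Green I has_partial_sqproj_power has_partial_sqproj_power_grad)
      (auto simp: sqproj_power_grad_def[abs_def] sqproj_power_hess_def[abs_def]
        intro!: polyfun_intros polyfun_sqproj polyfun_sqproj_grad)
  also have "\<dots> = gauss_expect I (\<lambda>z. 2 * real j * (sqproj I J' a z ^ i * sqproj I J b z ^ j)
      - 2 * real j * (2 * real j + real (card J) - 2)
        * (sqproj I J' a z ^ i * sqproj I J b z ^ (j - 1)))"
    unfolding ornstein_uhlenbeck_sqproj_power[OF J b] by (simp add: right_diff_distrib mult_ac)
  finally show ?thesis
    using poly[of j] poly[of "j - 1"] I
    by (simp add: gauss_expect_diff gauss_expect_cmult polyfun_intros)
qed

lemma gauss_expect_sqproj_recurrence:
  assumes I: "finite I" and J: "finite J" "finite J'" "card J = d" "card J' = d"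
    and ab: "orthonormal_family I J' a" "orthonormal_family I J b"
  defines "E \<equiv> \<lambda>i j. gauss_expect I (\<lambda>z. sqproj I J' a z ^ i * sqproj I J b z ^ j)"
  shows "real j * (2 * real j + real d - 2) * E i (j - 1)
      - real i * (2 * real i + real d - 2) * E (i - 1) j
    = (real j - real i) * E i j"
proof -
  have "2 * real i * E i j - 2 * real i * (2 * real i + real d - 2) * E (i - 1) j
      = 2 * real j * E i j - 2 * real j * (2 * real j + real d - 2) * E i (j - 1)"
    using gauss_expect_sqproj_gradients[OF I J(1) ab(2), of J' a i j]
      gauss_expect_sqproj_gradients[OF I J(2) ab(1), of J b j i] J(3,4)
    by (simp add: E_def mult.commute)
  then show ?thesis by (simp add: algebra_simps)
qed

lemma gauss_expect_sqn_power_Suc: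
  assumes I: "finite I"
  shows "gauss_expect I (\<lambda>z. sqn I z ^ Suc n)
    = (real (card I) + 2 * real n) * gauss_expect I (\<lambda>z. sqn I z ^ n)"
proof -
  have "gauss_expect I (\<lambda>z. \<Sum>k\<in>I.
      sqproj_power_grad I I unit_vec 0 k z * sqproj_power_grad I I unit_vec (Suc n) k z) = 0"
    by (simp add: sqproj_power_grad_def gauss_expect_def)
  then have "2 * real (Suc n) * (gauss_expect I (\<lambda>z. sqn I z ^ Suc n)
      - (real (card I) + 2 * real n) * gauss_expect I (\<lambda>z. sqn I z ^ n)) = 0"
    unfolding gauss_expect_sqproj_gradients[OF I I orthonormal_family_unit_vec[OF I]]
    by (simp add: sqn_eq_sqproj[OF I] algebra_simps)
  then show ?thesis by simp
qed

lemma gauss_expect_sqn_power_pos: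
  assumes "finite I" "I \<noteq> {}"
  shows "0 < gauss_expect I (\<lambda>z. sqn I z ^ n)"
proof (induction n)
  case 0
  then show ?case using gauss_expect_1[OF assms(1)] by simp
next
  case (Suc n)
  have "card I > 0" using assms by (simp add: card_gt_0_iff)
  then show ?case
    unfolding gauss_expect_sqn_power_Suc[OF assms(1)] using Suc by (intro mult_pos_pos) simp_all
qed

section \<open>Radial integration\<close>

lemma nn_integral_euclid_scale:
  assumes "finite I" "c > 0" "f \<in> borel_measurable (euclid I)"
  shows "(\<integral>\<^sup>+z. f z \<partial>euclid I) = ennreal c ^ card I * (\<integral>\<^sup>+z. f (\<lambda>k\<in>I. c * z k) \<partial>euclid I)"
  using assms(1,3)
proof (induction I arbitrary: f)
  case empty
  interpret product_sigma_finite "\<lambda>_. lborel :: real measure"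
    by standard
  show ?case by (simp add: nn_integral_empty restrict_def del: nn_integral_const)
next
  case (insert i I)
  interpret product_sigma_finite "\<lambda>_. lborel :: real measure"
    by standard
  have f[measurable]: "f \<in> borel_measurable (euclid (insert i I))" by (rule insert.prems)
  have scaled: "(\<lambda>k\<in>insert i I. c * (x(i := y)) k) = (\<lambda>k\<in>I. c * x k)(i := c * y)"
    for x :: "'a \<Rightarrow> real" and y
    using insert.hyps by (auto simp: fun_eq_iff)
  have "(\<integral>\<^sup>+z. f z \<partial>euclid (insert i I)) = (\<integral>\<^sup>+x. (\<integral>\<^sup>+y. f (x(i := y)) \<partial>lborel) \<partial>euclid I)"
    by (rule product_nn_integral_insert[OF insert.hyps f])
  also have "\<dots> = (\<integral>\<^sup>+x. ennreal c * (\<integral>\<^sup>+y. f (x(i := c * y)) \<partial>lborel) \<partial>euclid I)"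
  proof (rule nn_integral_cong)
    fix x assume [measurable]: "x \<in> space (euclid I)"
    show "(\<integral>\<^sup>+y. f (x(i := y)) \<partial>lborel) = ennreal c * (\<integral>\<^sup>+y. f (x(i := c * y)) \<partial>lborel)"
      using assms(2) by (subst nn_integral_real_affine[of _ c 0]) auto
  qed
  also have "\<dots> = ennreal c * (\<integral>\<^sup>+x. (\<integral>\<^sup>+y. f (x(i := c * y)) \<partial>lborel) \<partial>euclid I)"
    by (rule nn_integral_cmult) measurable
  also have "(\<integral>\<^sup>+x. (\<integral>\<^sup>+y. f (x(i := c * y)) \<partial>lborel) \<partial>euclid I)
      = ennreal c ^ card I * (\<integral>\<^sup>+x. (\<integral>\<^sup>+y. f ((\<lambda>k\<in>I. c * x k)(i := c * y)) \<partial>lborel) \<partial>euclid I)"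
    by (rule insert.IH) measurable
  also have "(\<integral>\<^sup>+x. (\<integral>\<^sup>+y. f ((\<lambda>k\<in>I. c * x k)(i := c * y)) \<partial>lborel) \<partial>euclid I)
      = (\<integral>\<^sup>+z. f (\<lambda>k\<in>insert i I. c * z k) \<partial>euclid (insert i I))"
    unfolding scaled[symmetric]
    by (rule product_nn_integral_insert[OF insert.hyps, symmetric]) measurable
  finally show ?case
    by (simp only: card_insert_disjoint[OF insert.hyps] power_Suc mult.assoc)
qed

lemma sqn_nonneg: "0 \<le> sqn I z"
  by (simp add: sqn_def sum_nonneg)

lemma sqn_measurable [measurable]: "sqn I \<in> borel_measurable (euclid I)"
  unfolding sqn_def by measurable

lemma sqn_scale: "sqn I (\<lambda>k\<in>I. c * z k) = c\<^sup>2 * sqn I z"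
  by (simp add: sqn_def power_mult_distrib sum_distrib_left)

lemma coord_square_le_sqn: "finite I \<Longrightarrow> k \<in> I \<Longrightarrow> (z k)\<^sup>2 \<le> sqn I z"
  unfolding sqn_def by (rule member_le_sum) auto

lemma emeasure_euclid_PiE:
  assumes "finite I" "A \<in> sets borel"
  shows "emeasure (euclid I) (\<Pi>\<^sub>E k\<in>I. A) = emeasure lborel A ^ card I"
proof -
  interpret product_sigma_finite "\<lambda>_. lborel :: real measure"
    by standard
  show ?thesis using assms by (subst emeasure_PiM) auto
qed

lemma AE_sqn_pos:
  assumes "finite I" "I \<noteq> {}"
  shows "AE z in euclid I. 0 < sqn I z"
proof (rule AE_I)
  show "{z \<in> space (euclid I). \<not> 0 < sqn I z} \<subseteq> (\<Pi>\<^sub>E k\<in>I. {0})"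
  proof
    fix z assume "z \<in> {z \<in> space (euclid I). \<not> 0 < sqn I z}"
    then have "z \<in> extensional I" "sqn I z = 0"
      using sqn_nonneg[of I z] by (auto simp: space_PiM PiE_def)
    then show "z \<in> (\<Pi>\<^sub>E k\<in>I. {0})"
      using coord_square_le_sqn[OF assms(1), of _ z] by (intro PiE_I) (auto simp: extensional_def)
  qed
  show "emeasure (euclid I) (\<Pi>\<^sub>E k\<in>I. {0}) = 0"
    using assms by (subst emeasure_euclid_PiE) (simp_all add: card_gt_0_iff)
  show "(\<Pi>\<^sub>E k\<in>I. {0}) \<in> sets (euclid I)"
    using assms(1) by (intro sets_PiM_I_finite) auto
qed

lemma emeasure_ball_finite:
  assumes "finite I"
  shows "emeasure (euclid I) {z \<in> space (euclid I). sqn I z \<le> 1} < \<infinity>"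
proof -
  have "{z \<in> space (euclid I). sqn I z \<le> 1} \<subseteq> (\<Pi>\<^sub>E k\<in>I. {-1..1})"
  proof
    fix z assume z: "z \<in> {z \<in> space (euclid I). sqn I z \<le> 1}"
    then have "\<bar>z k\<bar> \<le> 1" if "k \<in> I" for k
      using coord_square_le_sqn[OF assms that, of z] by (simp flip: abs_square_le_1)
    then show "z \<in> (\<Pi>\<^sub>E k\<in>I. {-1..1})"
      using z by (auto simp: space_PiM PiE_def Pi_def abs_le_iff minus_le_iff)
  qed
  then have "emeasure (euclid I) {z \<in> space (euclid I). sqn I z \<le> 1}
      \<le> emeasure (euclid I) (\<Pi>\<^sub>E k\<in>I. {-1..1})"
    by (rule emeasure_mono) (auto intro!: sets_PiM_I_finite assms)
  also have "\<dots> < \<infinity>" using assms by (simp add: emeasure_euclid_PiE power_less_top_ennreal)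
  finally show ?thesis .
qed

lemma emeasure_ball_pos:
  assumes I: "finite I" "I \<noteq> {}"
  shows "0 < emeasure (euclid I) {z \<in> space (euclid I). sqn I z < 1}"
proof -
  define c where "c = 1 / real (card I)"
  have cI: "card I > 0" using I by (simp add: card_gt_0_iff)
  then have c: "c > 0" "c \<le> 1" by (simp_all add: c_def field_simps Suc_le_eq)
  have sub: "(\<Pi>\<^sub>E k\<in>I. {0<..<c}) \<subseteq> {z \<in> space (euclid I). sqn I z < 1}"
  proof
    fix z assume z: "z \<in> (\<Pi>\<^sub>E k\<in>I. {0<..<c})"
    have "sqn I z < (\<Sum>k\<in>I. c)"
      unfolding sqn_def
    proof (rule sum_strict_mono[OF I])
      fix k assume "k \<in> I"
      then have "0 < z k" "z k < c" using z by (auto simp: PiE_def Pi_def)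
      then have "z k * z k < c * 1"
        using c by (intro mult_strict_mono) auto
      then show "(z k)\<^sup>2 < c" by (simp add: power2_eq_square)
    qed
    then show "z \<in> {z \<in> space (euclid I). sqn I z < 1}"
      using z cI by (auto simp: space_PiM PiE_def c_def)
  qed
  have "0 < emeasure (euclid I) (\<Pi>\<^sub>E k\<in>I. {0<..<c})"
    using c I by (simp add: emeasure_euclid_PiE ennreal_power)
  also have "\<dots> \<le> emeasure (euclid I) {z \<in> space (euclid I). sqn I z < 1}"
    by (rule emeasure_mono[OF sub]) measurable
  finally show ?thesis .
qed

lemma gauss_density_radial:
  assumes "finite I"
  shows "gauss_density I z = (1 / sqrt (2 * pi)) ^ card I * exp (- sqn I z / 2)"
proof -
  have "gauss_density I z = (\<Prod>k\<in>I. 1 / sqrt (2 * pi)) * (\<Prod>k\<in>I. exp (- (z k)\<^sup>2 / 2))"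
    unfolding gauss_density_def std_normal_density_def prod.distrib ..
  also have "(\<Prod>k\<in>I. exp (- (z k)\<^sup>2 / 2)) = exp (- sqn I z / 2)"
    using assms by (simp add: exp_sum[symmetric] sqn_def sum_negf sum_divide_distrib)
  finally show ?thesis by simp
qed

definition ray_constant :: "'i set \<Rightarrow> (('i \<Rightarrow> real) \<Rightarrow> 'b) \<Rightarrow> bool" where
  "ray_constant I g \<longleftrightarrow> (\<forall>c>0. \<forall>z. g (\<lambda>k\<in>I. c * z k) = g z)"

lemma ray_constant_compose: "ray_constant I g \<Longrightarrow> ray_constant I (\<lambda>z. f (g z))"
  by (simp add: ray_constant_def)

lemma nn_integral_ball_ray_constant:
  assumes I: "finite I" and [measurable]: "g \<in> borel_measurable (euclid I)"
    and g: "ray_constant I g" and s: "s > 0"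
  shows "(\<integral>\<^sup>+z. g z * indicator {..<s} (sqn I z) \<partial>euclid I)
    = ennreal (sqrt s) ^ card I * (\<integral>\<^sup>+z. g z * indicator {..<1} (sqn I z) \<partial>euclid I)"
proof -
  have "(\<integral>\<^sup>+z. g z * indicator {..<s} (sqn I z) \<partial>euclid I) = ennreal (sqrt s) ^ card I *
     (\<integral>\<^sup>+z. g (\<lambda>k\<in>I. sqrt s * z k) * indicator {..<s} (sqn I (\<lambda>k\<in>I. sqrt s * z k)) \<partial>euclid I)"
    using s by (intro nn_integral_euclid_scale[OF I]) auto
  also have "(\<integral>\<^sup>+z. g (\<lambda>k\<in>I. sqrt s * z k)
      * indicator {..<s} (sqn I (\<lambda>k\<in>I. sqrt s * z k)) \<partial>euclid I)
     = (\<integral>\<^sup>+z. g z * indicator {..<1} (sqn I z) \<partial>euclid I)"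
    using s g
    by (intro nn_integral_cong) (auto simp: ray_constant_def sqn_scale split: split_indicator)
  finally show ?thesis .
qed

lemma emeasure_distr_sqn:
  assumes [measurable]: "g \<in> borel_measurable (euclid I)"
  shows "emeasure (distr (density (euclid I) g) borel (\<lambda>z. - sqn I z)) {x<..}
    = (\<integral>\<^sup>+z. g z * indicator {..<-x} (sqn I z) \<partial>euclid I)"
proof -
  have "emeasure (distr (density (euclid I) g) borel (\<lambda>z. - sqn I z)) {x<..}
      = (\<integral>\<^sup>+z. g z * indicator ((\<lambda>z. - sqn I z) -` {x<..} \<inter> space (euclid I)) z \<partial>euclid I)"
    by (subst emeasure_distr) (auto simp: emeasure_density)
  also have "\<dots> = (\<integral>\<^sup>+z. g z * indicator {..<-x} (sqn I z) \<partial>euclid I)"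
    by (intro nn_integral_cong) (auto split: split_indicator)
  finally show ?thesis .
qed

text \<open>The distribution of \<open>sqn\<close> under the density \<open>g\<close> is determined by its values on \<open>{..<s}\<close>; the
  sign turns these sets into the ones of the uniqueness theorem.\<close>

lemma nn_integral_radial_cong:
  assumes I: "finite I" and [measurable]: "g1 \<in> borel_measurable (euclid I)"
      "g2 \<in> borel_measurable (euclid I)" "h \<in> borel_measurable borel"
    and g: "ray_constant I g1" "ray_constant I g2"
    and eq: "(\<integral>\<^sup>+z. g1 z * indicator {..<1} (sqn I z) \<partial>euclid I)
      = (\<integral>\<^sup>+z. g2 z * indicator {..<1} (sqn I z) \<partial>euclid I)"
    and fin: "(\<integral>\<^sup>+z. g2 z * indicator {..<1} (sqn I z) \<partial>euclid I) < \<infinity>"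
  shows "(\<integral>\<^sup>+z. g1 z * h (sqn I z) \<partial>euclid I) = (\<integral>\<^sup>+z. g2 z * h (sqn I z) \<partial>euclid I)"
proof -
  define \<nu> where "\<nu> g = distr (density (euclid I) g) borel (\<lambda>z. - sqn I z)" for g
  have "emeasure (\<nu> g1) {x<..} = emeasure (\<nu> g2) {x<..} \<and> emeasure (\<nu> g2) {x<..} < \<infinity>" for x
  proof (cases "x < 0")
    case True
    then show ?thesis
      using nn_integral_ball_ray_constant[OF I _ g(1), of "- x"]
        nn_integral_ball_ray_constant[OF I _ g(2), of "- x"] eq fin
      by (simp add: \<nu>_def emeasure_distr_sqn ennreal_mult_less_top power_less_top_ennreal)
  next
    case False
    then have "indicator {..<-x} (sqn I z) = (0 :: ennreal)" for z
      using sqn_nonneg[of I z] by simp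
    then show ?thesis by (simp add: \<nu>_def emeasure_distr_sqn)
  qed
  then have "\<nu> g1 = \<nu> g2"
    by (intro measure_eqI_lessThan) (auto simp: \<nu>_def)
  moreover have "(\<integral>\<^sup>+r. h (- r) \<partial>\<nu> g) = (\<integral>\<^sup>+z. g z * h (sqn I z) \<partial>euclid I)"
    if "g \<in> borel_measurable (euclid I)" for g
    using that unfolding \<nu>_def by (subst nn_integral_distr) (auto simp: nn_integral_density)
  ultimately show ?thesis by (metis assms(2,3))
qed

lemma nn_integral_radial_factor:
  assumes I: "finite I" "I \<noteq> {}" and g: "g \<in> borel_measurable (euclid I)" "ray_constant I g"
    and fin: "(\<integral>\<^sup>+z. g z * indicator {..<1} (sqn I z) \<partial>euclid I) < \<infinity>"
  shows "\<exists>c. \<forall>h\<in>borel_measurable borel.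
    (\<integral>\<^sup>+z. g z * h (sqn I z) \<partial>euclid I) = c * (\<integral>\<^sup>+z. h (sqn I z) \<partial>euclid I)"
proof (intro exI ballI)
  define V where "V = (\<integral>\<^sup>+z. indicator {..<1} (sqn I z) \<partial>euclid I)"
  define c where "c = (\<integral>\<^sup>+z. g z * indicator {..<1} (sqn I z) \<partial>euclid I) / V"
  have V_eq: "V = emeasure (euclid I) {z \<in> space (euclid I). sqn I z < 1}"
  proof -
    have "V = (\<integral>\<^sup>+z. indicator {z \<in> space (euclid I). sqn I z < 1} z \<partial>euclid I)"
      unfolding V_def by (intro nn_integral_cong) (auto split: split_indicator)
    then show ?thesis by simp
  qed
  have "V \<le> emeasure (euclid I) {z \<in> space (euclid I). sqn I z \<le> 1}"
    unfolding V_eq by (rule emeasure_mono) auto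
  then have V: "V \<noteq> 0" "V < \<infinity>"
    using emeasure_ball_pos[OF I] emeasure_ball_finite[OF I(1)] unfolding V_eq by auto
  fix h :: "real \<Rightarrow> ennreal" assume h[measurable]: "h \<in> borel_measurable borel"
  have "(\<integral>\<^sup>+z. g z * h (sqn I z) \<partial>euclid I) = (\<integral>\<^sup>+z. c * h (sqn I z) \<partial>euclid I)"
  proof (rule nn_integral_radial_cong[OF I(1) g(1) _ h g(2)])
    have "(\<integral>\<^sup>+z. c * indicator {..<1} (sqn I z) \<partial>euclid I) = c * V"
      unfolding V_def by (rule nn_integral_cmult) measurable
    also have "\<dots> = (\<integral>\<^sup>+z. g z * indicator {..<1} (sqn I z) \<partial>euclid I)"
      using V by (simp add: c_def ennreal_divide_times less_top)
    finally show "(\<integral>\<^sup>+z. g z * indicator {..<1} (sqn I z) \<partial>euclid I)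
        = (\<integral>\<^sup>+z. c * indicator {..<1} (sqn I z) \<partial>euclid I)"
      and "(\<integral>\<^sup>+z. c * indicator {..<1} (sqn I z) \<partial>euclid I) < \<infinity>"
      using fin by simp_all
  qed (simp_all add: ray_constant_def)
  also have "\<dots> = c * (\<integral>\<^sup>+z. h (sqn I z) \<partial>euclid I)"
    by (rule nn_integral_cmult) measurable
  finally show "(\<integral>\<^sup>+z. g z * h (sqn I z) \<partial>euclid I) = c * (\<integral>\<^sup>+z. h (sqn I z) \<partial>euclid I)" .
qed

definition sphere_proj :: "'i set \<Rightarrow> ('i \<Rightarrow> real) \<Rightarrow> 'i \<Rightarrow> real" where
  "sphere_proj I z = (\<lambda>k\<in>I. z k / sqrt (sqn I z))"

lemma sphere_proj_measurable [measurable]: "sphere_proj I \<in> measurable (euclid I) (euclid I)"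
  unfolding sphere_proj_def by measurable

lemma sphere_proj_space: "sphere_proj I z \<in> space (euclid I)"
  by (simp add: sphere_proj_def space_PiM)

lemma ray_constant_sphere_proj: "ray_constant I (sphere_proj I)"
  unfolding ray_constant_def sphere_proj_def sqn_scale by (auto simp: fun_eq_iff real_sqrt_mult)

lemma sqn_sphere_proj:
  assumes "0 < sqn I z"
  shows "sqn I (sphere_proj I z) = 1"
proof -
  have "sqn I (sphere_proj I z) = (\<Sum>k\<in>I. (z k)\<^sup>2 / sqn I z)"
    unfolding sqn_def[of I "sphere_proj I z"] using assms
    by (intro sum.cong refl) (simp add: sphere_proj_def power_divide)
  also have "\<dots> = 1" using assms by (simp add: sqn_def flip: sum_divide_distrib)
  finally show ?thesis .
qed

lemma scale_sphere_proj:
  assumes "0 < sqn I z" "z \<in> space (euclid I)"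
  shows "(\<lambda>k\<in>I. sqrt (sqn I z) * sphere_proj I z k) = z"
  using assms by (auto simp: sphere_proj_def fun_eq_iff space_PiM PiE_def extensional_def)

section \<open>The surface measure\<close>

lemma finite_idx: "finite (idx \<delta> m)"
  by (simp add: idx_def)

lemma sqnorm_eq_sqn: "sqnorm \<delta> m = sqn (idx \<delta> m)"
  by (simp add: fun_eq_iff sqnorm_def sqn_def)

context
  fixes \<delta> m :: nat and I :: "(nat \<times> nat) set" and B :: "(nat \<times> nat \<Rightarrow> real) set"
    and \<sigma> :: "(nat \<times> nat \<Rightarrow> real) measure"
  defines "I \<equiv> idx \<delta> m" and "B \<equiv> punct_ball \<delta> m" and "\<sigma> \<equiv> sigma_K \<delta> m"
  assumes pos: "\<delta> > 0" "m > 0"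
begin

lemma idx_finite_nonempty: "finite I" "I \<noteq> {}"
  using pos by (auto simp: I_def idx_def)

lemma punct_ball_eq: "B = {z \<in> space (euclid I). sqn I z \<in> {0<..1}}"
  by (auto simp: B_def punct_ball_def eucl_def I_def sqnorm_eq_sqn)

lemma punct_ball_sets: "B \<in> sets (euclid I)"
  unfolding punct_ball_eq by measurable

lemma indicator_punct_ball:
  "z \<in> space (euclid I) \<Longrightarrow> indicator B z = (indicator {0<..1} (sqn I z) :: ennreal)"
  by (auto simp: punct_ball_eq split: split_indicator)

lemma emeasure_punct_ball: "emeasure (euclid I) B \<noteq> 0" "emeasure (euclid I) B < \<infinity>"
proof -
  have "0 < emeasure (euclid I) {z \<in> space (euclid I). sqn I z < 1}"
    by (rule emeasure_ball_pos[OF idx_finite_nonempty])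
  also have "\<dots> \<le> emeasure (euclid I) B"
    using AE_sqn_pos[OF idx_finite_nonempty]
    by (intro emeasure_mono_AE punct_ball_sets) (auto simp: punct_ball_eq)
  finally show "emeasure (euclid I) B \<noteq> 0" by simp
  have "emeasure (euclid I) B \<le> emeasure (euclid I) {z \<in> space (euclid I). sqn I z \<le> 1}"
    by (rule emeasure_mono) (auto simp: punct_ball_eq)
  then show "emeasure (euclid I) B < \<infinity>"
    using emeasure_ball_finite[OF idx_finite_nonempty(1)] by simp
qed

lemma sphere_K_eq: "sphere_K \<delta> m = {z \<in> space (euclid I). sqn I z = 1}"
  by (simp add: sphere_K_def eucl_def I_def sqnorm_eq_sqn)

lemma sigma_K_eq:
  "\<sigma> = distr (uniform_measure (restrict_space (euclid I) B) B)
     (restrict_space (euclid I) (sphere_K \<delta> m)) (sphere_proj I)"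
  by (simp add: \<sigma>_def sigma_K_def sphere_proj_def[abs_def] sqnorm_eq_sqn eucl_def B_def I_def)

lemma sphere_proj_measurable_sphere:
  "sphere_proj I \<in> measurable (uniform_measure (restrict_space (euclid I) B) B)
     (restrict_space (euclid I) (sphere_K \<delta> m))"
proof (rule measurable_restrict_space2)
  show "sphere_proj I \<in> space (uniform_measure (restrict_space (euclid I) B) B) \<rightarrow> sphere_K \<delta> m"
    by (auto simp: space_restrict_space punct_ball_eq sphere_K_eq sqn_sphere_proj sphere_proj_space)
  show "sphere_proj I \<in> measurable (uniform_measure (restrict_space (euclid I) B) B) (euclid I)"
    using measurable_restrict_space1[OF sphere_proj_measurable[of I], of B]
    by (simp cong: measurable_cong_sets)
qed

lemma space_sigma_K: "space \<sigma> = sphere_K \<delta> m"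
  by (auto simp: sigma_K_eq space_restrict_space sphere_K_eq)

lemma emeasure_restrict_punct_ball:
  "emeasure (restrict_space (euclid I) B) B = emeasure (euclid I) B"
  using punct_ball_sets by (subst emeasure_restrict_space) auto

lemma prob_space_sigma_K: "prob_space \<sigma>"
  unfolding sigma_K_eq
  using emeasure_punct_ball
  by (intro prob_space.prob_space_distr prob_space_uniform_measure sphere_proj_measurable_sphere)
    (auto simp: emeasure_restrict_punct_ball)

lemma borel_measurable_sigma_K:
  assumes "f \<in> borel_measurable (euclid I)"
  shows "f \<in> borel_measurable \<sigma>"
proof -
  have "sets \<sigma> = sets (restrict_space (euclid I) (sphere_K \<delta> m))"
    by (simp add: sigma_K_eq)
  with measurable_restrict_space1[OF assms] show ?thesis
    using measurable_cong_sets by blast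
qed

lemma nn_integral_sigma_K:
  assumes f: "f \<in> borel_measurable (euclid I)"
  shows "(\<integral>\<^sup>+z. f z \<partial>\<sigma>) * emeasure (euclid I) B
    = (\<integral>\<^sup>+z. f (sphere_proj I z) * indicator {0<..1} (sqn I z) \<partial>euclid I)"
proof -
  have B: "B \<in> sets (restrict_space (euclid I) B)" "B \<inter> space (euclid I) \<in> sets (euclid I)"
    using punct_ball_sets by (auto simp: sets_restrict_space image_iff)
  have f_proj: "(\<lambda>z. f (sphere_proj I z)) \<in> borel_measurable (euclid I)"
    by (rule measurable_compose[OF sphere_proj_measurable f])
  have "(\<integral>\<^sup>+z. f z \<partial>\<sigma>)
      = (\<integral>\<^sup>+z. f (sphere_proj I z) \<partial>uniform_measure (restrict_space (euclid I) B) B)"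
    using borel_measurable_sigma_K[OF f] unfolding sigma_K_eq
    by (intro nn_integral_distr sphere_proj_measurable_sphere)
  also have "\<dots> = (\<integral>\<^sup>+z. f (sphere_proj I z) * indicator B z \<partial>restrict_space (euclid I) B)
      / emeasure (euclid I) B"
    unfolding emeasure_restrict_punct_ball[symmetric]
    using B f_proj by (intro nn_integral_uniform_measure measurable_restrict_space1)
  also have "(\<integral>\<^sup>+z. f (sphere_proj I z) * indicator B z \<partial>restrict_space (euclid I) B)
        = (\<integral>\<^sup>+z. f (sphere_proj I z) * indicator {0<..1} (sqn I z) \<partial>euclid I)"
    using B(2) by (subst nn_integral_restrict_space)
      (auto intro!: nn_integral_cong simp: indicator_punct_ball[symmetric] split: split_indicator)
  finally show ?thesis
    using emeasure_punct_ball by (simp add: ennreal_divide_times less_top)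
qed

lemma nn_integral_polar:
  assumes f: "f \<in> borel_measurable (euclid I)" and h: "h \<in> borel_measurable borel"
    and fin: "(\<integral>\<^sup>+z. f z \<partial>\<sigma>) < \<infinity>"
  shows "(\<integral>\<^sup>+z. f (sphere_proj I z) * h (sqn I z) \<partial>euclid I)
    = (\<integral>\<^sup>+z. f z \<partial>\<sigma>) * (\<integral>\<^sup>+z. h (sqn I z) \<partial>euclid I)"
proof -
  have f_proj: "(\<lambda>z. f (sphere_proj I z)) \<in> borel_measurable (euclid I)"
    by (rule measurable_compose[OF sphere_proj_measurable f])
  have "(\<integral>\<^sup>+z. f (sphere_proj I z) * indicator {..<1} (sqn I z) \<partial>euclid I)
      \<le> (\<integral>\<^sup>+z. f (sphere_proj I z) * indicator {0<..1} (sqn I z) \<partial>euclid I)"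
    using AE_sqn_pos[OF idx_finite_nonempty]
    by (intro nn_integral_mono_AE) (auto split: split_indicator)
  also have "\<dots> < \<infinity>"
    unfolding nn_integral_sigma_K[OF f, symmetric] using fin emeasure_punct_ball
    by (simp add: ennreal_mult_less_top)
  finally obtain c where c: "\<And>h. h \<in> borel_measurable borel \<Longrightarrow>
      (\<integral>\<^sup>+z. f (sphere_proj I z) * h (sqn I z) \<partial>euclid I) = c * (\<integral>\<^sup>+z. h (sqn I z) \<partial>euclid I)"
    using nn_integral_radial_factor[OF idx_finite_nonempty f_proj]
      ray_constant_compose[OF ray_constant_sphere_proj, where f = f]
    by blast
  have "emeasure (euclid I) B = (\<integral>\<^sup>+z. indicator {0<..1} (sqn I z) \<partial>euclid I)"
    unfolding nn_integral_indicator[OF punct_ball_sets, symmetric]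
    by (intro nn_integral_cong) (simp add: indicator_punct_ball)
  then have "emeasure (euclid I) B * (\<integral>\<^sup>+z. f z \<partial>\<sigma>) = emeasure (euclid I) B * c"
    using nn_integral_sigma_K[OF f] c[of "indicator {0<..1}"] by (simp add: mult.commute)
  then have "(\<integral>\<^sup>+z. f z \<partial>\<sigma>) = c"
    using emeasure_punct_ball by (auto simp: ennreal_mult_cancel_left)
  then show ?thesis using c[OF h] by simp
qed

lemma integral_polar:
  fixes f :: "(nat \<times> nat \<Rightarrow> real) \<Rightarrow> real" and h :: "real \<Rightarrow> real"
  assumes f: "f \<in> borel_measurable (euclid I)" "integrable \<sigma> f"
    and h: "h \<in> borel_measurable borel" "\<And>r. r \<ge> 0 \<Longrightarrow> 0 \<le> h r"
    and int: "integrable (euclid I) (\<lambda>z. f (sphere_proj I z) * h (sqn I z))"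
  shows "(\<integral>z. f (sphere_proj I z) * h (sqn I z) \<partial>euclid I)
    = (\<integral>z. f z \<partial>\<sigma>) * (\<integral>z. h (sqn I z) \<partial>euclid I)"
proof -
  define H where "H = (\<integral>\<^sup>+z. ennreal (h (sqn I z)) \<partial>euclid I)"
  have polar: "(\<integral>\<^sup>+z. ennreal (g (sphere_proj I z) * h (sqn I z)) \<partial>euclid I)
      = (\<integral>\<^sup>+z. ennreal (g z) \<partial>\<sigma>) * H"
    if g[measurable]: "g \<in> borel_measurable (euclid I)" and fin: "(\<integral>\<^sup>+z. ennreal (g z) \<partial>\<sigma>) < \<infinity>"
    for g
    unfolding H_def using h nn_integral_polar[OF _ _ fin, of "\<lambda>r. ennreal (h r)"]
    by (simp add: ennreal_mult'' sqn_nonneg)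
  have fin: "(\<integral>\<^sup>+z. ennreal (f z) \<partial>\<sigma>) < \<infinity>" "(\<integral>\<^sup>+z. ennreal (- f z) \<partial>\<sigma>) < \<infinity>"
    using f(2) by (auto simp: real_integrable_def less_top)
  have "(\<integral>z. f (sphere_proj I z) * h (sqn I z) \<partial>euclid I)
      = (enn2real (\<integral>\<^sup>+z. ennreal (f z) \<partial>\<sigma>) - enn2real (\<integral>\<^sup>+z. ennreal (- f z) \<partial>\<sigma>)) * enn2real H"
    using polar[OF f(1) fin(1)] polar[OF borel_measurable_uminus[OF f(1)] fin(2)]
    by (simp add: real_lebesgue_integral_def[OF int] enn2real_mult left_diff_distrib)
  also have "enn2real H = (\<integral>z. h (sqn I z) \<partial>euclid I)"
    unfolding H_def using h by (intro integral_eq_nn_integral[symmetric]) (auto simp: sqn_nonneg)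
  finally show ?thesis
    by (simp add: real_lebesgue_integral_def[OF f(2)])
qed

lemma sphere_K_coord_le:
  assumes "z \<in> sphere_K \<delta> m" "k \<in> I"
  shows "\<bar>z k\<bar> \<le> 1"
  using coord_square_le_sqn[OF idx_finite_nonempty(1) assms(2), of z] assms(1)
  by (simp add: sphere_K_eq flip: abs_square_le_1)

lemma integrable_polyfun_sigma_K:
  assumes "polyfun I f"
  shows "integrable \<sigma> f"
proof -
  interpret prob_space \<sigma> by (rule prob_space_sigma_K)
  obtain K where "\<And>z. (\<And>k. k \<in> I \<Longrightarrow> \<bar>z k\<bar> \<le> 1) \<Longrightarrow> \<bar>f z\<bar> \<le> K"
    using polyfun_bounded_on_cube[OF assms idx_finite_nonempty(1)] by metis
  then have "AE z in \<sigma>. norm (f z) \<le> K"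
    using sphere_K_coord_le by (intro AE_I2) (simp add: space_sigma_K)
  then show ?thesis
    by (intro integrable_const_bound borel_measurable_sigma_K polyfun_measurable assms)
qed

lemma gauss_expect_homogeneous:
  assumes f: "polyfun I f" and hom: "\<And>c z. c > 0 \<Longrightarrow> f (\<lambda>k\<in>I. c * z k) = c ^ (2 * n) * f z"
  shows "gauss_expect I f = (\<integral>z. f z \<partial>\<sigma>) * gauss_expect I (\<lambda>z. sqn I z ^ n)"
proof -
  define w where "w r = r ^ n * ((1 / sqrt (2 * pi)) ^ card I * exp (- r / 2))" for r :: real
  have w: "w (sqn I z) = sqn I z ^ n * gauss_density I z" for z
    by (simp add: w_def gauss_density_radial idx_finite_nonempty)
  have [measurable]: "f \<in> borel_measurable (euclid I)" "w \<in> borel_measurable borel"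
    using polyfun_measurable[OF f] unfolding w_def by measurable
  have polar: "f z * gauss_density I z = f (sphere_proj I z) * w (sqn I z)"
    if "0 < sqn I z" "z \<in> space (euclid I)" for z
    using hom[of "sqrt (sqn I z)" "sphere_proj I z"] that
    by (simp add: scale_sphere_proj w power_mult)
  have AE_polar: "AE z in euclid I. f z * gauss_density I z = f (sphere_proj I z) * w (sqn I z)"
    using AE_sqn_pos[OF idx_finite_nonempty] AE_space by eventually_elim (rule polar)
  have int: "integrable (euclid I) (\<lambda>z. f (sphere_proj I z) * w (sqn I z))"
    using integrable_polyfun_gauss[OF f idx_finite_nonempty(1)] AE_polar
    by (subst integrable_cong_AE[symmetric, where f = "\<lambda>z. f z * gauss_density I z"]) auto
  have "gauss_expect I f = (\<integral>z. f (sphere_proj I z) * w (sqn I z) \<partial>euclid I)"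
    unfolding gauss_expect_def using AE_polar by (intro integral_cong_AE) measurable
  also have "\<dots> = (\<integral>z. f z \<partial>\<sigma>) * (\<integral>z. w (sqn I z) \<partial>euclid I)"
    using integrable_polyfun_sigma_K[OF f] int by (intro integral_polar) (auto simp: w_def)
  finally show ?thesis by (simp add: w gauss_expect_def)
qed

end

section \<open>Homogeneous polynomials on the sphere\<close>

lemma finite_exps: "finite (exps \<delta> m p)"
  by (rule finite_subset[of _ "PiE (idx \<delta> m) (\<lambda>_. {..p})"])
    (auto simp: exps_def finite_idx intro!: finite_PiE)

lemma homog_poly_add:
  assumes "homog_poly \<delta> m p f" "homog_poly \<delta> m p g"
  shows "homog_poly \<delta> m p (\<lambda>y. f y + g y)"
proof -
  obtain c d where "\<And>y. f y = (\<Sum>a\<in>exps \<delta> m p. c a * (\<Prod>k\<in>idx \<delta> m. complex_of_real (y k) ^ a k))"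
    "\<And>y. g y = (\<Sum>a\<in>exps \<delta> m p. d a * (\<Prod>k\<in>idx \<delta> m. complex_of_real (y k) ^ a k))"
    using assms unfolding homog_poly_def by blast
  then show ?thesis
    unfolding homog_poly_def
    by (intro exI[of _ "\<lambda>a. c a + d a"]) (simp add: sum.distrib distrib_right)
qed

lemma homog_poly_cmult:
  assumes "homog_poly \<delta> m p f"
  shows "homog_poly \<delta> m p (\<lambda>y. e * f y)"
proof -
  obtain c where "\<And>y. f y = (\<Sum>a\<in>exps \<delta> m p. c a * (\<Prod>k\<in>idx \<delta> m. complex_of_real (y k) ^ a k))"
    using assms unfolding homog_poly_def by blast
  then show ?thesis
    unfolding homog_poly_def
    by (intro exI[of _ "\<lambda>a. e * c a"]) (simp add: sum_distrib_left mult.assoc)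
qed

lemma homog_poly_sum:
  "(\<And>i. i \<in> A \<Longrightarrow> homog_poly \<delta> m p (f i)) \<Longrightarrow> homog_poly \<delta> m p (\<lambda>y. \<Sum>i\<in>A. f i y)"
proof (induction A rule: infinite_finite_induct)
  case (insert i A)
  then show ?case by (simp add: homog_poly_add)
qed (auto simp: homog_poly_def intro!: exI[of _ "\<lambda>_. 0"])

lemma homog_poly_monomial:
  assumes "a \<in> exps \<delta> m p"
  shows "homog_poly \<delta> m p (\<lambda>y. \<Prod>k\<in>idx \<delta> m. complex_of_real (y k) ^ a k)"
  unfolding homog_poly_def
  using assms by (intro exI[of _ "\<lambda>a'. if a' = a then 1 else 0"] allI)
    (simp add: finite_exps if_distrib[of "\<lambda>x. x * _"] cong: if_cong)

lemma homog_poly_mult: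
  assumes "homog_poly \<delta> m p f" "homog_poly \<delta> m q g"
  shows "homog_poly \<delta> m (p + q) (\<lambda>y. f y * g y)"
proof -
  obtain c d where f: "\<And>y. f y = (\<Sum>a\<in>exps \<delta> m p. c a * (\<Prod>k\<in>idx \<delta> m. complex_of_real (y k) ^ a k))"
    and g: "\<And>y. g y = (\<Sum>a\<in>exps \<delta> m q. d a * (\<Prod>k\<in>idx \<delta> m. complex_of_real (y k) ^ a k))"
    using assms unfolding homog_poly_def by blast
  define s where "s a b = (\<lambda>k\<in>idx \<delta> m. a k + b k)" for a b :: "nat \<times> nat \<Rightarrow> nat"
  have s: "s a b \<in> exps \<delta> m (p + q)" if "a \<in> exps \<delta> m p" "b \<in> exps \<delta> m q" for a b
    using that by (fastforce simp: s_def exps_def PiE_def Pi_def sum.distrib intro: add_mono)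
  have "homog_poly \<delta> m (p + q) (\<lambda>y. \<Sum>a\<in>exps \<delta> m p. \<Sum>b\<in>exps \<delta> m q. (c a * d b) *
      (\<Prod>k\<in>idx \<delta> m. complex_of_real (y k) ^ s a b k))"
    by (intro homog_poly_sum homog_poly_cmult homog_poly_monomial s)
  moreover have "f y * g y = (\<Sum>a\<in>exps \<delta> m p. \<Sum>b\<in>exps \<delta> m q. (c a * d b) *
      (\<Prod>k\<in>idx \<delta> m. complex_of_real (y k) ^ s a b k))" for y
    unfolding f g sum_product
    by (intro sum.cong refl) (simp add: s_def power_add prod.distrib mult_ac)
  ultimately show ?thesis by simp
qed

lemma homog_poly_const: "homog_poly \<delta> m 0 (\<lambda>y. c)"
proof -
  have "(\<lambda>k\<in>idx \<delta> m. 0) \<in> exps \<delta> m 0" by (simp add: exps_def PiE_def)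
  from homog_poly_cmult[OF homog_poly_monomial[OF this], of c] show ?thesis by simp
qed

lemma homog_poly_power:
  "homog_poly \<delta> m p f \<Longrightarrow> homog_poly \<delta> m (p * n) (\<lambda>y. f y ^ n)"
proof (induction n)
  case 0
  then show ?case by (simp add: homog_poly_const)
next
  case (Suc n)
  then show ?case using homog_poly_mult[of \<delta> m p f "p * n" "\<lambda>y. f y ^ n"] by simp
qed

lemma homog_poly_coord:
  assumes k: "k \<in> idx \<delta> m"
  shows "homog_poly \<delta> m 1 (\<lambda>y. complex_of_real (y k))"
proof -
  define e where "e = (\<lambda>j\<in>idx \<delta> m. if j = k then 1 else (0 :: nat))"
  have "e \<in> exps \<delta> m 1"
    using k by (auto simp: e_def exps_def PiE_def finite_idx)
  moreover have "(\<Prod>j\<in>idx \<delta> m. complex_of_real (y j) ^ e j) = complex_of_real (y k)" for y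
  proof -
    have "(\<Prod>j\<in>idx \<delta> m. complex_of_real (y j) ^ e j)
      = (\<Prod>j\<in>idx \<delta> m. if j = k then complex_of_real (y j) else 1)"
      by (intro prod.cong) (auto simp: e_def)
    then show ?thesis using k by (simp add: finite_idx)
  qed
  ultimately show ?thesis using homog_poly_monomial[of e \<delta> m 1] by simp
qed

lemma homog_poly_sqproj: "homog_poly \<delta> m 2 (\<lambda>y. complex_of_real (sqproj (idx \<delta> m) J a y))"
proof -
  have "homog_poly \<delta> m 1 (\<lambda>y. complex_of_real (inner_on (idx \<delta> m) (a j) y))" for j
    unfolding inner_on_def of_real_sum of_real_mult
    by (intro homog_poly_sum homog_poly_cmult homog_poly_coord)
  from homog_poly_power[OF this, of 2] show ?thesis
    unfolding sqproj_def of_real_sum of_real_power by (intro homog_poly_sum) simp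
qed

section \<open>The squared modulus of the inner product\<close>

text \<open>With \<open>e\<^sub>j\<close> the units of K, the \<open>j\<close>-th real component of the K-valued inner product
  \<open>(x, z)\<close> is the real inner product of \<open>x e\<^sub>j\<close> with \<open>z\<close>; hence \<open>|(x, z)|\<^sup>2\<close> is
  the squared length of the projection of \<open>z\<close> to the span of the vectors \<open>x e\<^sub>j\<close>.\<close>

definition frame :: "nat \<Rightarrow> nat \<Rightarrow> (nat \<times> nat \<Rightarrow> real) \<Rightarrow> nat \<Rightarrow> nat \<times> nat \<Rightarrow> real" where
  "frame \<delta> m x j = rmult \<delta> m x (unit_vec j)"

definition sqinner :: "nat \<Rightarrow> nat \<Rightarrow> (nat \<times> nat \<Rightarrow> real) \<Rightarrow> (nat \<times> nat \<Rightarrow> real) \<Rightarrow> real" where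
  "sqinner \<delta> m x z = sqproj (idx \<delta> m) {..<\<delta>} (frame \<delta> m x) z"

definition pad :: "nat \<Rightarrow> (nat \<Rightarrow> real) \<Rightarrow> nat \<Rightarrow> real" where
  "pad \<delta> w = (\<lambda>k. if k < \<delta> then w k else 0)"

lemmas qmul_expand = eval_nat_numeral less_Suc_eq qmul_def unit_vec_def pad_def

lemma qmul_unit_vec_orthogonal:
  assumes "\<delta> \<in> {1, 2, 4}" "i < \<delta>" "j < \<delta>"
  shows "(\<Sum>k<\<delta>. qmul (pad \<delta> w) (unit_vec i) k * qmul (pad \<delta> w) (unit_vec j) k)
    = (if i = j then (\<Sum>k<\<delta>. (w k)\<^sup>2) else 0)"
  using assms by (auto simp: qmul_expand power2_eq_square)

lemma qmul_unit_vec_adjoint: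
  assumes "\<delta> \<in> {1, 2, 4}" "j < \<delta>"
  shows "(\<Sum>k<\<delta>. qmul (pad \<delta> w) (unit_vec j) k * v k)
    = (if j = 0 then 1 else - 1) * (\<Sum>k<\<delta>. qmul (pad \<delta> v) (unit_vec j) k * w k)"
  using assms by (auto simp: qmul_expand mult.commute)

lemma qmul_unit_vec_qmul:
  assumes "\<delta> \<in> {1, 2, 4}" "j < \<delta>" "\<And>k. k \<ge> \<delta> \<Longrightarrow> l k = 0"
  shows "(\<Sum>k<\<delta>. qmul (pad \<delta> w) (unit_vec j) k * qmul (pad \<delta> v) l k)
    = qmul (pad \<delta> (\<lambda>i. \<Sum>k<\<delta>. qmul (pad \<delta> w) (unit_vec i) k * v k)) l j"
  using assms by (auto simp: qmul_expand algebra_simps)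

lemma qmul_norm:
  assumes "\<delta> \<in> {1, 2, 4}" "unit_K \<delta> l"
  shows "(\<Sum>j<\<delta>. (qmul (pad \<delta> c) l j)\<^sup>2) = (\<Sum>j<\<delta>. (c j)\<^sup>2)"
proof -
  have l: "(\<Sum>k<4. (l k)\<^sup>2) = 1" "\<And>k. k \<ge> \<delta> \<Longrightarrow> l k = 0"
    using assms(2) by (auto simp: unit_K_def)
  have "(\<Sum>j<\<delta>. (qmul (pad \<delta> c) l j)\<^sup>2) = (\<Sum>j<\<delta>. (c j)\<^sup>2) * (\<Sum>k<4. (l k)\<^sup>2)"
    using assms(1) l(2) by (auto simp: qmul_expand power2_eq_square algebra_simps)
  then show ?thesis unfolding l(1) by simp
qed

lemma qmul_sum_left: "qmul (\<lambda>i. \<Sum>r\<in>A. f r i) l j = (\<Sum>r\<in>A. qmul (f r) l j)"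
  by (auto simp: qmul_def sum_distrib_right sum.distrib sum_subtractf)

lemma sum_idx: "(\<Sum>k\<in>idx \<delta> m. f k) = (\<Sum>r<m. \<Sum>k<\<delta>. f (r, k))"
  by (simp add: idx_def sum.cartesian_product atLeast0LessThan)

lemma rmult_apply: "r < m \<Longrightarrow> k < \<delta> \<Longrightarrow> rmult \<delta> m x l (r, k) = qmul (pad \<delta> (\<lambda>k. x (r, k))) l k"
  by (simp add: rmult_def idx_def pad_def)

lemma inner_on_frame:
  "inner_on (idx \<delta> m) (frame \<delta> m x j) z
     = (\<Sum>r<m. \<Sum>k<\<delta>. qmul (pad \<delta> (\<lambda>k. x (r, k))) (unit_vec j) k * z (r, k))"
  unfolding inner_on_def sum_idx frame_def by (intro sum.cong refl) (simp add: rmult_apply)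

lemma inner_on_frame_rmult:
  "inner_on (idx \<delta> m) (frame \<delta> m x j) (rmult \<delta> m y l)
     = (\<Sum>r<m. \<Sum>k<\<delta>. qmul (pad \<delta> (\<lambda>k. x (r, k))) (unit_vec j) k * qmul (pad \<delta> (\<lambda>k. y (r, k))) l k)"
  unfolding inner_on_frame by (intro sum.cong refl) (simp add: rmult_apply)

lemma orthonormal_frame:
  assumes \<delta>: "\<delta> \<in> {1, 2, 4}" and x: "sqn (idx \<delta> m) x = 1"
  shows "orthonormal_family (idx \<delta> m) {..<\<delta>} (frame \<delta> m x)"
  unfolding orthonormal_family_def
proof (intro ballI)
  fix i j assume ij: "i \<in> {..<\<delta>}" "j \<in> {..<\<delta>}"
  have "inner_on (idx \<delta> m) (frame \<delta> m x i) (frame \<delta> m x j)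
      = (\<Sum>r<m. if i = j then (\<Sum>k<\<delta>. (x (r, k))\<^sup>2) else 0)"
    unfolding frame_def[of \<delta> m x j] inner_on_frame_rmult
    using ij by (simp only: qmul_unit_vec_orthogonal[OF \<delta>] lessThan_iff)
  also have "\<dots> = (if i = j then 1 else 0)"
    using x by (simp add: sqn_def sum_idx)
  finally show "inner_on (idx \<delta> m) (frame \<delta> m x i) (frame \<delta> m x j) = (if i = j then 1 else 0)" .
qed

lemma sqinner_commute:
  assumes \<delta>: "\<delta> \<in> {1, 2, 4}"
  shows "sqinner \<delta> m x z = sqinner \<delta> m z x"
  unfolding sqinner_def sqproj_def
proof (intro sum.cong refl)
  fix j assume "j \<in> {..<\<delta>}"
  then have "inner_on (idx \<delta> m) (frame \<delta> m x j) z
      = (if j = 0 then 1 else - 1) * inner_on (idx \<delta> m) (frame \<delta> m z j) x"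
    unfolding inner_on_frame sum_distrib_left[of _ _ "{..<m}"]
    by (intro sum.cong refl qmul_unit_vec_adjoint[OF \<delta>]) auto
  then show "(inner_on (idx \<delta> m) (frame \<delta> m x j) z)\<^sup>2 = (inner_on (idx \<delta> m) (frame \<delta> m z j) x)\<^sup>2"
    by auto
qed

lemma inner_on_frame_rmult_eq_qmul:
  assumes \<delta>: "\<delta> \<in> {1, 2, 4}" and l: "unit_K \<delta> l" and j: "j < \<delta>"
  shows "inner_on (idx \<delta> m) (frame \<delta> m z j) (rmult \<delta> m y l)
    = qmul (pad \<delta> (\<lambda>i. inner_on (idx \<delta> m) (frame \<delta> m z i) y)) l j"
proof -
  have "inner_on (idx \<delta> m) (frame \<delta> m z j) (rmult \<delta> m y l)
    = (\<Sum>r<m. qmul (pad \<delta> (\<lambda>i. \<Sum>k<\<delta>. qmul (pad \<delta> (\<lambda>k. z (r, k))) (unit_vec i) k * y (r, k))) l j)"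
    unfolding inner_on_frame_rmult using l
    by (intro sum.cong refl qmul_unit_vec_qmul[OF \<delta> j]) (simp add: unit_K_def)
  also have "\<dots> = qmul (\<lambda>i. \<Sum>r<m.
      pad \<delta> (\<lambda>i. \<Sum>k<\<delta>. qmul (pad \<delta> (\<lambda>k. z (r, k))) (unit_vec i) k * y (r, k)) i) l j"
    by (rule qmul_sum_left[symmetric])
  also have "(\<lambda>i. \<Sum>r<m. pad \<delta> (\<lambda>i. \<Sum>k<\<delta>. qmul (pad \<delta> (\<lambda>k. z (r, k))) (unit_vec i) k * y (r, k)) i)
      = pad \<delta> (\<lambda>i. inner_on (idx \<delta> m) (frame \<delta> m z i) y)"
    by (auto simp: pad_def inner_on_frame fun_eq_iff)
  finally show ?thesis .
qed

lemma sqinner_rmult: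
  assumes \<delta>: "\<delta> \<in> {1, 2, 4}" and l: "unit_K \<delta> l"
  shows "sqinner \<delta> m z (rmult \<delta> m y l) = sqinner \<delta> m z y"
  unfolding sqinner_def sqproj_def
  using qmul_norm[OF \<delta> l, of "\<lambda>i. inner_on (idx \<delta> m) (frame \<delta> m z i) y"]
  by (simp add: inner_on_frame_rmult_eq_qmul[OF \<delta> l])

lemma sqn_rmult:
  assumes \<delta>: "\<delta> \<in> {1, 2, 4}" and l: "unit_K \<delta> l"
  shows "sqn (idx \<delta> m) (rmult \<delta> m y l) = sqn (idx \<delta> m) y"
  unfolding sqn_def sum_idx using qmul_norm[OF \<delta> l] by (simp add: rmult_apply)

definition homogenize :: "nat \<Rightarrow> real poly \<Rightarrow> real \<Rightarrow> real \<Rightarrow> real" where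
  "homogenize d R t r = (\<Sum>j\<le>d. coeff R j * (t ^ j * r ^ (d - j)))"

lemma homogenize_1:
  assumes "degree R \<le> d"
  shows "homogenize d R t 1 = poly R t"
proof -
  have "homogenize d R t 1 = (\<Sum>j\<le>d. coeff R j * t ^ j)"
    by (simp add: homogenize_def)
  also have "\<dots> = poly R t"
    unfolding poly_altdef using assms by (intro sum.mono_neutral_right) (auto simp: coeff_eq_0)
  finally show ?thesis .
qed

lemma homogenize_sqinner_in_Phi_K:
  assumes \<delta>: "\<delta> \<in> {1, 2, 4}"
  shows "(\<lambda>y. complex_of_real (homogenize d R (sqinner \<delta> m z y) (sqn (idx \<delta> m) y)))
    \<in> Phi_K \<delta> m (2 * d)"
proof -
  have "homog_poly \<delta> m (2 * d) (\<lambda>y. \<Sum>j\<le>d. complex_of_real (coeff R j) *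
      (complex_of_real (sqinner \<delta> m z y) ^ j * complex_of_real (sqn (idx \<delta> m) y) ^ (d - j)))"
  proof (intro homog_poly_sum homog_poly_cmult)
    fix j assume "j \<in> {..d}"
    then have degree: "2 * d = 2 * j + 2 * (d - j)" by auto
    show "homog_poly \<delta> m (2 * d)
        (\<lambda>y. complex_of_real (sqinner \<delta> m z y) ^ j * complex_of_real (sqn (idx \<delta> m) y) ^ (d - j))"
      unfolding degree sqinner_def sqn_eq_sqproj[OF finite_idx]
      by (intro homog_poly_mult homog_poly_power homog_poly_sqproj)
  qed
  then show ?thesis
    by (simp add: Phi_K_def homogenize_def sqinner_rmult[OF \<delta>] sqn_rmult[OF \<delta>])
qed

lemma proj_cubature_sqinner:
  assumes \<delta>: "\<delta> \<in> {1, 2, 4}" and m: "m > 0"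
    and cubature: "proj_cubature \<delta> m (2 * d) n x \<rho>" and R: "degree R \<le> d"
  shows "(\<Sum>i<n. \<rho> i * poly R (sqinner \<delta> m z (x i))) = (\<integral>y. poly R (sqinner \<delta> m z y) \<partial>sigma_K \<delta> m)"
proof -
  define f where "f y = homogenize d R (sqinner \<delta> m z y) (sqn (idx \<delta> m) y)" for y
  have f_sphere: "f y = poly R (sqinner \<delta> m z y)" if "y \<in> sphere_K \<delta> m" for y
    using that homogenize_1[OF R] by (simp add: f_def sphere_K_def sqnorm_eq_sqn)
  have "(\<lambda>y. complex_of_real (f y)) \<in> Phi_K \<delta> m (2 * d)"
    unfolding f_def by (rule homogenize_sqinner_in_Phi_K[OF \<delta>])
  then have "(\<integral>y. complex_of_real (f y) \<partial>sigma_K \<delta> m)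
      = (\<Sum>i<n. complex_of_real (\<rho> i) * complex_of_real (f (x i)))"
    using cubature unfolding proj_cubature_def by blast
  then have "complex_of_real (\<integral>y. f y \<partial>sigma_K \<delta> m) = complex_of_real (\<Sum>i<n. \<rho> i * f (x i))"
    by simp
  then have "(\<Sum>i<n. \<rho> i * f (x i)) = (\<integral>y. f y \<partial>sigma_K \<delta> m)"
    by (simp only: of_real_eq_iff)
  moreover have "(\<integral>y. f y \<partial>sigma_K \<delta> m) = (\<integral>y. poly R (sqinner \<delta> m z y) \<partial>sigma_K \<delta> m)"
    using \<delta> m by (intro Bochner_Integration.integral_cong refl f_sphere) (auto simp: space_sigma_K)
  ultimately show ?thesis
    using cubature by (simp add: f_sphere proj_cubature_def)
qed

section \<open>Cubature formulas as Jacobi designs\<close>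

locale projective_sphere =
  fixes \<delta> m :: nat and \<alpha> \<beta> :: real
  assumes \<delta>: "\<delta> \<in> {1, 2, 4}" and m: "m \<ge> 2"
    and \<alpha>: "\<alpha> = (real (\<delta> * (m - 1)) - 2) / 2" and \<beta>: "\<beta> = (real \<delta> - 2) / 2"
begin

abbreviation I :: "(nat \<times> nat) set" where "I \<equiv> idx \<delta> m"

abbreviation \<sigma> :: "(nat \<times> nat \<Rightarrow> real) measure" where "\<sigma> \<equiv> sigma_K \<delta> m"

lemma dims_pos: "\<delta> > 0" "m > 0"
  using \<delta> m by auto

lemma jacobi_parameters: "\<alpha> > -1" "\<beta> > -1"
  using dims_pos m by (auto simp: \<alpha> \<beta>)

lemma dims_eq: "real \<delta> = 2 * \<beta> + 2" "real (\<delta> * m) = 2 * (\<alpha> + \<beta> + 1) + 2"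
  using m by (simp_all add: \<alpha> \<beta> of_nat_diff field_simps)

interpretation prob_space \<sigma>
  by (rule prob_space_sigma_K[OF dims_pos])

lemma integrable_polyfun: "polyfun I f \<Longrightarrow> integrable \<sigma> f"
  by (rule integrable_polyfun_sigma_K[OF dims_pos])

lemma sigma_sqproj_recurrence:
  assumes ab: "orthonormal_family I {..<\<delta>} a" "orthonormal_family I {..<\<delta>} b"
  defines "S \<equiv> \<lambda>i j. \<integral>z. sqproj I {..<\<delta>} a z ^ i * sqproj I {..<\<delta>} b z ^ j \<partial>\<sigma>"
  shows "real j * (real j + \<beta>) * S i (j - 1) - real i * (real i + \<beta>) * S (i - 1) j
    = (jacobi_eigenvalue \<alpha> \<beta> j - jacobi_eigenvalue \<alpha> \<beta> i) * S i j"
proof (cases "i + j")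
  case (Suc n)
  define E where "E n = gauss_expect I (\<lambda>z. sqn I z ^ n)" for n
  define G where "G i j = gauss_expect I (\<lambda>z. sqproj I {..<\<delta>} a z ^ i * sqproj I {..<\<delta>} b z ^ j)"
    for i j
  have GS: "G i j = S i j * E (i + j)" for i j
    unfolding S_def E_def G_def
    by (intro gauss_expect_homogeneous dims_pos polyfun_intros polyfun_sqproj)
      (simp_all add: sqproj_scale power_mult_distrib power_mult[symmetric] power_add
        distrib_left mult_ac)
  have "card I = \<delta> * m" by (simp add: idx_def mult.commute)
  then have "E (Suc n) = (real (\<delta> * m) + 2 * real n) * E n"
    using gauss_expect_sqn_power_Suc[OF finite_idx[of \<delta> m], of n] by (simp add: E_def)
  also have "real (\<delta> * m) + 2 * real n = 2 * (real i + real j + \<alpha> + \<beta> + 1)"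
    using arg_cong[OF Suc, of real] by (simp add: dims_eq(2) del: of_nat_mult)
  finally have top: "G i j = E n * (2 * (real i + real j + \<alpha> + \<beta> + 1) * S i j)"
    using GS[of i j] Suc by simp
  have lower: "real j * c * G i (j - 1) = E n * (real j * c * S i (j - 1))"
    "real i * c * G (i - 1) j = E n * (real i * c * S (i - 1) j)" for c
    using GS[of i "j - 1"] GS[of "i - 1" j] Suc by (cases j; simp; fail | cases i; simp; fail)+
  have "2 * (E n * (real j * (real j + \<beta>) * S i (j - 1) - real i * (real i + \<beta>) * S (i - 1) j))
      = 2 * (real j * (real j + \<beta>) * G i (j - 1) - real i * (real i + \<beta>) * G (i - 1) j)"
    by (simp only: lower right_diff_distrib[of "E n"])
  also have "\<dots> = (real j - real i) * G i j"
    using gauss_expect_sqproj_recurrence[OF finite_idx finite_lessThan finite_lessThan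
        card_lessThan card_lessThan ab, of j i]
    unfolding G_def[symmetric] by (simp add: dims_eq(1) algebra_simps)
  also have "\<dots> = 2 * (E n * ((jacobi_eigenvalue \<alpha> \<beta> j - jacobi_eigenvalue \<alpha> \<beta> i) * S i j))"
    by (simp add: top jacobi_eigenvalue_def algebra_simps)
  finally show ?thesis
    using gauss_expect_sqn_power_pos[OF idx_finite_nonempty[OF dims_pos], of n] by (simp add: E_def)
qed auto

lemma sigma_jacobi_op_symmetric:
  assumes ab: "orthonormal_family I {..<\<delta>} a" "orthonormal_family I {..<\<delta>} b"
  shows "(\<integral>z. poly P (sqproj I {..<\<delta>} a z) * poly (jacobi_op \<alpha> \<beta> R) (sqproj I {..<\<delta>} b z) \<partial>\<sigma>)
    = (\<integral>z. poly (jacobi_op \<alpha> \<beta> P) (sqproj I {..<\<delta>} a z) * poly R (sqproj I {..<\<delta>} b z) \<partial>\<sigma>)"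
proof -
  define T where "T P R = (\<integral>z. poly P (sqproj I {..<\<delta>} a z) * poly R (sqproj I {..<\<delta>} b z) \<partial>\<sigma>)"
    for P R
  have "integrable \<sigma> (\<lambda>z. poly P (sqproj I {..<\<delta>} a z) * poly R (sqproj I {..<\<delta>} b z))" for P R
    by (intro integrable_polyfun polyfun_intros polyfun_poly polyfun_sqproj)
  then have T_add: "T (P + Q) R = T P R + T Q R" "T R (P + Q) = T R P + T R Q" for P Q R
    unfolding T_def by (simp_all add: distrib_right distrib_left)
  have T_smult: "T (smult c P) R = c * T P R" "T P (smult c R) = c * T P R" for c P R
    unfolding T_def by (simp_all add: mult.assoc mult.left_commute)
  have T_monom: "T (monom c i) (monom e j)
      = c * e * (\<integral>z. sqproj I {..<\<delta>} a z ^ i * sqproj I {..<\<delta>} b z ^ j \<partial>\<sigma>)" for c e i j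
    unfolding T_def poly_monom by (simp add: mult_ac flip: integral_mult_right_zero)
  have "T P (jacobi_op \<alpha> \<beta> R) - T (jacobi_op \<alpha> \<beta> P) R = 0"
  proof (rule poly_bilinear_eq_0[where f = "\<lambda>P R. T P (jacobi_op \<alpha> \<beta> R) - T (jacobi_op \<alpha> \<beta> P) R"])
    show "T (monom 1 i) (jacobi_op \<alpha> \<beta> (monom 1 j)) - T (jacobi_op \<alpha> \<beta> (monom 1 i)) (monom 1 j) = 0"
      for i j
      using sigma_sqproj_recurrence[OF ab, of j i]
      unfolding jacobi_op_monom T_add T_monom by (simp add: algebra_simps)
  qed (simp_all add: T_add T_smult jacobi_op_add jacobi_op_smult right_diff_distrib)
  then show ?thesis by (simp add: T_def)
qed

lemma orthonormal_sphere_frame: "x \<in> sphere_K \<delta> m \<Longrightarrow> orthonormal_family I {..<\<delta>} (frame \<delta> m x)"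
  using \<delta> by (intro orthonormal_frame) (auto simp: sphere_K_eq[OF dims_pos])

lemma integrable_sqinner: "integrable \<sigma> (\<lambda>z. poly P (sqinner \<delta> m x z))"
  unfolding sqinner_def by (intro integrable_polyfun polyfun_poly polyfun_sqproj)

lemma sqinner_range:
  assumes "x \<in> sphere_K \<delta> m" "z \<in> sphere_K \<delta> m"
  shows "sqinner \<delta> m x z \<in> {0..1}"
  using sqproj_le_sqn[OF finite_lessThan orthonormal_sphere_frame[OF assms(1)], of z] assms(2)
  by (simp add: sqinner_def sqproj_nonneg sphere_K_eq[OF dims_pos])

lemma expectation_sqinner:
  assumes "x \<in> sphere_K \<delta> m"
  shows "(\<integral>z. poly P (sqinner \<delta> m x z) \<partial>\<sigma>) = jacobi_mean \<alpha> \<beta> (poly P)"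
proof (rule expectation_eq_jacobi_mean[OF jacobi_parameters integrable_sqinner])
  show "(\<integral>z. poly (jacobi_op \<alpha> \<beta> P) (sqinner \<delta> m x z) \<partial>\<sigma>) = 0" for P
    using sigma_jacobi_op_symmetric[of "frame \<delta> m x" "frame \<delta> m x" 1 P]
      orthonormal_sphere_frame[OF assms]
    by (simp add: sqinner_def)
qed

lemma jacobi_design_of_cubature:
  assumes cubature: "proj_cubature \<delta> m (2 * d) n x \<rho>"
  shows "jacobi_design \<sigma> \<alpha> \<beta> d n \<rho> (\<lambda>i. sqinner \<delta> m (x i))"
proof
  have nodes: "x i \<in> sphere_K \<delta> m" if "i < n" for i
    using cubature that by (simp add: proj_cubature_def)
  have exact: "(\<Sum>i<n. \<rho> i * poly R (sqinner \<delta> m z (x i))) = (\<integral>y. poly R (sqinner \<delta> m z y) \<partial>\<sigma>)"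
    if "degree R \<le> d" for R z
    using \<delta> dims_pos(2) cubature that by (rule proj_cubature_sqinner)
  show "- 1 < \<alpha>" "- 1 < \<beta>" by (rule jacobi_parameters)+
  show "0 \<le> \<rho> i" if "i < n" for i
    using cubature that by (simp add: proj_cubature_def less_imp_le)
  show "(\<Sum>i<n. \<rho> i) = 1"
    using exact[of 1] by (simp add: prob_space)
  show "sqinner \<delta> m (x i) \<in> borel_measurable \<sigma>" for i
    using integrable_sqinner[of "[:0, 1:]" "x i"] by auto
  show "sqinner \<delta> m (x i) z \<in> {0..1}" if "i < n" "z \<in> space \<sigma>" for i z
    using that nodes by (intro sqinner_range) (auto simp: space_sigma_K[OF dims_pos])
  show "(\<integral>z. poly P (sqinner \<delta> m (x i) z) * poly (jacobi_op \<alpha> \<beta> R) (sqinner \<delta> m (x j) z) \<partial>\<sigma>)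
      = (\<integral>z. poly (jacobi_op \<alpha> \<beta> P) (sqinner \<delta> m (x i) z) * poly R (sqinner \<delta> m (x j) z) \<partial>\<sigma>)"
    if "i < n" "j < n" for i j P R
    unfolding sqinner_def using that nodes
    by (intro sigma_jacobi_op_symmetric orthonormal_sphere_frame)
  show "(\<Sum>i<n. \<rho> i * poly R (sqinner \<delta> m (x i) z)) = jacobi_mean \<alpha> \<beta> (poly R)"
    if "degree R \<le> d" "z \<in> space \<sigma>" for R z
    using exact[OF that(1), of z] expectation_sqinner[of z R] that(2) sqinner_commute[OF \<delta>, of m z]
    by (simp add: space_sigma_K[OF dims_pos])
qed

end

lemma Beta_div_incomplete_beta:
  assumes a: "a > -1" and z: "z > 0"
  shows "Beta (b + 1) (a + 1) / incomplete_beta a b z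
    = Gamma (a + 2) * Gamma (b + 1) / (Gamma (a + b + 2) * hyp2F1 (- b) (a + 1) (a + 2) z)
      * (1 / z) powr (a + 1)"
proof -
  have "Gamma (a + 2) = (a + 1) * Gamma (a + 1)"
    using Gamma_plus1[of "a + 1"] a by (auto simp: add.assoc nonpos_Ints_def dest!: Ints_cases)
  moreover have "Beta (b + 1) (a + 1) = Gamma (b + 1) * Gamma (a + 1) / Gamma (a + b + 2)"
    by (simp add: Beta_def add_ac)
  ultimately show ?thesis
    using a z by (simp add: incomplete_beta_def powr_divide divide_simps)
qed

theorem theorem4p1:
  fixes \<delta> m p n :: nat and x :: "nat \<Rightarrow> nat \<times> nat \<Rightarrow> real" and \<rho> :: "nat \<Rightarrow> real"
    and \<alpha> \<beta> \<xi> \<epsilon> :: real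
  assumes "\<delta> \<in> {1, 2, 4}"
    and "m \<ge> 2"
    and "even p" and "p > 0"
    and "\<alpha> = (real (\<delta> * (m - 1)) - 2) / 2"
    and "\<beta> = (real \<delta> - 2) / 2"
    and "\<xi> = Max {t. jacobiP (p div 2) (\<alpha> + 1) (\<beta> + 1) t = 0}"
    and "\<epsilon> = (1 - \<xi>) / 2"
    and "proj_cubature \<delta> m p n x \<rho>"
  shows "real n \<ge> Gamma (\<alpha> + 2) * Gamma (\<beta> + 1)
                  / (Gamma (\<alpha> + \<beta> + 2) * hyp2F1 (- \<beta>) (\<alpha> + 1) (\<alpha> + 2) \<epsilon>)
                  * (1 / \<epsilon>) powr (real (\<delta> * (m - 1)) / 2)"
proof -
  interpret projective_sphere \<delta> m \<alpha> \<beta>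
    using assms(1,2,5,6) by unfold_locales
  define d where "d = p div 2"
  have d: "d > 0" "p = 2 * d" using assms(3,4) by (auto simp: d_def)
  interpret jacobi_design \<sigma> \<alpha> \<beta> d n \<rho> "\<lambda>i. sqinner \<delta> m (x i)"
    using assms(9) unfolding d(2) by (rule jacobi_design_of_cubature)
  define \<tau> where "\<tau> = largest_jacobi_zero d (\<alpha> + 1) (\<beta> + 1)"
  have \<epsilon>: "\<epsilon> = 1 - \<tau>"
    by (simp add: assms(7,8) \<tau>_def d_def largest_jacobi_zero_def field_simps)
  have \<tau>: "0 < \<tau>" "\<tau> < 1"
    using largest_jacobi_zero(1,2)[of "\<alpha> + 1" "\<beta> + 1" d] ab d(1) unfolding \<tau>_def by auto
  have "1 \<le> real n * (incomplete_beta \<alpha> \<beta> \<epsilon> / Beta (\<beta> + 1) (\<alpha> + 1))"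
    using one_le_card_mult_cap[OF d(1)] jacobi_mean_cap[OF ab(1) \<tau>, of \<beta>] by (simp add: \<epsilon> \<tau>_def)
  then have "Beta (\<beta> + 1) (\<alpha> + 1) / incomplete_beta \<alpha> \<beta> \<epsilon> \<le> real n"
    using incomplete_beta_pos[OF ab(1) \<tau>, of \<beta>] Beta_pos[of "\<beta> + 1" "\<alpha> + 1"] ab
    by (simp add: \<epsilon> field_simps)
  moreover have "real (\<delta> * (m - 1)) / 2 = \<alpha> + 1" by (simp add: assms(5) field_simps)
  moreover have "\<epsilon> > 0" using \<tau> by (simp add: \<epsilon>)
  ultimately show ?thesis
    by (simp only: Beta_div_incomplete_beta[OF ab(1)])
qed

end
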